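(* For any Coxeter group $W$, the algebra $\hat{\mathbf{D}}(W)$ is generated by all $D_s$, $s\in\mathcal{S}$, subject to (defining) relations $D_s^2=D_s$, $s\in\mathcal{S}$. Furthermore, $\hat{\mathbf{H}}(W)$ factors as $\hat{\mathbf{H}}(W)=\hat{\mathbf{D}}(W)\cdot\mathbb{Z}W$, i.e., the multiplication map defines an isomorphism of $\mathbb{Z}$-modules $\hat{\mathbf{D}}(W)\otimes_{\mathbb{Z}}\mathbb{Z}W\to\hat{\mathbf{H}}(W)$.
   Context: A Coxeter group $W$ is generated by $s_i$, $i\in I$, subject to relations $(s_is_j)^{m_{ij}}=1$, where $m_{ij}=m_{ji}\in\mathbb{Z}_{\ge 0}$ are such that $m_{ij}=1$ iff $i=j$ ($m_{ij}=0$ imposes no relation). $\hat{\mathbf{H}}(W)$ is the (unital associative) $\mathbb{Z}$-algebra generated by $s_i,D_i$, $i\in I$, subject to relations: (i) $s_i^2=1$, $D_i^2=D_i$, $s_iD_i+D_is_i=s_i-1$ for $i\in I$; (ii) $(s_is_j)^{m_{ij}}=1$; (iii) $\underbrace{D_is_js_i\cdots s_{j'}}_{m_{ij}}=\underbrace{s_j\cdots s_{i'}s_{j'}D_{i'}}_{m_{ij}}$ for all distinct $i,j\in I$ with $m_{ij}\ne 0$, where $i'=i$ if $m_{ij}$ is even, $i'=j$ if $m_{ij}$ is odd, and $\{i',j'\}=\{i,j\}$ (each side has $m_{ij}$ factors with indices alternating between $i$ and $j$). $\mathcal{S}:=\{ws_iw^{-1}\mid w\in W,i\in I\}$ is the set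 of all reflections in $W$. For each $s\in\mathcal{S}$ there is a unique element $D_s\in\hat{\mathbf{H}}(W)$ such that $D_{s_i}=D_i$ for $i\in I$ and $D_{s_iss_i}=s_iD_ss_i$ for any $i\in I$, $s\in\mathcal{S}\setminus\{s_i\}$. $\hat{\mathbf{D}}(W)$ is the subalgebra of $\hat{\mathbf{H}}(W)$ generated by all $D_s$, $s\in\mathcal{S}$. *)

theory Defs
  imports "HOL-Algebra.QuotRing" "HOL-Algebra.Generated_Rings" "HOL-Algebra.Free_Abelian_Groups"
begin

section \<open>Presentations of groups and of rings\<close>

text \<open>A letter \<open>(x, True)\<close> stands for the generator \<open>x\<close>, and \<open>(x, False)\<close> for its formal inverse.\<close>

inductive_set presentation_cong ::
    "'x set \<Rightarrow> ('x \<times> bool) list set \<Rightarrow> (('x \<times> bool) list \<times> ('x \<times> bool) list) set"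
  for X R where
    refl: "u \<in> lists (X \<times> UNIV) \<Longrightarrow> (u, u) \<in> presentation_cong X R"
  | sym: "(u, v) \<in> presentation_cong X R \<Longrightarrow> (v, u) \<in> presentation_cong X R"
  | trans: "\<lbrakk>(u, v) \<in> presentation_cong X R; (v, w) \<in> presentation_cong X R\<rbrakk>
      \<Longrightarrow> (u, w) \<in> presentation_cong X R"
  | cancel: "\<lbrakk>u \<in> lists (X \<times> UNIV); v \<in> lists (X \<times> UNIV); x \<in> X\<rbrakk>
      \<Longrightarrow> (u @ [(x, b), (x, \<not> b)] @ v, u @ v) \<in> presentation_cong X R"
  | relator: "\<lbrakk>u \<in> lists (X \<times> UNIV); v \<in> lists (X \<times> UNIV); r \<in> R\<rbrakk>
      \<Longrightarrow> (u @ r @ v, u @ v) \<in> presentation_cong X R"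

definition presented_group :: "'x set \<Rightarrow> ('x \<times> bool) list set \<Rightarrow> ('x \<times> bool) list set monoid" where
  "presented_group X R =
    \<lparr>carrier = lists (X \<times> UNIV) // presentation_cong X R,
     monoid.mult = (\<lambda>A B. \<Union>a\<in>A. \<Union>b\<in>B. presentation_cong X R `` {a @ b}),
     one = presentation_cong X R `` {[]}\<rparr>"

definition pres_gen :: "'x set \<Rightarrow> ('x \<times> bool) list set \<Rightarrow> 'x \<Rightarrow> ('x \<times> bool) list set" where
  "pres_gen X R x = presentation_cong X R `` {[(x, True)]}"

text \<open>The integral monoid ring: finitely supported integer-valued functions on the monoid, with
  the bilinear extension of the monoid multiplication. Elements are of the same type as those of
  \<^const>\<open>free_Abelian_group\<close>, the basis element for \<open>x\<close> being \<^term>\<open>frag_of x\<close>.\<close>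

definition monoid_ring :: "('a, 'b) monoid_scheme \<Rightarrow> ('a \<Rightarrow>\<^sub>0 int) ring" where
  "monoid_ring M =
    \<lparr>carrier = {f. Poly_Mapping.keys f \<subseteq> carrier M},
     monoid.mult = (\<lambda>f g. frag_extend (\<lambda>x. frag_extend (\<lambda>y. frag_of (x \<otimes>\<^bsub>M\<^esub> y)) g) f),
     one = frag_of \<one>\<^bsub>M\<^esub>, ring.zero = 0, ring.add = (+)\<rparr>"

definition free_ring :: "'x set \<Rightarrow> ('x list \<Rightarrow>\<^sub>0 int) ring" where
  "free_ring X = monoid_ring \<lparr>carrier = lists X, monoid.mult = (@), one = []\<rparr>"

text \<open>The unital associative ring (that is, \<open>\<int>\<close>-algebra) on generators \<open>X\<close> in which the
  elements of \<open>R\<close> become zero.\<close>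

definition presented_ring :: "'x set \<Rightarrow> ('x list \<Rightarrow>\<^sub>0 int) set \<Rightarrow> ('x list \<Rightarrow>\<^sub>0 int) set ring" where
  "presented_ring X R = free_ring X Quot (genideal (free_ring X) R)"

definition ring_gen :: "'x set \<Rightarrow> ('x list \<Rightarrow>\<^sub>0 int) set \<Rightarrow> 'x \<Rightarrow> ('x list \<Rightarrow>\<^sub>0 int) set" where
  "ring_gen X R x = genideal (free_ring X) R +>\<^bsub>free_ring X\<^esub> frag_of [x]"


section \<open>Tensor products of abelian groups\<close>

definition tensor_relators :: "('a, 'c) monoid_scheme \<Rightarrow> ('b, 'd) monoid_scheme
    \<Rightarrow> (('a \<times> 'b) \<Rightarrow>\<^sub>0 int) set" where
  "tensor_relators A B =
    {frag_of (a \<otimes>\<^bsub>A\<^esub> a', b) - frag_of (a, b) - frag_of (a', b) | a a' b.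
      a \<in> carrier A \<and> a' \<in> carrier A \<and> b \<in> carrier B} \<union>
    {frag_of (a, b \<otimes>\<^bsub>B\<^esub> b') - frag_of (a, b) - frag_of (a, b') | a b b'.
      a \<in> carrier A \<and> b \<in> carrier B \<and> b' \<in> carrier B}"

definition tensor_subgroup :: "('a, 'c) monoid_scheme \<Rightarrow> ('b, 'd) monoid_scheme
    \<Rightarrow> (('a \<times> 'b) \<Rightarrow>\<^sub>0 int) set" where
  "tensor_subgroup A B =
    generate (free_Abelian_group (carrier A \<times> carrier B)) (tensor_relators A B)"

definition tensor_group :: "('a, 'c) monoid_scheme \<Rightarrow> ('b, 'd) monoid_scheme
    \<Rightarrow> (('a \<times> 'b) \<Rightarrow>\<^sub>0 int) set monoid" where
  "tensor_group A B = free_Abelian_group (carrier A \<times> carrier B) Mod tensor_subgroup A B"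

definition pure_tensor :: "('a, 'c) monoid_scheme \<Rightarrow> ('b, 'd) monoid_scheme
    \<Rightarrow> 'a \<Rightarrow> 'b \<Rightarrow> (('a \<times> 'b) \<Rightarrow>\<^sub>0 int) set" where
  "pure_tensor A B a b =
    tensor_subgroup A B #>\<^bsub>free_Abelian_group (carrier A \<times> carrier B)\<^esub> frag_of (a, b)"


section \<open>Coxeter groups\<close>

definition coxeter_matrix :: "'i set \<Rightarrow> ('i \<Rightarrow> 'i \<Rightarrow> nat) \<Rightarrow> bool" where
  "coxeter_matrix I m \<longleftrightarrow> (\<forall>i\<in>I. \<forall>j\<in>I. m i j = m j i \<and> (m i j = 1 \<longleftrightarrow> i = j))"

text \<open>For \<open>m i j = 0\<close> the relator below is the empty word, so it imposes no relation.\<close>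

definition coxeter_relators :: "'i set \<Rightarrow> ('i \<Rightarrow> 'i \<Rightarrow> nat) \<Rightarrow> ('i \<times> bool) list set" where
  "coxeter_relators I m =
    {concat (replicate (m i j) [(i, True), (j, True)]) | i j. i \<in> I \<and> j \<in> I}"

definition coxeter_group :: "'i set \<Rightarrow> ('i \<Rightarrow> 'i \<Rightarrow> nat) \<Rightarrow> ('i \<times> bool) list set monoid" where
  "coxeter_group I m = presented_group I (coxeter_relators I m)"

definition simple_refl :: "'i set \<Rightarrow> ('i \<Rightarrow> 'i \<Rightarrow> nat) \<Rightarrow> 'i \<Rightarrow> ('i \<times> bool) list set" where
  "simple_refl I m i = pres_gen I (coxeter_relators I m) i"

definition reflections :: "'i set \<Rightarrow> ('i \<Rightarrow> 'i \<Rightarrow> nat) \<Rightarrow> ('i \<times> bool) list set set" where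
  "reflections I m =
    {w \<otimes>\<^bsub>coxeter_group I m\<^esub> simple_refl I m i \<otimes>\<^bsub>coxeter_group I m\<^esub> inv\<^bsub>coxeter_group I m\<^esub> w | w i.
      w \<in> carrier (coxeter_group I m) \<and> i \<in> I}"


section \<open>The algebras \<open>\<^bold>H(W)\<close> and \<open>\<^bold>D(W)\<close>\<close>

datatype 'i hecke_gen = GenS 'i | GenD 'i

text \<open>The word \<open>s\<^sub>i s\<^sub>j s\<^sub>i \<dots>\<close> with \<open>n\<close> alternating factors, starting with \<open>s\<^sub>i\<close>.\<close>

definition alt_word :: "nat \<Rightarrow> 'i \<Rightarrow> 'i \<Rightarrow> 'i hecke_gen list" where
  "alt_word n i j = map (\<lambda>k. GenS (if even k then i else j)) [0..<n]"

text \<open>A relation \<open>a = b\<close> is represented by \<open>a - b\<close>. The last set is the relation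
  \<open>D\<^sub>i s\<^sub>j s\<^sub>i \<dots> = \<dots> s\<^sub>i s\<^sub>j D\<^sub>i\<close> with \<open>m i j\<close> factors on each side: both sides contain the same word
  in the \<open>s\<close> of length \<open>m i j - 1\<close>, which starts with \<open>s\<^sub>j\<close>.\<close>

definition hecke_relators :: "'i set \<Rightarrow> ('i \<Rightarrow> 'i \<Rightarrow> nat) \<Rightarrow> ('i hecke_gen list \<Rightarrow>\<^sub>0 int) set" where
  "hecke_relators I m =
    {frag_of [GenS i, GenS i] - frag_of [] | i. i \<in> I} \<union>
    {frag_of [GenD i, GenD i] - frag_of [GenD i] | i. i \<in> I} \<union>
    {(frag_of [GenS i, GenD i] + frag_of [GenD i, GenS i]) - (frag_of [GenS i] - frag_of [])
      | i. i \<in> I} \<union>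
    {frag_of (concat (replicate (m i j) [GenS i, GenS j])) - frag_of [] | i j. i \<in> I \<and> j \<in> I} \<union>
    {frag_of (GenD i # alt_word (m i j - 1) j i)
      - frag_of (alt_word (m i j - 1) j i @ [GenD (if even (m i j) then i else j)])
      | i j. i \<in> I \<and> j \<in> I \<and> i \<noteq> j \<and> m i j \<noteq> 0}"

definition hecke_gens :: "'i set \<Rightarrow> 'i hecke_gen set" where
  "hecke_gens I = GenS ` I \<union> GenD ` I"

definition H_hat :: "'i set \<Rightarrow> ('i \<Rightarrow> 'i \<Rightarrow> nat) \<Rightarrow> ('i hecke_gen list \<Rightarrow>\<^sub>0 int) set ring" where
  "H_hat I m = presented_ring (hecke_gens I) (hecke_relators I m)"

definition H_s :: "'i set \<Rightarrow> ('i \<Rightarrow> 'i \<Rightarrow> nat) \<Rightarrow> 'i \<Rightarrow> ('i hecke_gen list \<Rightarrow>\<^sub>0 int) set" where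
  "H_s I m i = ring_gen (hecke_gens I) (hecke_relators I m) (GenS i)"

definition H_D :: "'i set \<Rightarrow> ('i \<Rightarrow> 'i \<Rightarrow> nat) \<Rightarrow> 'i \<Rightarrow> ('i hecke_gen list \<Rightarrow>\<^sub>0 int) set" where
  "H_D I m i = ring_gen (hecke_gens I) (hecke_relators I m) (GenD i)"

text \<open>The unique family \<open>(D\<^sub>s)\<close>, indexed by the reflections \<open>s\<close>, that extends the generators
  \<open>D\<^sub>i\<close> and is compatible with conjugation by the \<open>s\<^sub>i\<close>.\<close>

definition is_D_family :: "'i set \<Rightarrow> ('i \<Rightarrow> 'i \<Rightarrow> nat)
    \<Rightarrow> (('i \<times> bool) list set \<Rightarrow> ('i hecke_gen list \<Rightarrow>\<^sub>0 int) set) \<Rightarrow> bool" where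
  "is_D_family I m D \<longleftrightarrow>
    D \<in> reflections I m \<rightarrow>\<^sub>E carrier (H_hat I m) \<and>
    (\<forall>i\<in>I. D (simple_refl I m i) = H_D I m i) \<and>
    (\<forall>i\<in>I. \<forall>s\<in>reflections I m - {simple_refl I m i}.
      D (simple_refl I m i \<otimes>\<^bsub>coxeter_group I m\<^esub> s \<otimes>\<^bsub>coxeter_group I m\<^esub> simple_refl I m i) =
      H_s I m i \<otimes>\<^bsub>H_hat I m\<^esub> D s \<otimes>\<^bsub>H_hat I m\<^esub> H_s I m i)"

definition D_refl :: "'i set \<Rightarrow> ('i \<Rightarrow> 'i \<Rightarrow> nat)
    \<Rightarrow> ('i \<times> bool) list set \<Rightarrow> ('i hecke_gen list \<Rightarrow>\<^sub>0 int) set" where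
  "D_refl I m = (THE D. is_D_family I m D)"

definition D_hat :: "'i set \<Rightarrow> ('i \<Rightarrow> 'i \<Rightarrow> nat) \<Rightarrow> ('i hecke_gen list \<Rightarrow>\<^sub>0 int) set ring" where
  "D_hat I m =
    (H_hat I m)\<lparr>carrier := generate_ring (H_hat I m) (D_refl I m ` reflections I m)\<rparr>"

text \<open>The canonical ring homomorphism from the group ring \<open>\<int>W\<close> to \<open>\<^bold>H(W)\<close>; it is determined by
  \<open>s\<^sub>i \<mapsto> s\<^sub>i\<close>.\<close>

definition group_ring_map :: "'i set \<Rightarrow> ('i \<Rightarrow> 'i \<Rightarrow> nat)
    \<Rightarrow> (('i \<times> bool) list set \<Rightarrow>\<^sub>0 int) \<Rightarrow> ('i hecke_gen list \<Rightarrow>\<^sub>0 int) set" where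
  "group_ring_map I m =
    (THE h. h \<in> ring_hom (monoid_ring (coxeter_group I m)) (H_hat I m) \<and>
            h \<in> extensional (carrier (monoid_ring (coxeter_group I m))) \<and>
            (\<forall>i\<in>I. h (frag_of (simple_refl I m i)) = H_s I m i))"

definition idempotent_relators :: "'x set \<Rightarrow> ('x list \<Rightarrow>\<^sub>0 int) set" where
  "idempotent_relators X = {frag_of [x, x] - frag_of [x] | x. x \<in> X}"

end

theory Submission
  imports Defs Complex_Main
begin

text \<open>
  Spanning is a rewriting argument: \<open>s\<^sub>i D\<^sub>t = D\<^sub>t\<^sub>' s\<^sub>i\<close> with \<open>t' = s\<^sub>i t s\<^sub>i\<close> if \<open>t \<noteq> s\<^sub>i\<close>, and
  \<open>s\<^sub>i D\<^sub>i = (1 - D\<^sub>i) s\<^sub>i - 1\<close>. For independence, let \<open>T\<close> be the ring generated by idempotents \<open>e\<^sub>t\<close>,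
  one for each reflection \<open>t\<close>. Then \<open>\<^bold>H(W)\<close> acts on the functions \<open>f : W \<rightarrow> T\<close> by \<open>(s\<^sub>i f)(x) = f(s\<^sub>i x)\<close>
  and, with \<open>r = x\<^sup>-\<^sup>1 t x\<close>, by \<open>(D\<^sub>t f)(x) = e\<^sub>r f(x)\<close> if \<open>t x\<close> is longer than \<open>x\<close> and
  \<open>(D\<^sub>t f)(x) = f(x) - e\<^sub>r f(x) - f(t x)\<close> if it is shorter. As \<open>(D\<^sub>t f)(1) = e\<^sub>t f(1)\<close>, evaluating
  \<open>\<Sum> d\<^sub>w w\<close> at \<open>1\<close> on the indicator function of \<open>v\<^sup>-\<^sup>1\<close> recovers \<open>d\<^sub>v\<close>.

  That \<open>D\<^sub>t = w D\<^sub>i w\<^sup>-\<^sup>1\<close> for \<open>t = w s\<^sub>i w\<^sup>-\<^sup>1\<close> with \<open>w s\<^sub>i\<close> longer than \<open>w\<close> is well defined amounts to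
  \<open>v D\<^sub>i = D\<^sub>j v\<close> whenever \<open>v\<close> maps the simple root of \<open>i\<close> to that of \<open>j\<close>. By an argument of Deodhar,
  such a \<open>v\<close> is a product of elements of finite dihedral parabolic subgroups, for which the equation
  is relation (iii). This needs that \<open>s\<^sub>i s\<^sub>j\<close> has order exactly \<open>m i j\<close>, shown with the
  geometric representation; positivity of roots is replaced by the inversion cocycle.
\<close>


section \<open>Monoid rings and presented rings\<close>

text \<open>The action has the form of a coinduced module. If \<open>H\<close> were already known to
  be free over the subalgebra of the \<open>D_t\<close> with basis \<open>W\<close>, a left linear
  map from \<open>H\<close> to \<open>T\<close> would be a function \<open>f\<close> on
  \<open>W\<close>, with \<open>f(x)\<close> its value at \<open>x^-1\<close>. Rewriting
  \<open>x^-1 D_t\<close> gives \<open>D_r x^-1\<close>, or \<open>x^-1 - D_r x^-1 - r x^-1\<close>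
  if \<open>x^-1\<close> makes the root of \<open>t\<close> negative, because
  \<open>s_i D_i s_i = 1 - s_i - D_i\<close>. Taking the outcome as a definition of operators avoids
  the circle: it presupposes neither freeness nor the family \<open>D_t\<close>, and only the
  defining relations of \<open>H\<close> remain to be checked.

  One question of sign runs through both halves: conjugation by \<open>w\<close> carries
  \<open>D_t\<close> to the idempotent of the conjugate reflection if \<open>w\<close> keeps the
  root of \<open>t\<close> positive. Its cocycle identity yields the well-definedness of the
  \<open>D_t\<close> and also relation (iii) for the operators. The exact order \<open>m i j\<close>
  is needed in both places: it identifies the dihedral factors in the first, and in the second it
  guarantees that the alternating word of length \<open>m i j - 1\<close> inverts nothing it should
  not.\<close>

abbreviation (input) "supp \<equiv> Poly_Mapping.keys"

lemma carrier_monoid_ring [simp]: "f \<in> carrier (monoid_ring M) \<longleftrightarrow> supp f \<subseteq> carrier M"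
  and zero_monoid_ring [simp]: "\<zero>\<^bsub>monoid_ring M\<^esub> = 0"
  and one_monoid_ring [simp]: "\<one>\<^bsub>monoid_ring M\<^esub> = frag_of \<one>\<^bsub>M\<^esub>"
  and add_monoid_ring [simp]: "f \<oplus>\<^bsub>monoid_ring M\<^esub> g = f + g"
  by (simp_all add: monoid_ring_def)

lemma keys_diff_subset:
  "supp p \<subseteq> A \<Longrightarrow> supp q \<subseteq> A \<Longrightarrow> supp (p - q) \<subseteq> A"
  by (meson keys_diff Un_least order_trans)

text \<open>Since \<open>0\<close>, the basis elements and differences generate the free abelian
  group, subtraction is the only operation to be treated when a linear statement is extended from
  basis elements.\<close>

lemmas frag_induct = free_Abelian_group_induct[consumes 1, case_names zero diff one]

text \<open>In the product of a monoid ring the extension over the second factor sits inside the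
  function that is extended over the first, so linearity in the second factor rests on linearity of
  \<open>frag_extend\<close> in that function.\<close>

lemma frag_extend_add_fun: "frag_extend (\<lambda>x. f x + g x) a = frag_extend f a + frag_extend g a"
  by (simp add: frag_extend_def frag_cmul_distrib2 sum.distrib)

lemma frag_extend_diff_fun: "frag_extend (\<lambda>x. f x - g x) a = frag_extend f a - frag_extend g a"
proof -
  have "frag_cmul c (f x - g x) = frag_cmul c (f x) - frag_cmul c (g x)" for c x
    by (metis add_diff_cancel_right' diff_add_cancel frag_cmul_distrib2)
  then show ?thesis
    by (simp add: frag_extend_def flip: sum_subtractf)
qed

lemma mult_monoid_ring_zero [simp]:
  "0 \<otimes>\<^bsub>monoid_ring M\<^esub> g = 0" "f \<otimes>\<^bsub>monoid_ring M\<^esub> 0 = 0"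
  by (simp_all add: monoid_ring_def frag_extend_eq_0)

lemma mult_monoid_ring_of [simp]:
  "frag_of x \<otimes>\<^bsub>monoid_ring M\<^esub> frag_of y = frag_of (x \<otimes>\<^bsub>M\<^esub> y)"
  by (simp add: monoid_ring_def)

lemma mult_monoid_ring_distrib:
  "(f + f') \<otimes>\<^bsub>monoid_ring M\<^esub> g = f \<otimes>\<^bsub>monoid_ring M\<^esub> g + f' \<otimes>\<^bsub>monoid_ring M\<^esub> g"
  "f \<otimes>\<^bsub>monoid_ring M\<^esub> (g + g') = f \<otimes>\<^bsub>monoid_ring M\<^esub> g + f \<otimes>\<^bsub>monoid_ring M\<^esub> g'"
  "(f - f') \<otimes>\<^bsub>monoid_ring M\<^esub> g = f \<otimes>\<^bsub>monoid_ring M\<^esub> g - f' \<otimes>\<^bsub>monoid_ring M\<^esub> g"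
  "f \<otimes>\<^bsub>monoid_ring M\<^esub> (g - g') = f \<otimes>\<^bsub>monoid_ring M\<^esub> g - f \<otimes>\<^bsub>monoid_ring M\<^esub> g'"
  by (simp_all add: monoid_ring_def frag_extend_add frag_extend_diff frag_extend_add_fun
      frag_extend_diff_fun)

lemma monoid_ring_mult_closed:
  assumes "monoid M" "supp f \<subseteq> carrier M" "supp g \<subseteq> carrier M"
  shows "supp (f \<otimes>\<^bsub>monoid_ring M\<^esub> g) \<subseteq> carrier M"
  using assms(2)
proof (induction f rule: frag_induct)
  case (one x)
  show ?case
    using assms(3)
  proof (induction g rule: frag_induct)
    case (diff a b)
    then show ?case
      unfolding mult_monoid_ring_distrib by (meson keys_diff Un_least order_trans)
  qed (use one assms(1) in \<open>auto simp: monoid.m_closed\<close>)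
next
  case (diff a b)
  then show ?case
    unfolding mult_monoid_ring_distrib by (meson keys_diff Un_least order_trans)
qed auto

lemma monoid_ring_mult_assoc:
  assumes "monoid M" "supp f \<subseteq> carrier M" "supp g \<subseteq> carrier M"
    "supp h \<subseteq> carrier M"
  shows "(f \<otimes>\<^bsub>monoid_ring M\<^esub> g) \<otimes>\<^bsub>monoid_ring M\<^esub> h = f \<otimes>\<^bsub>monoid_ring M\<^esub> (g \<otimes>\<^bsub>monoid_ring M\<^esub> h)"
  using assms(2)
proof (induction f rule: frag_induct)
  case (one x)
  show ?case
    using assms(3)
  proof (induction g rule: frag_induct)
    case (one y)
    show ?case
      using assms(4)
      by (induction h rule: frag_induct)
        (use \<open>x \<in> carrier M\<close> one assms(1) in \<open>auto simp: mult_monoid_ring_distrib monoid.m_assoc\<close>)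
  qed (auto simp: mult_monoid_ring_distrib)
qed (auto simp: mult_monoid_ring_distrib)

lemma monoid_ring_one:
  assumes "monoid M" "supp f \<subseteq> carrier M"
  shows "frag_of \<one>\<^bsub>M\<^esub> \<otimes>\<^bsub>monoid_ring M\<^esub> f = f" "f \<otimes>\<^bsub>monoid_ring M\<^esub> frag_of \<one>\<^bsub>M\<^esub> = f"
proof -
  interpret M: monoid M by fact
  show "frag_of \<one>\<^bsub>M\<^esub> \<otimes>\<^bsub>monoid_ring M\<^esub> f = f" "f \<otimes>\<^bsub>monoid_ring M\<^esub> frag_of \<one>\<^bsub>M\<^esub> = f"
    using assms(2)
    by (induction f rule: frag_induct) (auto simp: mult_monoid_ring_distrib)
qed

lemma ring_monoid_ring: 
  assumes "monoid M"
  shows "ring (monoid_ring M)"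
proof (rule ringI)
  show "abelian_group (monoid_ring M)"
  proof (rule abelian_groupI)
    show "\<exists>y\<in>carrier (monoid_ring M). y \<oplus>\<^bsub>monoid_ring M\<^esub> x = \<zero>\<^bsub>monoid_ring M\<^esub>"
      if "x \<in> carrier (monoid_ring M)" for x
      by (rule bexI[of _ "- x"]) (use that in auto)
  qed (use subsetD[OF keys_add] in \<open>fastforce simp: add_ac\<close>)+
  show "monoid (monoid_ring M)"
    by (rule monoidI) (use assms in \<open>auto simp: monoid_ring_mult_closed monoid_ring_one
      monoid_ring_mult_assoc monoid.one_closed subsetD[OF monoid_ring_mult_closed]\<close>)
qed (auto simp: mult_monoid_ring_distrib)

lemma ring_hom_minus:
  assumes "ring R" "ring S" "h \<in> ring_hom R S" "a \<in> carrier R" "b \<in> carrier R"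
  shows "h (a \<ominus>\<^bsub>R\<^esub> b) = h a \<ominus>\<^bsub>S\<^esub> h b"
proof -
  interpret ring_hom_ring R S h
    by (rule ring_hom_ringI2[OF assms(1-3)])
  show ?thesis
    using assms(4,5) by (simp add: R.minus_eq S.minus_eq)
qed

lemma a_minus_monoid_ring:
  assumes "monoid M" "supp f \<subseteq> carrier M" "supp g \<subseteq> carrier M"
  shows "f \<ominus>\<^bsub>monoid_ring M\<^esub> g = f - g"
proof -
  interpret ring "monoid_ring M" by (rule ring_monoid_ring) fact
  have "\<ominus>\<^bsub>monoid_ring M\<^esub> g = - g"
    by (rule minus_equality) (use assms in auto)
  then show ?thesis by (simp add: a_minus_def)
qed

lemma ring_hom_monoid_ring_diff:
  assumes "monoid M" "ring A" "h \<in> ring_hom (monoid_ring M) A"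
    "supp f \<subseteq> carrier M" "supp g \<subseteq> carrier M"
  shows "h (f - g) = h f \<ominus>\<^bsub>A\<^esub> h g"
proof -
  interpret ring_hom_ring "monoid_ring M" A h
    by (rule ring_hom_ringI2) (use assms ring_monoid_ring in auto)
  show ?thesis
    using assms hom_add[of f "\<ominus>\<^bsub>monoid_ring M\<^esub> g"] hom_a_inv[of g] R.a_inv_closed[of g]
    by (simp add: R.minus_eq S.minus_eq flip: a_minus_monoid_ring[OF assms(1)])
qed

lemma ring_hom_monoid_ring_cong:
  assumes "monoid M" "ring A" "h \<in> ring_hom (monoid_ring M) A" "h' \<in> ring_hom (monoid_ring M) A"
    "\<And>x. x \<in> carrier M \<Longrightarrow> h (frag_of x) = h' (frag_of x)" "supp f \<subseteq> carrier M"
  shows "h f = h' f"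
  using assms(6)
proof (induction f rule: frag_induct)
  case zero
  have *: "h 0 = \<zero>\<^bsub>A\<^esub>" if "h \<in> ring_hom (monoid_ring M) A" for h
  proof -
    interpret ring_hom_ring "monoid_ring M" A h
      by (rule ring_hom_ringI2) (use that assms ring_monoid_ring in auto)
    show ?thesis using hom_zero by simp
  qed
  from *[OF assms(3)] *[OF assms(4)] show ?case by simp
next
  case (diff f g)
  then show ?case
    using assms by (simp add: ring_hom_monoid_ring_diff[of M A])
qed (use assms in auto)

text \<open>The free abelian group supplies the additive map. Both sides of multiplicativity are
  additive in each factor, so they need comparing only on basis elements, where \<open>g\<close> is
  multiplicative.\<close>

lemma monoid_ring_universal:
  assumes "monoid M" "ring A" and g: "g \<in> hom M A" "g \<one>\<^bsub>M\<^esub> = \<one>\<^bsub>A\<^esub>"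
  obtains h where "h \<in> ring_hom (monoid_ring M) A"
    "\<And>x. x \<in> carrier M \<Longrightarrow> h (frag_of x) = g x"
proof -
  interpret M: monoid M by fact
  interpret A: ring A by fact
  obtain h where h: "h \<in> hom (free_Abelian_group (carrier M)) (add_monoid A)"
      "\<And>x. x \<in> carrier M \<Longrightarrow> h (frag_of x) = g x"
    by (rule comm_group.free_Abelian_group_universal[OF A.a_comm_group, of g "carrier M"])
      (use g(1) in \<open>auto simp: hom_def\<close>)
  have closed: "h f \<in> carrier A" if "supp f \<subseteq> carrier M" for f
    using h(1) that by (auto simp: hom_def)
  have add: "h (f + f') = h f \<oplus>\<^bsub>A\<^esub> h f'"
    if "supp f \<subseteq> carrier M" "supp f' \<subseteq> carrier M" for f f'
    using h(1) that by (auto simp: hom_def)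
  have h_zero: "h 0 = \<zero>\<^bsub>A\<^esub>"
    using add[of 0 0] closed[of 0] A.add.l_cancel_one'[of "h 0" "h 0"] by simp
  have h_diff: "h (f - f') = h f \<ominus>\<^bsub>A\<^esub> h f'"
    if "supp f \<subseteq> carrier M" "supp f' \<subseteq> carrier M" for f f'
  proof -
    have "supp (f - f') \<subseteq> carrier M"
      using that by (meson keys_diff Un_least order_trans)
    then have "h f = h (f - f') \<oplus>\<^bsub>A\<^esub> h f'"
      using add[of "f - f'" f'] that by simp
    then show ?thesis
      using that \<open>supp (f - f') \<subseteq> carrier M\<close>
      by (simp add: A.minus_eq A.add.inv_solve_right' A.add.m_assoc closed A.r_neg)
  qed
  have kd: "supp (f - f') \<subseteq> carrier M"
    if "supp f \<subseteq> carrier M" "supp f' \<subseteq> carrier M" for f f' :: "'a \<Rightarrow>\<^sub>0 int"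
    using that by (meson keys_diff Un_least order_trans)
  have mc: "supp (f \<otimes>\<^bsub>monoid_ring M\<^esub> f') \<subseteq> carrier M"
    if "supp f \<subseteq> carrier M" "supp f' \<subseteq> carrier M" for f f' :: "'a \<Rightarrow>\<^sub>0 int"
    using that monoid_ring_mult_closed assms(1) by metis
  have gg: "g x \<in> carrier A" if "x \<in> carrier M" for x
    using g that by (auto simp: hom_def)
  have gm: "g (x \<otimes>\<^bsub>M\<^esub> y) = g x \<otimes>\<^bsub>A\<^esub> g y" if "x \<in> carrier M" "y \<in> carrier M" for x y
    using g that by (auto simp: hom_def)
  have mult: "h (f \<otimes>\<^bsub>monoid_ring M\<^esub> f') = h f \<otimes>\<^bsub>A\<^esub> h f'"
    if f: "supp f \<subseteq> carrier M" "supp f' \<subseteq> carrier M" for f f'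
    using f(1)
  proof (induction f rule: frag_induct)
    case zero
    then show ?case using f by (simp add: h_zero closed)
  next
    case (diff a b)
    then show ?case
      using f by (simp add: mult_monoid_ring_distrib h_diff closed mc A.minus_eq A.l_distr A.l_minus)
  next
    case (one x)
    show ?case
      using f(2)
    proof (induction f' rule: frag_induct)
      case zero
      then show ?case using one by (simp add: h_zero closed)
    next
      case (diff a b)
      then show ?case
        using one by (simp add: mult_monoid_ring_distrib h_diff closed mc A.minus_eq A.r_distr A.r_minus)
    next
      case (one y)
      then show ?case
        using \<open>x \<in> carrier M\<close> h(2) by (simp add: gm)
    qed
  qed
  show thesis
  proof (rule that)
    show "h \<in> ring_hom (monoid_ring M) A"
      by (rule ring_hom_memI) (use closed mult add g(2) h(2) in auto)
  qed (rule h(2))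
qed

section \<open>Free rings and their universal property\<close>

lemma monoid_lists: "monoid \<lparr>carrier = lists X, monoid.mult = (@), one = []\<rparr>"
  by (rule monoidI) auto

lemma ring_free_ring: "ring (free_ring X)"
  unfolding free_ring_def by (intro ring_monoid_ring monoid_lists)

lemma carrier_free_ring [simp]: "f \<in> carrier (free_ring X) \<longleftrightarrow> supp f \<subseteq> lists X"
  and zero_free_ring [simp]: "\<zero>\<^bsub>free_ring X\<^esub> = 0"
  and one_free_ring [simp]: "\<one>\<^bsub>free_ring X\<^esub> = frag_of []"
  and add_free_ring [simp]: "f \<oplus>\<^bsub>free_ring X\<^esub> g = f + g"
  and mult_free_ring_of [simp]: "frag_of u \<otimes>\<^bsub>free_ring X\<^esub> frag_of v = frag_of (u @ v)"
  by (simp_all add: free_ring_def)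

lemmas mult_free_ring_distrib =
  mult_monoid_ring_distrib[where M = "\<lparr>carrier = lists X, monoid.mult = (@), one = []\<rparr>" for X,
    folded free_ring_def]

lemmas mult_free_ring_zero [simp] =
  mult_monoid_ring_zero[where M = "\<lparr>carrier = lists X, monoid.mult = (@), one = []\<rparr>" for X,
    folded free_ring_def]


lemma a_inv_free_ring: "supp p \<subseteq> lists X \<Longrightarrow> \<ominus>\<^bsub>free_ring X\<^esub> p = - p"
  by (rule abelian_group.minus_equality[OF ring.is_abelian_group[OF ring_free_ring]]) simp_all

lemma ring_hom_free_ring_diff:
  assumes "ring A" "h \<in> ring_hom (free_ring X) A"
    "supp f \<subseteq> lists X" "supp g \<subseteq> lists X"
  shows "h (f - g) = h f \<ominus>\<^bsub>A\<^esub> h g"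
  using ring_hom_monoid_ring_diff[OF monoid_lists, of A h X] assms unfolding free_ring_def by simp


lemma free_ring_universal:
  assumes "ring A" "g ` X \<subseteq> carrier A"
  obtains h where "h \<in> ring_hom (free_ring X) A" "\<And>x. x \<in> X \<Longrightarrow> h (frag_of [x]) = g x"
proof -
  interpret A: ring A by fact
  let ?M = "\<lparr>carrier = lists X, monoid.mult = (@), one = []\<rparr>"
  let ?g = "\<lambda>u. foldr (\<lambda>x y. g x \<otimes>\<^bsub>A\<^esub> y) u \<one>\<^bsub>A\<^esub>"
  have cl: "?g u \<in> carrier A" if "u \<in> lists X" for u
    using that assms(2) by (induction u) auto
  have "?g (u @ v) = ?g u \<otimes>\<^bsub>A\<^esub> ?g v" if "u \<in> lists X" "v \<in> lists X" for u v
    using that(1) 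
  proof (induction u)
    case (Cons x u)
    then show ?case
      using assms(2) cl that(2) cl[of u] cl[of v] by (auto simp: image_subset_iff A.m_assoc)
  qed (use cl that in auto)
  then have "?g \<in> hom ?M A"
    by (auto simp: hom_def cl)
  then obtain h where "h \<in> ring_hom (monoid_ring ?M) A"
    "\<And>x. x \<in> carrier ?M \<Longrightarrow> h (frag_of x) = ?g x"
    by (rule monoid_ring_universal[OF monoid_lists assms(1)]) auto
  then show thesis
    using that[of h] assms(2) A.r_one by (simp add: free_ring_def image_subset_iff)
qed

section \<open>Rings given by generators and relations\<close>

locale presentation =
  fixes X :: "'x set" and R :: "('x list \<Rightarrow>\<^sub>0 int) set"
  assumes relators_closed: "R \<subseteq> carrier (free_ring X)"
begin

abbreviation "FR \<equiv> free_ring X"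
abbreviation "PR \<equiv> presented_ring X R"

sublocale free: ring "free_ring X"
  by (rule ring_free_ring)

abbreviation relideal where "relideal \<equiv> genideal (free_ring X) R"

sublocale relideal: ideal relideal "free_ring X"
  by (rule free.genideal_ideal[OF relators_closed])

sublocale pres: ring "presented_ring X R"
  unfolding presented_ring_def by (rule relideal.quotient_is_ring)

definition proj where "proj p = relideal +>\<^bsub>FR\<^esub> p"

lemma proj_hom: "proj \<in> ring_hom (free_ring X) (presented_ring X R)"
  using relideal.rcos_ring_hom unfolding presented_ring_def proj_def[abs_def] .

sublocale proj: ring_hom_ring "free_ring X" "presented_ring X R" proj
  by (rule ring_hom_ringI2[OF ring_free_ring pres.ring_axioms proj_hom])

lemma proj_surj: "a \<in> carrier PR \<Longrightarrow> \<exists>p. supp p \<subseteq> lists X \<and> a = proj p"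
  unfolding presented_ring_def FactRing_def proj_def A_RCOSETS_def'
  by (simp only: partial_object.simps UN_iff singleton_iff Bex_def carrier_free_ring)

lemma proj_eq_zero_iff:
  assumes "supp p \<subseteq> lists X"
  shows "proj p = \<zero>\<^bsub>PR\<^esub> \<longleftrightarrow> p \<in> relideal"
proof -
  have "\<zero>\<^bsub>PR\<^esub> = relideal"
    by (simp add: presented_ring_def FactRing_def)
  then show ?thesis
    unfolding proj_def using assms relideal.a_rcos_const[of p] relideal.a_rcos_self[of p] by auto
qed

lemma proj_diff:
  "supp p \<subseteq> lists X \<Longrightarrow> supp q \<subseteq> lists X \<Longrightarrow>
    proj (p - q) = proj p \<ominus>\<^bsub>PR\<^esub> proj q"
  by (rule ring_hom_free_ring_diff[OF pres.ring_axioms proj_hom])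

lemma proj_eq_iff:
  assumes "supp p \<subseteq> lists X" "supp q \<subseteq> lists X"
  shows "proj p = proj q \<longleftrightarrow> p - q \<in> relideal"
proof -
  have "supp (p - q) \<subseteq> lists X"
    using assms by (meson keys_diff Un_least order_trans)
  from proj_eq_zero_iff[OF this] show ?thesis
    using assms by (simp add: proj_diff)
qed

lemma relator_proj: 
  assumes "p - q \<in> R" "supp p \<subseteq> lists X" "supp q \<subseteq> lists X"
  shows "proj p = proj q"
  using assms proj_eq_iff subsetD[OF free.genideal_self[OF relators_closed] assms(1)] by simp

lemma ring_gen_proj: "ring_gen X R x = proj (frag_of [x])"
  by (simp add: ring_gen_def proj_def)

lemma ring_gen_closed [simp]: "x \<in> X \<Longrightarrow> ring_gen X R x \<in> carrier PR"
  by (simp add: ring_gen_proj)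

lemma proj_Nil: "proj (frag_of []) = \<one>\<^bsub>PR\<^esub>"
  using proj.hom_one by simp

lemma proj_append:
  assumes "u \<in> lists X" "v \<in> lists X"
  shows "proj (frag_of (u @ v)) = proj (frag_of u) \<otimes>\<^bsub>PR\<^esub> proj (frag_of v)"
  using proj.hom_mult[of "frag_of u" "frag_of v"] assms by auto

lemma proj_Cons:
  assumes "x \<in> X" "u \<in> lists X"
  shows "proj (frag_of (x # u)) = ring_gen X R x \<otimes>\<^bsub>PR\<^esub> proj (frag_of u)"
  using proj_append[of "[x]" u] assms by (simp add: ring_gen_proj)

text \<open>Every element is the class of an integral combination of words, so the induction on the
  free abelian group descends to the quotient.\<close>

lemma proj_induct [consumes 1, case_names zero word diff]:
  assumes "a \<in> carrier PR" "P \<zero>\<^bsub>PR\<^esub>"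
    "\<And>u. u \<in> lists X \<Longrightarrow> P (proj (frag_of u))"
    "\<And>a b. a \<in> carrier PR \<Longrightarrow> b \<in> carrier PR \<Longrightarrow>
      P a \<Longrightarrow> P b \<Longrightarrow> P (a \<ominus>\<^bsub>PR\<^esub> b)"
  shows "P a"
proof -
  obtain p where p: "supp p \<subseteq> lists X" "a = proj p"
    using proj_surj assms(1) by blast
  have "P (proj p)"
    using p(1)
    by (induction p rule: frag_induct)
      (use assms in \<open>auto simp: proj_diff proj_eq_zero_iff relideal.zero_closed
        proj.hom_zero[simplified]\<close>)
  then show ?thesis using p by simp
qed

text \<open>The kernel of \<open>h\<close> is an ideal that contains the relators, hence all of
  \<open>relideal\<close>; so \<open>h\<close> is constant on cosets and may be evaluated at any
  chosen preimage.\<close>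

lemma presented_ring_universal:
  assumes "ring A" "h \<in> ring_hom (free_ring X) A" "\<And>r. r \<in> R \<Longrightarrow> h r = \<zero>\<^bsub>A\<^esub>"
  obtains \<phi> where "\<phi> \<in> ring_hom (presented_ring X R) A"
    "\<And>p. supp p \<subseteq> lists X \<Longrightarrow> \<phi> (proj p) = h p"
proof -
  have hrr: "ring_hom_ring (free_ring X) A h"
    by (rule ring_hom_ringI2[OF ring_free_ring assms(1,2)])
  have h_closed: "h p \<in> carrier A" if "supp p \<subseteq> lists X" for p
    using ring_hom_closed[OF assms(2)] that by simp
  have ker: "relideal \<subseteq> a_kernel (free_ring X) A h"
  proof (rule free.genideal_minimal[OF ring_hom_ring.kernel_is_ideal[OF hrr]], rule subsetI)
    fix r assume "r \<in> R"
    then show "r \<in> a_kernel (free_ring X) A h"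
      using assms(3) subsetD[OF relators_closed] by (simp add: a_kernel_def')
  qed
  have well: "h p = h q" if "proj p = proj q" "supp p \<subseteq> lists X"
    "supp q \<subseteq> lists X" for p q
  proof -
    have "p - q \<in> a_kernel (free_ring X) A h" using proj_eq_iff[OF that(2,3)] that(1) ker by auto
    then have "h p \<ominus>\<^bsub>A\<^esub> h q = \<zero>\<^bsub>A\<^esub>"
      using ring_hom_free_ring_diff[OF assms(1,2) that(2,3)] by (simp add: a_kernel_def')
    then show ?thesis using ring.r_right_minus_eq[OF assms(1)] h_closed that by simp
  qed
  define \<phi> where "\<phi> a = h (SOME p. supp p \<subseteq> lists X \<and> proj p = a)" for a
  have \<phi>: "\<phi> (proj p) = h p" if p: "supp p \<subseteq> lists X" for p
    unfolding \<phi>_def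
    using someI[of "\<lambda>q. supp q \<subseteq> lists X \<and> proj q = proj p" p] p
    by (intro well) auto
  have "\<phi> \<in> ring_hom (presented_ring X R) A"
  proof (rule ring_hom_memI)
    fix a b assume a: "a \<in> carrier PR" and b: "b \<in> carrier PR"
    obtain p where p: "supp p \<subseteq> lists X" "a = proj p" using proj_surj[OF a] by blast
    obtain q where q: "supp q \<subseteq> lists X" "b = proj q" using proj_surj[OF b] by blast
    show "\<phi> a \<in> carrier A" using p \<phi> h_closed by simp
    have "p \<otimes>\<^bsub>FR\<^esub> q \<in> carrier (free_ring X)" "p \<oplus>\<^bsub>FR\<^esub> q \<in> carrier (free_ring X)"
      using p q free.m_closed free.a_closed by simp_all
    then show "\<phi> (a \<otimes>\<^bsub>PR\<^esub> b) = \<phi> a \<otimes>\<^bsub>A\<^esub> \<phi> b"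
      "\<phi> (a \<oplus>\<^bsub>PR\<^esub> b) = \<phi> a \<oplus>\<^bsub>A\<^esub> \<phi> b"
      unfolding p(2) q(2) using p(1) q(1) \<phi> ring_hom_mult[OF assms(2), of p q] ring_hom_add[OF assms(2), of p q]
      by (simp_all del: add_free_ring flip: proj.hom_mult proj.hom_add)
  next
    show "\<phi> \<one>\<^bsub>PR\<^esub> = \<one>\<^bsub>A\<^esub>"
      using \<phi>[of "frag_of []"] ring_hom_one[OF assms(2)] by (simp add: proj_Nil)
  qed
  then show thesis using that \<phi> by blast
qed

lemma relideal_keys: "p \<in> relideal \<Longrightarrow> supp p \<subseteq> lists X"
  using subsetD[OF relideal.a_subset] by simp

lemma relideal_diff:
  assumes "p \<in> relideal" "q \<in> relideal"
  shows "p - q \<in> relideal"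
proof -
  have "p \<oplus>\<^bsub>FR\<^esub> \<ominus>\<^bsub>FR\<^esub> q \<in> relideal"
    using assms by (intro relideal.a_closed relideal.a_inv_closed)
  then show ?thesis
    using a_inv_free_ring[OF relideal_keys[OF assms(2)]] by simp
qed

end


section \<open>Tensor products\<close>

lemma (in group) mult_inv_eq_one_iff:
  "x \<in> carrier G \<Longrightarrow> y \<in> carrier G \<Longrightarrow> x \<otimes> inv y = \<one> \<longleftrightarrow> x = y"
  using inv_solve_right[of \<one> x y] by auto

lemma (in comm_group) mult_inv_inv_eq_one_iff:
  "x \<in> carrier G \<Longrightarrow> y \<in> carrier G \<Longrightarrow> z \<in> carrier G \<Longrightarrow>
    x \<otimes> inv y \<otimes> inv z = \<one> \<longleftrightarrow> x = y \<otimes> z"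
  using mult_inv_eq_one_iff[of x "y \<otimes> z"] by (simp add: inv_mult m_assoc)

lemma hom_free_Abelian_group_zero:
  assumes "group G" "h \<in> hom (free_Abelian_group S) G"
  shows "h 0 = \<one>\<^bsub>G\<^esub>"
  using hom_one[OF assms(2) group_free_Abelian_group assms(1)] by simp

lemma hom_free_Abelian_group_diff:
  assumes "group G" "h \<in> hom (free_Abelian_group S) G"
    "supp x \<subseteq> S" "supp y \<subseteq> S"
  shows "h (x - y) = h x \<otimes>\<^bsub>G\<^esub> inv\<^bsub>G\<^esub> h y"
proof -
  have xy: "x - y \<in> carrier (free_Abelian_group S)" "y \<in> carrier (free_Abelian_group S)"
    using assms(3,4) by (simp_all add: keys_diff_subset)
  have "h x = h (x - y) \<otimes>\<^bsub>G\<^esub> h y"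
    using hom_mult[OF assms(2) xy] by simp
  moreover have "h (x - y) \<in> carrier G" "h x \<in> carrier G" "h y \<in> carrier G"
    using hom_in_carrier[OF assms(2)] xy assms(3) by simp_all
  ultimately show ?thesis
    by (intro iffD2[OF group.inv_solve_right[OF assms(1)]])
qed

locale tensor_pair = A: comm_group A + B: comm_group B
  for A :: "('a, 'c) monoid_scheme" and B :: "('b, 'd) monoid_scheme"
begin

abbreviation "FG \<equiv> free_Abelian_group (carrier A \<times> carrier B)"
abbreviation "N \<equiv> tensor_subgroup A B"
abbreviation "Q \<equiv> tensor_group A B"

definition tproj where "tproj z = N #>\<^bsub>FG\<^esub> z"

lemma pure_tensor_tproj: "pure_tensor A B a b = tproj (frag_of (a, b))"
  by (simp add: pure_tensor_def tproj_def)

lemma FG_comm_group: "comm_group FG"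
  by (rule abelian_free_Abelian_group)

lemma FG_diff_diff:
  assumes "x \<in> S" "y \<in> S" "z \<in> S"
  shows "frag_of x - frag_of y - frag_of z \<in> carrier (free_Abelian_group S)"
  using assms unfolding carrier_free_Abelian_group_iff by (intro keys_diff_subset) simp_all

lemma tensor_relators_closed: "tensor_relators A B \<subseteq> carrier FG"
  unfolding tensor_relators_def Un_subset_iff
  by (intro conjI; clarify; intro FG_diff_diff) simp_all

lemma N_subgroup: "subgroup N FG"
  unfolding tensor_subgroup_def
  by (rule group.generate_is_subgroup[OF group_free_Abelian_group tensor_relators_closed])

lemma N_normal: "N \<lhd> FG"
  by (rule comm_group.subgroup_imp_normal[OF FG_comm_group N_subgroup])

lemma Q_comm_group: "comm_group Q"
  unfolding tensor_group_def by (rule comm_group.abelian_FactGroup[OF FG_comm_group N_subgroup])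

lemma Q_group: "group Q"
  by (rule comm_group.axioms(2)[OF Q_comm_group])

lemma tproj_hom: "tproj \<in> hom FG Q"
  unfolding tensor_group_def tproj_def[abs_def] by (rule normal.r_coset_hom_Mod[OF N_normal])

lemma tproj_closed: "z \<in> carrier FG \<Longrightarrow> tproj z \<in> carrier Q"
  by (rule hom_in_carrier[OF tproj_hom])

lemma tproj_surj: "q \<in> carrier Q \<Longrightarrow> \<exists>z\<in>carrier FG. q = tproj z"
  by (simp add: tensor_group_def FactGroup_def RCOSETS_def tproj_def Bex_def)

lemma tproj_eq_one_iff:
  assumes "z \<in> carrier FG"
  shows "tproj z = \<one>\<^bsub>Q\<^esub> \<longleftrightarrow> z \<in> N"
proof -
  have "\<one>\<^bsub>Q\<^esub> = N"
    by (simp add: tensor_group_def FactGroup_def)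
  then show ?thesis
    unfolding tproj_def
    using group.coset_join1[OF group_free_Abelian_group _ assms N_subgroup]
      group.coset_join2[OF group_free_Abelian_group assms N_subgroup] by auto
qed

lemma tproj_relator:
  assumes "frag_of x - frag_of y - frag_of z \<in> tensor_relators A B"
    "x \<in> carrier A \<times> carrier B" "y \<in> carrier A \<times> carrier B" "z \<in> carrier A \<times> carrier B"
  shows "tproj (frag_of x) = tproj (frag_of y) \<otimes>\<^bsub>Q\<^esub> tproj (frag_of z)"
proof -
  have "frag_of x - frag_of y - frag_of z \<in> N"
    using assms(1) unfolding tensor_subgroup_def by (rule generate.incl)
  then have "tproj (frag_of x - frag_of y - frag_of z) = \<one>\<^bsub>Q\<^esub>"
    using tproj_eq_one_iff[OF FG_diff_diff[OF assms(2-4)]] by simp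
  moreover have "tproj (frag_of x - frag_of y - frag_of z) =
      tproj (frag_of x) \<otimes>\<^bsub>Q\<^esub> inv\<^bsub>Q\<^esub> tproj (frag_of y) \<otimes>\<^bsub>Q\<^esub> inv\<^bsub>Q\<^esub> tproj (frag_of z)"
    using assms(2-4) hom_free_Abelian_group_diff[OF Q_group tproj_hom] by (simp add: keys_diff_subset)
  moreover have cl: "tproj (frag_of x) \<in> carrier Q" "tproj (frag_of y) \<in> carrier Q" "tproj (frag_of z) \<in> carrier Q"
    using assms(2-4) by (simp_all add: tproj_closed)
  ultimately show ?thesis
    using comm_group.mult_inv_inv_eq_one_iff[OF Q_comm_group cl] by simp
qed

lemma pure_tensor_closed: "a \<in> carrier A \<Longrightarrow> b \<in> carrier B \<Longrightarrow> pure_tensor A B a b \<in> carrier Q"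
  unfolding pure_tensor_tproj by (rule tproj_closed) simp

lemma pure_tensor_mult_left:
  assumes "a \<in> carrier A" "a' \<in> carrier A" "b \<in> carrier B"
  shows "pure_tensor A B (a \<otimes>\<^bsub>A\<^esub> a') b = pure_tensor A B a b \<otimes>\<^bsub>Q\<^esub> pure_tensor A B a' b"
  unfolding pure_tensor_tproj
proof (rule tproj_relator)
  show "frag_of (a \<otimes>\<^bsub>A\<^esub> a', b) - frag_of (a, b) - frag_of (a', b) \<in> tensor_relators A B"
    using assms unfolding tensor_relators_def Un_iff mem_Collect_eq by blast
qed (use assms in auto)

lemma pure_tensor_mult_right:
  assumes "a \<in> carrier A" "b \<in> carrier B" "b' \<in> carrier B"
  shows "pure_tensor A B a (b \<otimes>\<^bsub>B\<^esub> b') = pure_tensor A B a b \<otimes>\<^bsub>Q\<^esub> pure_tensor A B a b'"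
  unfolding pure_tensor_tproj
proof (rule tproj_relator)
  show "frag_of (a, b \<otimes>\<^bsub>B\<^esub> b') - frag_of (a, b) - frag_of (a, b') \<in> tensor_relators A B"
    using assms unfolding tensor_relators_def Un_iff mem_Collect_eq by blast
qed (use assms in auto)

lemma pure_tensor_one_left:
  assumes "b \<in> carrier B"
  shows "pure_tensor A B \<one>\<^bsub>A\<^esub> b = \<one>\<^bsub>Q\<^esub>"
proof -
  have "pure_tensor A B \<one>\<^bsub>A\<^esub> b = pure_tensor A B \<one>\<^bsub>A\<^esub> b \<otimes>\<^bsub>Q\<^esub> pure_tensor A B \<one>\<^bsub>A\<^esub> b"
    using pure_tensor_mult_left[of "\<one>\<^bsub>A\<^esub>" "\<one>\<^bsub>A\<^esub>" b] assms by simp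
  then show ?thesis
    using pure_tensor_closed[OF A.one_closed assms]
    by (intro iffD1[OF group.r_cancel_one'[OF Q_group]])
qed

lemma pure_tensor_one_right:
  assumes "a \<in> carrier A"
  shows "pure_tensor A B a \<one>\<^bsub>B\<^esub> = \<one>\<^bsub>Q\<^esub>"
proof -
  have "pure_tensor A B a \<one>\<^bsub>B\<^esub> = pure_tensor A B a \<one>\<^bsub>B\<^esub> \<otimes>\<^bsub>Q\<^esub> pure_tensor A B a \<one>\<^bsub>B\<^esub>"
    using pure_tensor_mult_right[of a "\<one>\<^bsub>B\<^esub>" "\<one>\<^bsub>B\<^esub>"] assms by simp
  then show ?thesis
    using pure_tensor_closed[OF assms B.one_closed]
    by (intro iffD1[OF group.r_cancel_one'[OF Q_group]])
qed

text \<open>The difference enters through the equation \<open>a = c \<otimes> a'\<close>, so that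
  the lemma applies to additive groups of rings, where \<open>c\<close> is written as a ring
  difference.\<close>

lemma pure_tensor_diff_left:
  assumes "c \<in> carrier A" "a \<in> carrier A" "a' \<in> carrier A" "b \<in> carrier B" "a = c \<otimes>\<^bsub>A\<^esub> a'"
  shows "pure_tensor A B c b = pure_tensor A B a b \<otimes>\<^bsub>Q\<^esub> inv\<^bsub>Q\<^esub> pure_tensor A B a' b"
  by (rule iffD2[OF group.inv_solve_right[OF Q_group pure_tensor_closed[OF assms(1,4)]
      pure_tensor_closed[OF assms(2,4)] pure_tensor_closed[OF assms(3,4)]]])
    (unfold assms(5), rule pure_tensor_mult_left[OF assms(1,3,4)])

lemma pure_tensor_diff_right:
  assumes "a \<in> carrier A" "c \<in> carrier B" "b \<in> carrier B" "b' \<in> carrier B" "b = c \<otimes>\<^bsub>B\<^esub> b'"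
  shows "pure_tensor A B a c = pure_tensor A B a b \<otimes>\<^bsub>Q\<^esub> inv\<^bsub>Q\<^esub> pure_tensor A B a b'"
  by (rule iffD2[OF group.inv_solve_right[OF Q_group pure_tensor_closed[OF assms(1,2)]
      pure_tensor_closed[OF assms(1,3)] pure_tensor_closed[OF assms(1,4)]]])
    (unfold assms(5), rule pure_tensor_mult_right[OF assms(1,2,4)])

lemma tensor_induct [consumes 1, case_names one pure diff]:
  assumes "q \<in> carrier Q" "P \<one>\<^bsub>Q\<^esub>"
    "\<And>a b. a \<in> carrier A \<Longrightarrow> b \<in> carrier B \<Longrightarrow> P (pure_tensor A B a b)"
    "\<And>x y. x \<in> carrier Q \<Longrightarrow> y \<in> carrier Q \<Longrightarrow> P x \<Longrightarrow> P y \<Longrightarrow> P (x \<otimes>\<^bsub>Q\<^esub> inv\<^bsub>Q\<^esub> y)"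
  shows "P q"
proof -
  obtain z where z: "supp z \<subseteq> carrier A \<times> carrier B" "q = tproj z"
    using tproj_surj[OF assms(1)] by auto
  have "P (tproj z)"
    using z(1)
  proof (induction z rule: frag_induct)
    case zero
    then show ?case using assms(2) hom_free_Abelian_group_zero[OF Q_group tproj_hom] by simp
  next
    case (diff x y)
    then show ?case
      using assms(4) hom_free_Abelian_group_diff[OF Q_group tproj_hom] tproj_closed by simp
  next
    case (one x)
    then show ?case
      using assms(3)[of "fst x" "snd x"] by (auto simp: pure_tensor_tproj)
  qed
  then show ?thesis using z by simp
qed

text \<open>Biadditivity of \<open>\<beta>\<close> says that its extension to the free abelian group
  on pairs kills \<open>tensor_relators\<close>, and so factors through the quotient.\<close>

lemma tensor_universal:
  assumes G: "comm_group G"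
    and closed: "\<And>a b. a \<in> carrier A \<Longrightarrow> b \<in> carrier B \<Longrightarrow> \<beta> a b \<in> carrier G"
    and left: "\<And>a a' b. a \<in> carrier A \<Longrightarrow> a' \<in> carrier A \<Longrightarrow> b \<in> carrier B \<Longrightarrow>
      \<beta> (a \<otimes>\<^bsub>A\<^esub> a') b = \<beta> a b \<otimes>\<^bsub>G\<^esub> \<beta> a' b"
    and right: "\<And>a b b'. a \<in> carrier A \<Longrightarrow> b \<in> carrier B \<Longrightarrow> b' \<in> carrier B \<Longrightarrow>
      \<beta> a (b \<otimes>\<^bsub>B\<^esub> b') = \<beta> a b \<otimes>\<^bsub>G\<^esub> \<beta> a b'"
  obtains \<mu> where "\<mu> \<in> hom Q G"
    "\<And>a b. a \<in> carrier A \<Longrightarrow> b \<in> carrier B \<Longrightarrow> \<mu> (pure_tensor A B a b) = \<beta> a b"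
proof -
  note G_group = comm_group.axioms(2)[OF G]
  have "case_prod \<beta> ` (carrier A \<times> carrier B) \<subseteq> carrier G"
    using closed by auto
  then obtain h where h: "h \<in> hom FG G" and h_of: "\<And>x. x \<in> carrier A \<times> carrier B \<Longrightarrow> h (frag_of x) = case_prod \<beta> x"
    using comm_group.free_Abelian_group_universal[OF G] by blast
  have h_diff: "h (x - y) = h x \<otimes>\<^bsub>G\<^esub> inv\<^bsub>G\<^esub> h y" if "x \<in> carrier FG" "y \<in> carrier FG" for x y
    using hom_free_Abelian_group_diff[OF G_group h] that by simp
  have h_closed: "h x \<in> carrier G" if "x \<in> carrier FG" for x
    using hom_in_carrier[OF h that] .
  have relator: "h (frag_of x - frag_of y - frag_of z) = \<one>\<^bsub>G\<^esub>"
    if "case_prod \<beta> x = case_prod \<beta> y \<otimes>\<^bsub>G\<^esub> case_prod \<beta> z"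
      "x \<in> carrier A \<times> carrier B" "y \<in> carrier A \<times> carrier B" "z \<in> carrier A \<times> carrier B" for x y z
  proof -
    have cl: "h (frag_of x) \<in> carrier G" "h (frag_of y) \<in> carrier G" "h (frag_of z) \<in> carrier G"
      using that(2-4) by (simp_all add: h_closed)
    have "h (frag_of x - frag_of y - frag_of z) = h (frag_of x) \<otimes>\<^bsub>G\<^esub> inv\<^bsub>G\<^esub> h (frag_of y) \<otimes>\<^bsub>G\<^esub> inv\<^bsub>G\<^esub> h (frag_of z)"
      using that(2-4) h_diff[of "frag_of x - frag_of y" "frag_of z"] h_diff[of "frag_of x" "frag_of y"]
      by (simp add: keys_diff_subset)
    then show ?thesis
      using comm_group.mult_inv_inv_eq_one_iff[OF G cl] that h_of by simp
  qed
  have gh: "group_hom FG G h"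
    using h G_group by (simp add: group_hom_def group_hom_axioms_def)
  have "tensor_relators A B \<subseteq> kernel FG G h"
  proof
    fix r assume r: "r \<in> tensor_relators A B"
    then have "h r = \<one>\<^bsub>G\<^esub>"
      unfolding tensor_relators_def Un_iff mem_Collect_eq
      by (elim disjE exE conjE; simp only:; intro relator) (use left right in simp_all)
    then show "r \<in> kernel FG G h"
      using subsetD[OF tensor_relators_closed r] by (simp add: kernel_def)
  qed
  then have N: "N \<subseteq> kernel FG G h"
    unfolding tensor_subgroup_def
    by (rule group.generate_subgroup_incl[OF group_free_Abelian_group _ group_hom.subgroup_kernel[OF gh]])
  have well: "h x = h y" if x: "x \<in> carrier FG" and y: "y \<in> carrier FG" and eq: "tproj x = tproj y" for x y
  proof -
    have xy: "x - y \<in> carrier FG" using x y by (simp add: keys_diff_subset)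
    have "tproj (x - y) = tproj x \<otimes>\<^bsub>Q\<^esub> inv\<^bsub>Q\<^esub> tproj y"
      using hom_free_Abelian_group_diff[OF Q_group tproj_hom] x y by simp
    then have "tproj (x - y) = \<one>\<^bsub>Q\<^esub>"
      using eq group.mult_inv_eq_one_iff[OF Q_group] tproj_closed[OF y] by simp
    then have "x - y \<in> N" using tproj_eq_one_iff[OF xy] by simp
    then have "h x \<otimes>\<^bsub>G\<^esub> inv\<^bsub>G\<^esub> h y = \<one>\<^bsub>G\<^esub>"
      using N h_diff[OF x y] by (auto simp: kernel_def)
    then show ?thesis
      using group.mult_inv_eq_one_iff[OF G_group h_closed[OF x] h_closed[OF y]] by simp
  qed
  define \<mu> where "\<mu> q = h (SOME z. z \<in> carrier FG \<and> tproj z = q)" for q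
  have \<mu>: "\<mu> (tproj z) = h z" if z: "z \<in> carrier FG" for z
  proof -
    have "(SOME z'. z' \<in> carrier FG \<and> tproj z' = tproj z) \<in> carrier FG \<and>
        tproj (SOME z'. z' \<in> carrier FG \<and> tproj z' = tproj z) = tproj z"
      using someI[of "\<lambda>z'. z' \<in> carrier FG \<and> tproj z' = tproj z" z] z by blast
    then show ?thesis unfolding \<mu>_def using z by (intro well) blast+
  qed
  show thesis
  proof (rule that)
    show "\<mu> \<in> hom Q G"
    proof (rule homI)
      fix p q assume p: "p \<in> carrier Q" and q: "q \<in> carrier Q"
      obtain x where x: "x \<in> carrier FG" "p = tproj x" using tproj_surj[OF p] by blast
      obtain y where y: "y \<in> carrier FG" "q = tproj y" using tproj_surj[OF q] by blast
      show "\<mu> p \<in> carrier G" using x \<mu> h_closed by simp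
      have "\<mu> (tproj (x \<otimes>\<^bsub>FG\<^esub> y)) = h (x \<otimes>\<^bsub>FG\<^esub> y)"
        by (rule \<mu>[OF group.is_monoid[OF group_free_Abelian_group, THEN monoid.m_closed, OF x(1) y(1)]])
      then show "\<mu> (p \<otimes>\<^bsub>Q\<^esub> q) = \<mu> p \<otimes>\<^bsub>G\<^esub> \<mu> q"
        unfolding hom_mult[OF tproj_hom x(1) y(1)] hom_mult[OF h x(1) y(1)] x(2) y(2)
        using \<mu> x(1) y(1) by simp
    qed
    show "\<mu> (pure_tensor A B a b) = \<beta> a b" if "a \<in> carrier A" "b \<in> carrier B" for a b
      unfolding pure_tensor_tproj using that \<mu> h_of by simp
  qed
qed

end


section \<open>Presented groups\<close>

context
  fixes X :: "'x set" and R :: "('x \<times> bool) list set"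
begin

abbreviation "PC \<equiv> presentation_cong X R"
abbreviation "PG \<equiv> presented_group X R"
abbreviation "L \<equiv> lists (X \<times> (UNIV :: bool set))"

lemma presentation_cong_lists:
  assumes "R \<subseteq> L" "(u, v) \<in> PC"
  shows "u \<in> L \<and> v \<in> L"
  using assms(2) by induction (use assms(1) in auto)

lemma equiv_presentation_cong:
  assumes "R \<subseteq> L"
  shows "equiv (L) (PC)"
proof (rule equivI)
  show "PC \<subseteq> L \<times> L"
    by (auto dest!: presentation_cong_lists[OF assms] simp del: in_lists_conv_set)
  show "refl_on (L) (PC)"
    by (rule refl_onI) (auto intro: presentation_cong.refl)
  show "sym (PC)"
    by (rule symI) (rule presentation_cong.sym)
  show "trans (PC)"
    by (rule transI) (rule presentation_cong.trans)
qed

lemma presentation_cong_context: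
  assumes "(u, v) \<in> PC" "a \<in> L" "b \<in> L"
  shows "(a @ u @ b, a @ v @ b) \<in> PC"
  using assms(1)
proof induction
  case (cancel u v x c)
  then show ?case
    using assms presentation_cong.cancel[of "a @ u" X "v @ b" x c R] by simp
next
  case (relator u v r)
  then show ?case
    using assms presentation_cong.relator[of "a @ u" X "v @ b" r R] by simp
next
  case (trans u v w)
  then show ?case by (metis presentation_cong.trans)
next
  case (refl u)
  then show ?case using assms by (intro presentation_cong.refl) simp
qed (rule presentation_cong.sym)

lemma presentation_cong_append:
  assumes "R \<subseteq> L"
    "(u, u') \<in> PC" "(v, v') \<in> PC"
  shows "(u @ v, u' @ v') \<in> PC"
  using presentation_cong_context[OF assms(2), of "[]" v]
    presentation_cong_context[OF assms(3), of u' "[]"]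
    presentation_cong_lists[OF assms(1,2)] presentation_cong_lists[OF assms(1,3)]
  by (auto intro: presentation_cong.trans)

lemma presented_group_carrier:
  "w \<in> carrier (PG) \<longleftrightarrow>
    (\<exists>u\<in>L. w = PC `` {u})"
  by (simp add: presented_group_def quotient_def)

lemma presented_group_mult:
  assumes "R \<subseteq> L" "u \<in> L" "v \<in> L"
  shows "PC `` {u} \<otimes>\<^bsub>PG\<^esub> PC `` {v} =
    PC `` {u @ v}"
proof -
  have "(\<lambda>a b. PC `` {a @ b}) respects2 PC"
    unfolding congruent2_def
    using presentation_cong_append[OF assms(1)] equiv_presentation_cong[OF assms(1)]
    by (auto intro!: equiv_class_eq)
  from UN_equiv_class2[OF equiv_presentation_cong equiv_presentation_cong this]
  show ?thesis
    using assms by (simp add: presented_group_def)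
qed

lemma presentation_cong_inverse:
  assumes "u \<in> L"
  shows "(rev (map (\<lambda>(x, b). (x, \<not> b)) u) @ u, []) \<in> PC"
  using assms
proof (induction u)
  case Nil
  then show ?case by (simp add: presentation_cong.refl)
next
  case (Cons y u)
  obtain x b where y: "y = (x, b)" by fastforce
  let ?r = "rev (map (\<lambda>(x, b). (x, \<not> b)) u)"
  have "?r \<in> L"
    using Cons.hyps(2) by auto
  \<comment> \<open>The cancellation rule expects a letter with exponent \<open>c\<close> followed
    by \<open>\<not> c\<close>; here \<open>c = \<not> b\<close>, whence the double
    negation.\<close>
  then have "(?r @ [(x, \<not> b), (x, \<not> \<not> b)] @ u, ?r @ u) \<in> PC"
    using Cons.hyps y by (intro presentation_cong.cancel) auto
  from presentation_cong.trans[OF this Cons.IH] show ?case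
    using y by simp
qed

lemma group_presented_group:
  assumes "R \<subseteq> L"
  shows "group (PG)"
proof (rule groupI)
  note mult = presented_group_mult[OF assms]
  have one: "\<one>\<^bsub>PG\<^esub> = PC `` {[]}"
    by (simp add: presented_group_def)
  fix a assume "a \<in> carrier (PG)"
  then obtain u where u: "u \<in> L" "a = PC `` {u}"
    by (auto simp: presented_group_carrier)
  show "\<one>\<^bsub>PG\<^esub> \<otimes>\<^bsub>PG\<^esub> a = a"
    using u by (simp add: mult one)
  show "\<exists>b\<in>carrier (PG). b \<otimes>\<^bsub>PG\<^esub> a = \<one>\<^bsub>PG\<^esub>"
  proof
    let ?v = "rev (map (\<lambda>(x, b). (x, \<not> b)) u)"
    have v: "?v \<in> L" using u by auto
    then show "PC `` {?v} \<in> carrier (PG)"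
      by (auto simp: presented_group_carrier)
    show "PC `` {?v} \<otimes>\<^bsub>PG\<^esub> a = \<one>\<^bsub>PG\<^esub>"
      using v u presentation_cong_inverse[OF u(1)]
      by (simp add: mult one equiv_class_eq[OF equiv_presentation_cong[OF assms]])
  qed
  fix b assume "b \<in> carrier (PG)"
  then obtain v where v: "v \<in> L" "b = PC `` {v}"
    by (auto simp: presented_group_carrier)
  then show "a \<otimes>\<^bsub>PG\<^esub> b \<in> carrier (PG)"
    using u mult by (auto simp: presented_group_carrier intro!: bexI[of _ "u @ v"])
  fix c assume "c \<in> carrier (PG)"
  then obtain w where w: "w \<in> L" "c = PC `` {w}"
    by (auto simp: presented_group_carrier)
  show "a \<otimes>\<^bsub>PG\<^esub> b \<otimes>\<^bsub>PG\<^esub> c =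
      a \<otimes>\<^bsub>PG\<^esub> (b \<otimes>\<^bsub>PG\<^esub> c)"
    using u v w by (simp add: mult)
qed (auto simp: presented_group_def quotient_def intro!: bexI[of _ "[]"])

end


section \<open>Coxeter groups\<close>

declare in_lists_conv_set [simp del]

text \<open>A recursive counterpart of \<open>alt_word\<close> on plain indices: removing the first
  letter exchanges the roles of \<open>a\<close> and \<open>b\<close>, the form that inductions on
  dihedral words need.\<close>

fun altw :: "nat \<Rightarrow> 'i \<Rightarrow> 'i \<Rightarrow> 'i list" where
  "altw 0 a b = []"
| "altw (Suc n) a b = a # altw n b a"

lemma length_altw [simp]: "length (altw n a b) = n"
  by (induction n arbitrary: a b) auto

lemma altw_in_lists [simp]: "a \<in> J \<Longrightarrow> b \<in> J \<Longrightarrow> altw n a b \<in> lists J"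
  by (induction n arbitrary: a b) auto

lemma altw_add: "altw (k + n) a b = altw k a b @ (if even k then altw n a b else altw n b a)"
  by (induction k arbitrary: a b) auto

lemma altw_snoc: "altw (Suc n) a b = altw n a b @ [if even n then a else b]"
  using altw_add[of n 1 a b] by simp

lemma alt_word_altw: "alt_word n a b = map GenS (altw n a b)"
proof (induction n arbitrary: a b)
  case (Suc n)
  have "alt_word (Suc n) a b = GenS a # alt_word n b a"
    by (rule nth_equalityI)
      (auto simp: alt_word_def nth_Cons simp del: upt_Suc split: nat.split)
  with Suc show ?case by simp
qed (simp add: alt_word_def)

lemma foldr_concat_replicate:
  "foldr f (concat (replicate n [i, j])) a = ((f i \<circ> f j) ^^ n) a"
  by (induction n) auto

lemma concat_replicate_lists [simp]:
  "x \<in> A \<Longrightarrow> y \<in> A \<Longrightarrow> concat (replicate n [x, y]) \<in> lists A"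
  by (induction n) auto

text \<open>The induction steps of \<open>tits_pow\<close> as polynomial identities.
  \<open>s\<close> and \<open>c\<close> are the sine and cosine of \<theta>, \<open>S\<close> and
  \<open>C\<close> those of \<open>2 n \<theta>\<close>, and \<open>S'\<close> and \<open>C'\<close>
  those of \<open>2 (n + 1) \<theta>\<close>; \<open>P\<close> and \<open>Q\<close> are
  \<open>s\<close> times the coordinates \<open>j\<close> and \<open>i\<close> after
  \<open>n\<close> steps. The only relation used is that between \<open>s\<close> and
  \<open>c\<close>.\<close>

lemma trig_step:
  fixes s c S C x y p q :: real
  assumes "s\<^sup>2 = 1 - c\<^sup>2"
  defines "P \<equiv> (S * c + C * s) * y + S * x" and "Q \<equiv> - (S * y + (S * c - C * s) * x)"
    and "S' \<equiv> S * (2 * c\<^sup>2 - 1) + C * (2 * s * c)" and "C' \<equiv> C * (2 * c\<^sup>2 - 1) - S * (2 * s * c)"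
  shows "- P + 2 * c * Q + 4 * c\<^sup>2 * P = (S' * c + C' * s) * y + S' * x"
    "- Q - 2 * c * P = - (S' * y + (S' * c - C' * s) * x)"
    "q * ((1 - C) * y + (c - (C * c + S * s)) * x) + p * ((c - (C * c - S * s)) * y + (1 - C) * x) +
      2 * s * (q * P + p * (Q + 2 * c * P)) =
      q * ((1 - C') * y + (c - (C' * c + S' * s)) * x) + p * ((c - (C' * c - S' * s)) * y + (1 - C') * x)"
proof -
  have ss: "s * s = 1 - c * c"
    using assms(1) by (simp add: power2_eq_square)
  then have sss: "s * (s * z) = z - c * (c * z)" for z
    by (simp add: left_diff_distrib flip: mult.assoc)
  show
    "- P + 2 * c * Q + 4 * c\<^sup>2 * P = (S' * c + C' * s) * y + S' * x"
    "- Q - 2 * c * P = - (S' * y + (S' * c - C' * s) * x)"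
    "q * ((1 - C) * y + (c - (C * c + S * s)) * x) + p * ((c - (C * c - S * s)) * y + (1 - C) * x) +
      2 * s * (q * P + p * (Q + 2 * c * P)) =
      q * ((1 - C') * y + (c - (C' * c + S' * s)) * x) + p * ((c - (C' * c - S' * s)) * y + (1 - C') * x)"
    unfolding P_def Q_def S'_def C'_def by (simp_all add: algebra_simps power2_eq_square ss sss)
qed

type_synonym 'i cox = "('i \<times> bool) list set"
type_synonym 'i hecke = "('i hecke_gen list \<Rightarrow>\<^sub>0 int) set"
type_synonym 'i frag_cox = "'i cox list \<Rightarrow>\<^sub>0 int"

locale coxeter =
  fixes I :: "'i set" and m :: "'i \<Rightarrow> 'i \<Rightarrow> nat"
  assumes coxeter_matrix: "coxeter_matrix I m"
begin

abbreviation "W \<equiv> coxeter_group I m"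
abbreviation "s \<equiv> simple_refl I m"
abbreviation "Rfl \<equiv> reflections I m"
abbreviation pow_W :: "_ \<Rightarrow> nat \<Rightarrow> _" (infixr "\<up>" 75) where "v \<up> n \<equiv> v [^]\<^bsub>W\<^esub> n"
abbreviation mult_W (infixl "\<cdot>" 70) where "v \<cdot> w \<equiv> v \<otimes>\<^bsub>W\<^esub> w"
abbreviation inv_W ("\<iota> _" [81] 80) where "\<iota> w \<equiv> inv\<^bsub>W\<^esub> w"

lemma m_sym: "i \<in> I \<Longrightarrow> j \<in> I \<Longrightarrow> m i j = m j i"
  and m_eq_1: "i \<in> I \<Longrightarrow> j \<in> I \<Longrightarrow> m i j = 1 \<longleftrightarrow> i = j"
  using coxeter_matrix by (auto simp: coxeter_matrix_def)

lemma relators_lists: "coxeter_relators I m \<subseteq> lists (I \<times> UNIV)"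
proof
  fix r assume "r \<in> coxeter_relators I m"
  then obtain i j where "r = concat (replicate (m i j) [(i, True), (j, True)])" "i \<in> I" "j \<in> I"
    by (auto simp: coxeter_relators_def)
  then show "r \<in> lists (I \<times> UNIV)"
    using concat_replicate_lists[of "(i, True)" "I \<times> UNIV" "(j, True)"] by simp
qed

sublocale W: group W
  unfolding coxeter_group_def by (rule group_presented_group[OF relators_lists])

section \<open>Words in the generators and their values in \<open>W\<close>\<close>

definition wd :: "'i list \<Rightarrow> 'i cox" where
  "wd \<omega> = presentation_cong I (coxeter_relators I m) `` {map (\<lambda>i. (i, True)) \<omega>}"

lemma wd_append:
  "\<omega> \<in> lists I \<Longrightarrow> \<omega>' \<in> lists I \<Longrightarrow> wd (\<omega> @ \<omega>') = wd \<omega> \<cdot> wd \<omega>'"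
  unfolding wd_def coxeter_group_def
  by (subst presented_group_mult[OF relators_lists]) auto

lemma wd_Nil [simp]: "wd [] = \<one>\<^bsub>W\<^esub>"
  by (simp add: wd_def coxeter_group_def presented_group_def)

lemma wd_single: "wd [i] = s i"
  by (simp add: wd_def simple_refl_def pres_gen_def)

lemma wd_Cons: "i \<in> I \<Longrightarrow> \<omega> \<in> lists I \<Longrightarrow> wd (i # \<omega>) = s i \<cdot> wd \<omega>"
  using wd_append[of "[i]" \<omega>] by (simp add: wd_single)

lemma wd_closed [simp]: "\<omega> \<in> lists I \<Longrightarrow> wd \<omega> \<in> carrier W"
  unfolding coxeter_group_def presented_group_carrier wd_def by force

lemma s_closed [simp]: "i \<in> I \<Longrightarrow> s i \<in> carrier W"
  using wd_closed[of "[i]"] by (simp add: wd_single)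

lemma wd_relator:
  assumes "i \<in> I" "j \<in> I"
  shows "wd (concat (replicate (m i j) [i, j])) = \<one>\<^bsub>W\<^esub>"
proof -
  let ?r = "concat (replicate (m i j) [(i, True), (j, True)])"
  have "?r \<in> coxeter_relators I m"
    using assms by (auto simp: coxeter_relators_def)
  then have "(?r, []) \<in> presentation_cong I (coxeter_relators I m)"
    using presentation_cong.relator[of "[]" I "[]" ?r] by simp
  moreover have "map (\<lambda>i. (i, True)) (concat (replicate n [i, j])) =
    concat (replicate n [(i, True), (j, True)])" for n
    by (induction n) auto
  ultimately have "wd (concat (replicate (m i j) [i, j])) = wd []"
    unfolding wd_def by (simp add: equiv_class_eq[OF equiv_presentation_cong[OF relators_lists]])
  then show ?thesis by simp
qed

lemma s_s [simp]: "i \<in> I \<Longrightarrow> s i \<cdot> s i = \<one>\<^bsub>W\<^esub>"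
  using wd_relator[of i i] m_eq_1[of i i] wd_append[of "[i]" "[i]"] by (simp add: wd_single)

lemma inv_s [simp]: "i \<in> I \<Longrightarrow> \<iota> (s i) = s i"
  by (rule W.inv_equality) auto

lemma s_s_left [simp]: "i \<in> I \<Longrightarrow> w \<in> carrier W \<Longrightarrow> s i \<cdot> (s i \<cdot> w) = w"
  by (simp flip: W.m_assoc)

lemma wd_rev: "\<omega> \<in> lists I \<Longrightarrow> wd (rev \<omega>) = \<iota> (wd \<omega>)"
proof (induction \<omega>)
  case (Cons i \<omega>)
  then have "rev \<omega> \<in> lists I" by auto
  with Cons show ?case
    by (simp add: wd_append wd_Cons wd_single W.inv_mult_group)
qed simp

text \<open>A generator is its own inverse, so a letter with negative exponent has the same value as
  the letter, and words without exponents reach all of \<open>W\<close>.\<close>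

lemma wd_surj:
  assumes "w \<in> carrier W"
  obtains \<omega> where "\<omega> \<in> lists I" "w = wd \<omega>"
proof -
  let ?C = "presentation_cong I (coxeter_relators I m)"
  have neg: "?C `` {[(i, b)]} = s i" if "i \<in> I" for i b
  proof (cases b)
    case True
    then show ?thesis by (simp add: simple_refl_def pres_gen_def)
  next
    case False
    have "([(i, b), (i, \<not> b)], []) \<in> ?C"
      using presentation_cong.cancel[of "[]" I "[]" i b] that by simp
    then have "?C `` {[(i, b)]} \<cdot> s i = \<one>\<^bsub>W\<^esub>"
      using that False presented_group_mult[OF relators_lists, of "[(i, b)]" "[(i, True)]"]
      by (simp add: coxeter_group_def simple_refl_def pres_gen_def presented_group_def
          equiv_class_eq[OF equiv_presentation_cong[OF relators_lists]])
    moreover have "?C `` {[(i, b)]} \<in> carrier W"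
      using that unfolding coxeter_group_def presented_group_carrier by force
    ultimately show ?thesis
      using that W.inv_equality[of "?C `` {[(i, b)]}" "s i"] by simp
  qed
  have "?C `` {u} = wd (map fst u)" if "u \<in> lists (I \<times> UNIV)" for u
    using that
  proof (induction u)
    case Nil
    then show ?case by (simp add: wd_def)
  next
    case (Cons x u)
    obtain i b where x: "x = (i, b)" by fastforce
    then have "?C `` {x # u} = ?C `` {[(i, b)]} \<cdot> ?C `` {u}"
      using Cons presented_group_mult[OF relators_lists, of "[x]" u]
      by (simp add: coxeter_group_def)
    also have "\<dots> = s i \<cdot> wd (map fst u)"
      using Cons x neg[of i b] by simp
    finally show ?case
      using Cons x by (subst list.map, subst wd_Cons) force+
  qed
  moreover obtain u where "u \<in> lists (I \<times> UNIV)" "w = ?C `` {u}"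
    using assms unfolding coxeter_group_def presented_group_carrier by blast
  ultimately show thesis
    using that[of "map fst u"] by fastforce
qed

text \<open>Since the generators are involutions, a family of operators satisfying the Coxeter relations
  may be evaluated on a word while ignoring the exponents of its letters.\<close>

lemma foldr_wd_cong:
  assumes cl: "\<And>i a. i \<in> I \<Longrightarrow> a \<in> A \<Longrightarrow> f i a \<in> A"
    and sq: "\<And>i a. i \<in> I \<Longrightarrow> a \<in> A \<Longrightarrow> f i (f i a) = a"
    and braid: "\<And>i j a. i \<in> I \<Longrightarrow> j \<in> I \<Longrightarrow> i \<noteq> j \<Longrightarrow> a \<in> A \<Longrightarrow> ((f i \<circ> f j) ^^ m i j) a = a"
    and \<omega>: "\<omega> \<in> lists I" "\<omega>' \<in> lists I" "wd \<omega> = wd \<omega>'" and a: "a \<in> A"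
  shows "foldr f \<omega> a = foldr f \<omega>' a"
proof -
  let ?C = "presentation_cong I (coxeter_relators I m)"
  let ?F = "\<lambda>u. foldr (\<lambda>x. f (fst x)) u"
  have map_in_lists: "map (\<lambda>i. (i, True)) \<omega> \<in> lists (I \<times> UNIV)" if "\<omega> \<in> lists I" for \<omega>
    using that by auto
  have F_closed: "?F u a \<in> A" if "u \<in> lists (I \<times> UNIV)" "a \<in> A" for u a
    using that(1) by induction (use cl that in auto)
  have "\<forall>a\<in>A. ?F u a = ?F v a" if "(u, v) \<in> ?C" for u v
    using that
  proof induction
    case (cancel u v x b)
    then show ?case using F_closed[OF cancel(2)] sq by simp
  next
    case (relator u v r)
    from relator(3) obtain i j where r: "r = concat (replicate (m i j) [(i, True), (j, True)])"
      "i \<in> I" "j \<in> I" by (auto simp: coxeter_relators_def)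
    have "?F r a = a" if "a \<in> A" for a
    proof (cases "i = j")
      case True
      then have "m i j = 1" using r m_eq_1 by blast
      then show ?thesis using True r that sq by simp
    next
      case False
      have "(\<lambda>a. f i (f j a)) = f i \<circ> f j" by auto
      then show ?thesis
        using False r that braid[of i j a] 
          foldr_concat_replicate[of "\<lambda>x. f (fst x)" "m i j" "(i, True)" "(j, True)"] by simp
    qed
    then show ?case using F_closed[OF relator(2)] by simp
  qed auto
  moreover have "(map (\<lambda>i. (i, True)) \<omega>, map (\<lambda>i. (i, True)) \<omega>') \<in> ?C"
    using \<omega> map_in_lists[OF \<omega>(1)] map_in_lists[OF \<omega>(2)] eq_equiv_class_iff[OF equiv_presentation_cong[OF relators_lists],
      of "map (\<lambda>i. (i, True)) \<omega>" "map (\<lambda>i. (i, True)) \<omega>'"]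
    unfolding wd_def by simp
  ultimately show ?thesis
    using a by (fastforce simp: foldr_map comp_def)
qed

lemma wd_concat_replicate:
  "i \<in> I \<Longrightarrow> j \<in> I \<Longrightarrow> wd (concat (replicate n [i, j])) = (s i \<cdot> s j) \<up> n"
proof (induction n)
  case (Suc n)
  have "wd (concat (replicate (Suc n) [i, j])) = s i \<cdot> s j \<cdot> wd (concat (replicate n [i, j]))"
    using Suc.prems concat_replicate_lists[OF Suc.prems, of n] by (simp add: wd_Cons W.m_assoc)
  with Suc show ?case by (simp only: W.nat_pow_Suc2 W.m_closed s_closed)
qed simp

lemma braid_power: "i \<in> I \<Longrightarrow> j \<in> I \<Longrightarrow> (s i \<cdot> s j) \<up> m i j = \<one>\<^bsub>W\<^esub>"
  using wd_relator wd_concat_replicate by simp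


subsection \<open>The order of a product of two generators\<close>

text \<open>The contragredient of Tits' geometric representation. As \<open>x / 0 = 0\<close>, the coefficient is \<open>2\<close>
  for \<open>m i k = 0\<close>, and as \<open>m i i = 1\<close> it is \<open>- 2\<close> for \<open>k = i\<close>.\<close>

definition tits :: "'i \<Rightarrow> ('i \<Rightarrow> real) \<Rightarrow> 'i \<Rightarrow> real" where
  "tits i f = (\<lambda>k. f k + (if k \<in> I then 2 * cos (pi / m i k) else 0) * f i)"

lemma tits_self [simp]: "i \<in> I \<Longrightarrow> tits i f i = - f i"
  using m_eq_1[of i i] by (simp add: tits_def)

lemma tits_tits [simp]: "i \<in> I \<Longrightarrow> tits i (tits i f) = f"
proof
  fix k assume "i \<in> I"
  then have "tits i (tits i f) k = tits i f k + (if k \<in> I then 2 * cos (pi / m i k) else 0) * - f i"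
    by (subst tits_def) simp
  then show "tits i (tits i f) k = f k"
    by (simp add: tits_def)
qed

text \<open>On the coordinates \<open>j\<close> and \<open>i\<close> the product of the two
  reflections is, for \<open>m i j \<ge> 2\<close>, conjugate to a rotation by
  \<open>2 \<theta>\<close>. The first two equations describe its powers, multiplied by
  \<open>sin \<theta>\<close> to avoid a division. The increments of an arbitrary coordinate
  \<open>k\<close> are combinations of sines, and the further factor \<open>2 sin \<theta>\<close>
  makes their sum telescope into differences of cosines.\<close>

lemma tits_pow:
  fixes f :: "'i \<Rightarrow> real"
  assumes ij: "i \<in> I" "j \<in> I" "i \<noteq> j"
  defines "\<theta> \<equiv> pi / m i j" and "F \<equiv> \<lambda>n. ((tits i \<circ> tits j) ^^ n) f"
  defines "c \<equiv> \<lambda>i k. if k \<in> I then 2 * cos (pi / m i k) else 0"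
  shows "sin \<theta> * F n j = sin ((2 * real n + 1) * \<theta>) * f j + sin (2 * real n * \<theta>) * f i"
    and "sin \<theta> * F n i = - (sin (2 * real n * \<theta>) * f j + sin ((2 * real n - 1) * \<theta>) * f i)"
    and "2 * (sin \<theta>)\<^sup>2 * (F n k - f k) =
      c j k * ((1 - cos (2 * real n * \<theta>)) * f j + (cos \<theta> - cos ((2 * real n - 1) * \<theta>)) * f i) +
      c i k * ((cos \<theta> - cos ((2 * real n + 1) * \<theta>)) * f j + (1 - cos (2 * real n * \<theta>)) * f i)"
proof -
  have c: "c j i = 2 * cos \<theta>" "c i j = 2 * cos \<theta>" "c i i = - 2" "c j j = - 2"
    using ij m_sym[of i j] m_eq_1[of i i] m_eq_1[of j j] by (auto simp: c_def \<theta>_def)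
  have step: "F (Suc n) k = F n k + c j k * F n j + c i k * (F n i + 2 * cos \<theta> * F n j)" for n k
    using c(1) by (simp add: F_def tits_def c_def)
  have 1: "sin ((2 * real n - 1) * \<theta>) = sin (2 * real n * \<theta>) * cos \<theta> - cos (2 * real n * \<theta>) * sin \<theta>"
    "cos ((2 * real n - 1) * \<theta>) = cos (2 * real n * \<theta>) * cos \<theta> + sin (2 * real n * \<theta>) * sin \<theta>" for n
    by (simp_all add: left_diff_distrib sin_diff cos_diff)
  have 2: "sin ((2 * real n + 1) * \<theta>) = sin (2 * real n * \<theta>) * cos \<theta> + cos (2 * real n * \<theta>) * sin \<theta>"
    "cos ((2 * real n + 1) * \<theta>) = cos (2 * real n * \<theta>) * cos \<theta> - sin (2 * real n * \<theta>) * sin \<theta>" for n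
    by (simp_all add: distrib_right sin_add cos_add)
  have 3: "sin (2 * (1 + real n) * \<theta>) = sin (2 * real n * \<theta>) * (2 * (cos \<theta>)\<^sup>2 - 1) + cos (2 * real n * \<theta>) * (2 * sin \<theta> * cos \<theta>)"
    "cos (2 * (1 + real n) * \<theta>) = cos (2 * real n * \<theta>) * (2 * (cos \<theta>)\<^sup>2 - 1) - sin (2 * real n * \<theta>) * (2 * sin \<theta> * cos \<theta>)" for n
  proof -
    have "2 * (1 + real n) * \<theta> = 2 * real n * \<theta> + 2 * \<theta>" by (simp add: algebra_simps)
    then show "sin (2 * (1 + real n) * \<theta>) = sin (2 * real n * \<theta>) * (2 * (cos \<theta>)\<^sup>2 - 1) + cos (2 * real n * \<theta>) * (2 * sin \<theta> * cos \<theta>)"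
      "cos (2 * (1 + real n) * \<theta>) = cos (2 * real n * \<theta>) * (2 * (cos \<theta>)\<^sup>2 - 1) - sin (2 * real n * \<theta>) * (2 * sin \<theta> * cos \<theta>)"
      by (simp_all only: sin_add cos_add sin_double cos_double_cos)
  qed
  have sc: "(sin \<theta>)\<^sup>2 = 1 - (cos \<theta>)\<^sup>2"
    by (simp add: sin_squared_eq)
  have *: "sin \<theta> * F n j = (sin (2 * real n * \<theta>) * cos \<theta> + cos (2 * real n * \<theta>) * sin \<theta>) * f j + sin (2 * real n * \<theta>) * f i \<and>
    sin \<theta> * F n i = - (sin (2 * real n * \<theta>) * f j + (sin (2 * real n * \<theta>) * cos \<theta> - cos (2 * real n * \<theta>) * sin \<theta>) * f i)" for n
  proof (induction n)
    case 0
    then show ?case by (simp add: F_def)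
  next
    case (Suc n)
    have "sin \<theta> * F (Suc n) j = - (sin \<theta> * F n j) + 2 * cos \<theta> * (sin \<theta> * F n i) + 4 * (cos \<theta>)\<^sup>2 * (sin \<theta> * F n j)"
      unfolding step c by (simp add: algebra_simps power2_eq_square)
    moreover have "sin \<theta> * F (Suc n) i = - (sin \<theta> * F n i) - 2 * cos \<theta> * (sin \<theta> * F n j)"
      unfolding step c by (simp add: algebra_simps power2_eq_square)
    moreover note Suc[THEN conjunct1] Suc[THEN conjunct2]
    ultimately show ?case
      using trig_step(1,2)[OF sc, where S = "sin (2 * real n * \<theta>)" and C = "cos (2 * real n * \<theta>)" and y = "f j" and x = "f i"]
      unfolding of_nat_Suc 3 by (simp only: conj_absorb simp_thms)
  qed
  show "sin \<theta> * F n j = sin ((2 * real n + 1) * \<theta>) * f j + sin (2 * real n * \<theta>) * f i"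
    "sin \<theta> * F n i = - (sin (2 * real n * \<theta>) * f j + sin ((2 * real n - 1) * \<theta>) * f i)"
    using *[of n] 1 2 by simp_all
  have "2 * (sin \<theta>)\<^sup>2 * (F n k - f k) =
      c j k * ((1 - cos (2 * real n * \<theta>)) * f j + (cos \<theta> - (cos (2 * real n * \<theta>) * cos \<theta> + sin (2 * real n * \<theta>) * sin \<theta>)) * f i) +
      c i k * ((cos \<theta> - (cos (2 * real n * \<theta>) * cos \<theta> - sin (2 * real n * \<theta>) * sin \<theta>)) * f j + (1 - cos (2 * real n * \<theta>)) * f i)"
  proof (induction n)
    case 0
    then show ?case by (simp add: F_def)
  next
    case (Suc n)
    have "2 * (sin \<theta>)\<^sup>2 * (F (Suc n) k - f k) = 2 * (sin \<theta>)\<^sup>2 * (F n k - f k) +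
      2 * sin \<theta> * (c j k * (sin \<theta> * F n j) + c i k * (sin \<theta> * F n i + 2 * cos \<theta> * (sin \<theta> * F n j)))"
      unfolding step by (simp add: algebra_simps power2_eq_square)
    then show ?case
      using trig_step(3)[OF sc, where S = "sin (2 * real n * \<theta>)" and C = "cos (2 * real n * \<theta>)"
        and y = "f j" and x = "f i" and q = "c j k" and p = "c i k"]
      unfolding Suc *[THEN conjunct1] *[THEN conjunct2] of_nat_Suc 3 by (simp only:)
  qed
  then show "2 * (sin \<theta>)\<^sup>2 * (F n k - f k) =
      c j k * ((1 - cos (2 * real n * \<theta>)) * f j + (cos \<theta> - cos ((2 * real n - 1) * \<theta>)) * f i) +
      c i k * ((cos \<theta> - cos ((2 * real n + 1) * \<theta>)) * f j + (1 - cos (2 * real n * \<theta>)) * f i)"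
    by (simp add: 1 2)
qed

text \<open>For \<open>n = m i j\<close> the angle \<open>2 n \<theta>\<close> is a full turn, and
  every coefficient in the third formula of \<open>tits_pow\<close> vanishes;
  \<open>sin \<theta>\<close> is nonzero because \<open>m i j \<ge> 2\<close>. For
  \<open>m i j = 0\<close> the power is the identity.\<close>

lemma tits_braid:
  assumes ij: "i \<in> I" "j \<in> I" "i \<noteq> j"
  shows "((tits i \<circ> tits j) ^^ m i j) f = f"
proof (cases "m i j = 0")
  case False
  define \<theta> where "\<theta> = pi / m i j"
  have "m i j \<noteq> 1" using ij m_eq_1 by blast
  with False have m: "m i j \<ge> 2" by linarith
  have "0 < \<theta>" "\<theta> < pi"
    using m by (simp_all add: \<theta>_def field_simps)
  then have sin: "sin \<theta> \<noteq> 0"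
    using sin_gt_zero by fastforce
  have "2 * real (m i j) * \<theta> = 2 * pi"
    using m by (simp add: \<theta>_def)
  moreover have "(2 * real (m i j) - 1) * \<theta> = 2 * pi - \<theta>" "(2 * real (m i j) + 1) * \<theta> = 2 * pi + \<theta>"
    using m by (simp_all add: \<theta>_def field_simps)
  moreover have "cos (2 * pi - \<theta>) = cos \<theta>" "cos (2 * pi + \<theta>) = cos \<theta>" "cos (2 * pi) = 1"
    by (simp_all add: cos_diff cos_add)
  ultimately have "2 * (sin \<theta>)\<^sup>2 * (((tits i \<circ> tits j) ^^ m i j) f k - f k) = 0" for k
    using tits_pow(3)[OF ij, of "m i j" f k] unfolding \<theta>_def[symmetric]
    by (simp only:) simp
  then show ?thesis using sin by auto
qed simp

text \<open>Together with \<open>braid_power\<close> this makes \<open>m i j\<close> the exact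
  order: a trivial power in \<open>W\<close> acts trivially in the geometric representation, where
  the rotation angle can be read off.\<close>

lemma order_ge:
  assumes ij: "i \<in> I" "j \<in> I" "i \<noteq> j" and n: "(s i \<cdot> s j) \<up> n = \<one>\<^bsub>W\<^esub>" "n > 0"
  shows "m i j \<noteq> 0 \<and> m i j \<le> n"
proof -
  have "wd (concat (replicate n [i, j])) = wd []"
    using n ij by (simp add: wd_concat_replicate)
  then have "foldr tits (concat (replicate n [i, j])) f = foldr tits [] f" for f
    by (intro foldr_wd_cong[where A = UNIV]) (use ij tits_braid concat_replicate_lists in simp_all)
  then have id: "((tits i \<circ> tits j) ^^ n) f = f" for f
    by (simp add: foldr_concat_replicate)
  \<comment> \<open>Two test vectors suffice: coordinate \<open>j\<close> of the image of
    \<open>?e\<close> yields \<open>sin (2 n \<theta>) = 0\<close>, that of \<open>?e'\<close>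
    yields \<open>sin ((2 n + 1) \<theta>) = sin \<theta>\<close>, and together they force
    \<open>cos (2 n \<theta>) = 1\<close>.\<close>
  let ?e = "\<lambda>k. if k = i then 1 else 0 :: real" and ?e' = "\<lambda>k. if k = j then 1 else 0 :: real"
  show ?thesis
  proof (cases "m i j = 0")
    case True
    \<comment> \<open>For \<open>m i j = 0\<close> the product is unipotent on these two coordinates
      and the orbit of \<open>?e\<close> grows linearly, so that no positive power fixes it.\<close>
    define F where "F = (\<lambda>n. ((tits i \<circ> tits j) ^^ n) ?e)"
    have m: "m i j = 0" "m j i = 0" "m i i = 1" "m j j = 1"
      using ij True m_sym[of i j] m_eq_1[of i i] m_eq_1[of j j] by simp_all
    have "F n i = 1 - 2 * real n \<and> F n j = 2 * real n" for n
    proof (induction n)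
      case (Suc n)
      have "F (Suc n) i = - (F n i + 2 * F n j)" "F (Suc n) j = - F n j + 2 * (F n i + 2 * F n j)"
        using ij m by (simp_all add: tits_def F_def)
      with Suc show ?case by simp
    qed (use ij in \<open>auto simp: F_def\<close>)
    from this[of n] show ?thesis using id[of ?e] n(2) ij by (simp add: F_def)
  next
    case False
    define \<theta> where "\<theta> = pi / m i j"
    have "m i j \<noteq> 1" using ij m_eq_1 by blast
    with False have m: "m i j \<ge> 2" by linarith
    have "0 < \<theta>" "\<theta> < pi"
      using m by (simp_all add: \<theta>_def field_simps)
    then have sin: "sin \<theta> \<noteq> 0"
      using sin_gt_zero by fastforce
    have "sin (2 * real n * \<theta>) = 0"
      using tits_pow(1)[OF ij, of n ?e] id[of ?e] ij by (simp add: \<theta>_def)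
    moreover have "sin ((2 * real n + 1) * \<theta>) = sin \<theta>"
      using tits_pow(1)[OF ij, of n ?e'] id[of ?e'] ij by (simp add: \<theta>_def)
    ultimately have "cos (2 * real n * \<theta>) = 1"
      using sin by (simp add: distrib_right sin_add)
    then obtain k :: int where k: "2 * real n * \<theta> = k * (2 * pi)"
      unfolding cos_one_2pi_int by (auto simp: mult.assoc)
    have "0 < 2 * real n * \<theta>" using n \<open>0 < \<theta>\<close> by simp
    then have "k \<ge> 1" unfolding k by (simp add: zero_less_mult_iff)
    then have "2 * pi \<le> 2 * real n * \<theta>" unfolding k by simp
    then have "real (m i j) \<le> n"
      using m by (simp add: \<theta>_def field_simps)
    with False show ?thesis by simp
  qed
qed

lemma s_neq: "i \<in> I \<Longrightarrow> j \<in> I \<Longrightarrow> i \<noteq> j \<Longrightarrow> s i \<noteq> s j"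
  using order_ge[of i j 1] m_eq_1[of i j] by force

text \<open>The word of \<open>(s i \<cdot> s k) \<up> n\<close> has \<open>2 n\<close> letters: its
  first half is \<open>altw n i k\<close>, and its second half is \<open>altw n k i\<close> read
  backwards, which is the inverse of that element.\<close>

lemma altw_swap:
  assumes "i \<in> I" "k \<in> I"
  shows "wd (altw n i k) = (s i \<cdot> s k) \<up> n \<cdot> wd (altw n k i)"
  using assms
proof (induction n arbitrary: i k)
  case (Suc n)
  note ik = Suc.prems
  have pow: "s i \<cdot> (s k \<cdot> s i) \<up> n = (s i \<cdot> s k) \<up> n \<cdot> s i" for n :: nat
  proof (induction n)
    case (Suc n)
    have "s i \<cdot> (s k \<cdot> s i) \<up> Suc n = s i \<cdot> (s k \<cdot> s i) \<up> n \<cdot> (s k \<cdot> s i)"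
      using ik by (simp add: W.m_assoc)
    then show ?case
      unfolding Suc using ik by (simp add: W.m_assoc)
  qed (use ik in simp)
  have "wd (altw (Suc n) i k) = s i \<cdot> wd (altw n k i)"
    using ik by (simp add: wd_Cons)
  also have "wd (altw n k i) = (s k \<cdot> s i) \<up> n \<cdot> wd (altw n i k)"
    by (rule Suc.IH[OF ik(2,1)])
  also have "s i \<cdot> \<dots> = s i \<cdot> (s k \<cdot> s i) \<up> n \<cdot> wd (altw n i k)"
    using ik by (simp add: W.m_assoc)
  also have "\<dots> = (s i \<cdot> s k) \<up> n \<cdot> (s i \<cdot> wd (altw n i k))"
    unfolding pow using ik by (simp add: W.m_assoc)
  also have "\<dots> = (s i \<cdot> s k) \<up> Suc n \<cdot> wd (altw (Suc n) k i)"
    using ik by (simp add: wd_Cons W.m_assoc)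
  finally show ?case .
qed simp

lemma altw_eq_iff:
  assumes "i \<in> I" "k \<in> I"
  shows "wd (altw n i k) = wd (altw n k i) \<longleftrightarrow> (s i \<cdot> s k) \<up> n = \<one>\<^bsub>W\<^esub>"
  unfolding altw_swap[OF assms, of n] using assms by simp


lemma W_inv_cancel [simp]:
  "p \<in> carrier W \<Longrightarrow> z \<in> carrier W \<Longrightarrow> \<iota> p \<cdot> (p \<cdot> z) = z"
  "p \<in> carrier W \<Longrightarrow> z \<in> carrier W \<Longrightarrow> p \<cdot> (\<iota> p \<cdot> z) = z"
  by (simp_all flip: W.m_assoc)

lemma W_conj_eq_iff:
  assumes "p \<in> carrier W" "x \<in> carrier W" "t \<in> carrier W"
  shows "p \<cdot> t \<cdot> \<iota> p = x \<longleftrightarrow> t = \<iota> p \<cdot> x \<cdot> p"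
proof
  assume "p \<cdot> t \<cdot> \<iota> p = x"
  with assms show "t = \<iota> p \<cdot> x \<cdot> p" by (auto simp: W.m_assoc)
next
  assume "t = \<iota> p \<cdot> x \<cdot> p"
  with assms show "p \<cdot> t \<cdot> \<iota> p = x" by (simp add: W.m_assoc)
qed

subsection \<open>The inversion cocycle\<close>

text \<open>The sign in Bourbaki's action of \<open>W\<close> on \<open>W \<times> {\<plusminus>1}\<close>, in which \<open>s\<^sub>i\<close> flips the sign of \<open>t\<close> only for
  \<open>t = s\<^sub>i\<close>. The action is by conjugation and, for convenience, on all of \<open>W\<close> instead of the reflections.\<close>

fun inv_word :: "'i list \<Rightarrow> 'i cox \<Rightarrow> bool" where
  "inv_word [] t = False"
| "inv_word (i # \<omega>) t = (inv_word \<omega> t \<noteq> (wd \<omega> \<cdot> t \<cdot> \<iota> wd \<omega> = s i))"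

definition flip_op :: "'i \<Rightarrow> 'i cox \<times> bool \<Rightarrow> 'i cox \<times> bool" where
  "flip_op i = (\<lambda>(t, b). (s i \<cdot> t \<cdot> s i, b \<noteq> (t = s i)))"

text \<open>Exhibits \<open>inv_word\<close> as the sign component of a composition of operators, so
  that its independence of the word follows from \<open>foldr_wd_cong\<close>.\<close>

lemma foldr_flip_op:
  assumes "\<omega> \<in> lists I" "t \<in> carrier W"
  shows "foldr flip_op \<omega> (t, b) = (wd \<omega> \<cdot> t \<cdot> \<iota> wd \<omega>, b \<noteq> inv_word \<omega> t)"
  using assms(1)
proof induction
  case Nil
  then show ?case using assms by simp
next
  case (Cons i \<omega>)
  then have \<omega>: "\<omega> \<in> lists I" by simp
  have "s i \<cdot> (wd \<omega> \<cdot> t \<cdot> \<iota> wd \<omega>) \<cdot> s i =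
      wd (i # \<omega>) \<cdot> t \<cdot> \<iota> wd (i # \<omega>)"
    using Cons \<omega> assms(2) by (simp add: wd_Cons W.inv_mult_group W.m_assoc)
  then show ?case
    using Cons.IH by (auto simp: flip_op_def)
qed

text \<open>Over two periods each value is counted twice.\<close>

lemma parity_double:
  fixes P :: "nat \<Rightarrow> bool"
  assumes "\<And>k. P (k + n) = P k"
  shows "even (\<Sum>k<2 * n. of_bool (P k) :: nat)"
proof -
  have "(\<Sum>k<n + l. f k) = (\<Sum>k<n. f k) + (\<Sum>k<l. f (k + n))" for f :: "nat \<Rightarrow> nat" and l
    by (induction l) (simp_all add: add.commute)
  from this[of _ n] assms show ?thesis
    by (simp add: mult_2)
qed

text \<open>The condition \<open>t = s\<^sub>j (s\<^sub>i s\<^sub>j)\<^sup>k\<close> is periodic in \<open>k\<close> of period \<open>m i j\<close>, so that the sign of \<open>t\<close>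
  is flipped an even number of times along the relator.\<close>

lemma flip_op_braid:
  assumes ij: "i \<in> I" "j \<in> I" and t: "t \<in> carrier W"
  shows "((flip_op i \<circ> flip_op j) ^^ m i j) (t, b) = (t, b)"
proof -
  define a where "a = s i \<cdot> s j"
  have a [simp]: "a \<in> carrier W" using ij by (simp add: a_def)
  have ia: "\<iota> a = s j \<cdot> s i" using ij by (simp add: a_def W.inv_mult_group)
  \<comment> \<open>\<open>s j\<close> conjugates \<open>a\<close> to its inverse, so that
    conjugating \<open>s j\<close> or \<open>s j \<cdot> a\<close> by a power of \<open>a\<close>
    again gives \<open>s j\<close> times a power of \<open>a\<close>.\<close>
  have conj: "s j \<cdot> a \<up> n = \<iota> (a \<up> n) \<cdot> s j" for n :: nat
  proof (induction n)
    case (Suc n)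
    have "s j \<cdot> a \<up> Suc n = s j \<cdot> a \<cdot> a \<up> n"
      unfolding W.nat_pow_Suc2[OF a] using ij by (simp add: W.m_assoc)
    also have "s j \<cdot> a = \<iota> a \<cdot> s j"
      using ij unfolding ia by (simp add: a_def W.m_assoc)
    also have "\<dots> \<cdot> a \<up> n = \<iota> a \<cdot> (s j \<cdot> a \<up> n)"
      using ij by (simp add: W.m_assoc)
    also have "\<dots> = \<iota> (a \<up> Suc n) \<cdot> s j"
      unfolding Suc using ij by (simp add: W.m_assoc W.inv_mult_group)
    finally show ?case .
  qed (use ij in simp)
  \<comment> \<open>In the pass that follows \<open>n\<close> others, \<open>flip_op j\<close> tests
    the condition with \<open>k = 2 n\<close> and \<open>flip_op i\<close> the one with
    \<open>k = 2 n + 1\<close>, so \<open>n\<close> passes run through all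
    \<open>k < 2 n\<close>.\<close>
  have pow: "((flip_op i \<circ> flip_op j) ^^ n) (t, b) = (a \<up> n \<cdot> t \<cdot> \<iota> (a \<up> n),
      b \<noteq> odd (\<Sum>k<2 * n. of_bool (t = s j \<cdot> a \<up> k) :: nat))" for n :: nat
  proof (induction n)
    case 0
    then show ?case using t by simp
  next
    case (Suc n)
    define t' where "t' = a \<up> n \<cdot> t \<cdot> \<iota> (a \<up> n)"
    have t' [simp]: "t' \<in> carrier W" using t by (simp add: t'_def)
    have 1: "t' = s j \<longleftrightarrow> t = s j \<cdot> a \<up> (2 * n)"
    proof -
      have "t' = s j \<longleftrightarrow> t = \<iota> (a \<up> n) \<cdot> s j \<cdot> a \<up> n"
        unfolding t'_def using ij t by (intro W_conj_eq_iff) simp_all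
      also have "\<iota> (a \<up> n) \<cdot> s j \<cdot> a \<up> n = s j \<cdot> a \<up> (n + n)"
        unfolding conj[symmetric] using ij by (simp add: W.m_assoc W.nat_pow_mult)
      finally show ?thesis by (simp add: mult_2)
    qed
    have 2: "s j \<cdot> t' \<cdot> s j = s i \<longleftrightarrow> t = s j \<cdot> a \<up> Suc (2 * n)"
    proof -
      have "s j \<cdot> t' \<cdot> s j = s i \<longleftrightarrow> t' = s j \<cdot> a"
      proof
        assume "s j \<cdot> t' \<cdot> s j = s i"
        then have "s j \<cdot> (s j \<cdot> t' \<cdot> s j) \<cdot> s j = s j \<cdot> s i \<cdot> s j" by simp
        then show "t' = s j \<cdot> a" using ij by (simp add: W.m_assoc a_def)
      qed (use ij in \<open>simp add: W.m_assoc a_def\<close>)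
      also have "\<dots> \<longleftrightarrow> t = \<iota> (a \<up> n) \<cdot> (s j \<cdot> a) \<cdot> a \<up> n"
        unfolding t'_def using ij t by (intro W_conj_eq_iff) simp_all
      also have "\<iota> (a \<up> n) \<cdot> (s j \<cdot> a) \<cdot> a \<up> n =
          \<iota> (a \<up> n) \<cdot> s j \<cdot> a \<up> Suc n"
        unfolding W.nat_pow_Suc2[OF a] using ij by (simp add: W.m_assoc)
      also have "\<dots> = s j \<cdot> a \<up> (n + Suc n)"
        unfolding conj[symmetric] using ij by (simp only: W.m_assoc W.nat_pow_mult s_closed a W.nat_pow_closed)
      also have "n + Suc n = Suc (2 * n)" by simp
      finally show ?thesis .
    qed
    have "s i \<cdot> (s j \<cdot> t' \<cdot> s j) \<cdot> s i = a \<cdot> t' \<cdot> \<iota> a"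
      unfolding ia using ij by (simp add: a_def W.m_assoc)
    also have "\<dots> = a \<up> Suc n \<cdot> t \<cdot> \<iota> (a \<up> Suc n)"
      unfolding t'_def W.nat_pow_Suc2[OF a] using t by (simp add: W.m_assoc W.inv_mult_group)
    finally have 3: "s i \<cdot> (s j \<cdot> t' \<cdot> s j) \<cdot> s i =
      a \<up> Suc n \<cdot> t \<cdot> \<iota> (a \<up> Suc n)" .
    have "((flip_op i \<circ> flip_op j) ^^ Suc n) (t, b) = flip_op i (flip_op j
        (t', b \<noteq> odd (\<Sum>k<2 * n. of_bool (t = s j \<cdot> a \<up> k) :: nat)))"
      by (simp only: funpow.simps comp_apply Suc t'_def)
    also have "\<dots> = (a \<up> Suc n \<cdot> t \<cdot> \<iota> (a \<up> Suc n),
        ((b \<noteq> odd (\<Sum>k<2 * n. of_bool (t = s j \<cdot> a \<up> k) :: nat)) \<noteq>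
          (t = s j \<cdot> a \<up> (2 * n))) \<noteq> (t = s j \<cdot> a \<up> Suc (2 * n)))"
      unfolding flip_op_def prod.case 1 2 3 ..
    also have "\<dots> = (a \<up> Suc n \<cdot> t \<cdot> \<iota> (a \<up> Suc n),
        b \<noteq> odd (\<Sum>k<2 * Suc n. of_bool (t = s j \<cdot> a \<up> k) :: nat))"
    proof -
      have parity: "odd (S + of_bool P + of_bool Q) \<longleftrightarrow> (odd S \<noteq> P) \<noteq> Q" for S :: nat and P Q
        by auto
      have "2 * Suc n = Suc (Suc (2 * n))" by simp
      then show ?thesis
        by (simp only: sum.lessThan_Suc parity) blast
    qed
    finally show ?case .
  qed
  have am: "a \<up> m i j = \<one>\<^bsub>W\<^esub>"
    using braid_power[OF ij] by (simp add: a_def)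
  have "even (\<Sum>k<2 * m i j. of_bool (t = s j \<cdot> a \<up> k) :: nat)"
    by (rule parity_double) (simp add: am flip: W.nat_pow_mult)
  then show ?thesis
    unfolding pow using t by (simp add: am)
qed

lemma inv_word_cong:
  assumes "\<omega> \<in> lists I" "\<omega>' \<in> lists I" "wd \<omega> = wd \<omega>'" "t \<in> carrier W"
  shows "inv_word \<omega> t = inv_word \<omega>' t"
proof -
  have "foldr flip_op \<omega> (t, False) = foldr flip_op \<omega>' (t, False)"
  proof (rule foldr_wd_cong[where A = "carrier W \<times> UNIV", OF _ _ _ assms(1-3)])
    fix i j a assume i: "i \<in> I" and a: "a \<in> carrier W \<times> (UNIV :: bool set)"
    then show "flip_op i a \<in> carrier W \<times> UNIV"
      by (auto simp: flip_op_def)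
    have "s i \<cdot> t \<cdot> s i = s i \<longleftrightarrow> t = s i" if t: "t \<in> carrier W" for t
    proof
      assume "s i \<cdot> t \<cdot> s i = s i"
      then have "s i \<cdot> (s i \<cdot> t \<cdot> s i) \<cdot> s i = s i \<cdot> s i \<cdot> s i" by simp
      then show "t = s i" using i t by (simp add: W.m_assoc)
    qed (use i in simp)
    then show "flip_op i (flip_op i a) = a"
      using i a by (auto simp: flip_op_def W.m_assoc)
    assume "j \<in> I"
    then show "((flip_op i \<circ> flip_op j) ^^ m i j) a = a"
      using i a flip_op_braid[of i j "fst a" "snd a"] by auto
  qed (use assms in simp)
  then show ?thesis
    using assms by (simp add: foldr_flip_op)
qed

definition inversion :: "'i cox \<Rightarrow> 'i cox \<Rightarrow> bool" where
  "inversion w t = inv_word (SOME \<omega>. \<omega> \<in> lists I \<and> wd \<omega> = w) t"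

lemma inversion_wd:
  assumes "\<omega> \<in> lists I" "t \<in> carrier W"
  shows "inversion (wd \<omega>) t = inv_word \<omega> t"
  unfolding inversion_def
  using someI[of "\<lambda>\<omega>'. \<omega>' \<in> lists I \<and> wd \<omega>' = wd \<omega>" \<omega>] assms inv_word_cong by blast

lemma inversion_one [simp]: "t \<in> carrier W \<Longrightarrow> \<not> inversion \<one>\<^bsub>W\<^esub> t"
  using inversion_wd[of "[]" t] by simp

lemma inversion_s [simp]: "i \<in> I \<Longrightarrow> t \<in> carrier W \<Longrightarrow> inversion (s i) t \<longleftrightarrow> t = s i"
  using inversion_wd[of "[i]" t] by (simp add: wd_single)

text \<open>The cocycle identity. In terms of roots: the root of \<open>t\<close> may change sign
  under \<open>w\<close>, and its image may change sign again under \<open>v\<close>.\<close>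

lemma inversion_mult:
  assumes "v \<in> carrier W" "w \<in> carrier W" "t \<in> carrier W"
  shows "inversion (v \<cdot> w) t \<longleftrightarrow> (inversion w t \<noteq> inversion v (w \<cdot> t \<cdot> \<iota> w))"
proof -
  obtain \<nu> \<omega> where \<nu>: "\<nu> \<in> lists I" "v = wd \<nu>" and \<omega>: "\<omega> \<in> lists I" "w = wd \<omega>"
    using assms by (meson wd_surj)
  have "foldr flip_op (\<nu> @ \<omega>) (t, False) = foldr flip_op \<nu> (foldr flip_op \<omega> (t, False))"
    by simp
  then show ?thesis
    using \<nu> \<omega> assms inversion_wd[of "\<nu> @ \<omega>" t]
    by (simp add: foldr_flip_op wd_append inversion_wd del: foldr_append)
qed

lemma inversion_s_mult:
  assumes "i \<in> I" "w \<in> carrier W" "t \<in> carrier W"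
  shows "inversion (s i \<cdot> w) t \<longleftrightarrow> (inversion w t \<noteq> (w \<cdot> t \<cdot> \<iota> w = s i))"
  using assms by (simp add: inversion_mult)

lemma inversion_mult_s:
  assumes "i \<in> I" "w \<in> carrier W"
  shows "inversion (w \<cdot> s i) (s i) \<longleftrightarrow> \<not> inversion w (s i)"
  using assms by (simp add: inversion_mult W.m_assoc)

text \<open>If the sign of \<open>t\<close> is flipped an odd number of times along
  \<open>\<omega>\<close>, some letter flips it, and deleting that letter multiplies the value by
  \<open>t\<close>. The new word is a subword, so the argument stays within the parabolic subgroup
  of \<open>J\<close>.\<close>

lemma strong_exchange:
  assumes "J \<subseteq> I" "\<omega> \<in> lists J" "t \<in> carrier W" "inversion (wd \<omega>) t"
  obtains \<omega>' where "\<omega>' \<in> lists J" "length \<omega>' < length \<omega>" "wd \<omega>' = wd \<omega> \<cdot> t"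
proof -
  have "\<exists>\<omega>'\<in>lists J. length \<omega>' < length \<omega> \<and> wd \<omega>' = wd \<omega> \<cdot> t" if "inv_word \<omega> t"
    using assms(2) that
  proof induction
    case (Cons i \<omega>)
    have i: "i \<in> I" and \<omega>: "\<omega> \<in> lists I"
      using Cons assms(1) by auto
    show ?case
    proof (cases "inv_word \<omega> t")
      case True
      with Cons obtain \<omega>' where \<omega>': "\<omega>' \<in> lists J" "length \<omega>' < length \<omega>" "wd \<omega>' = wd \<omega> \<cdot> t"
        by blast
      have "\<omega>' \<in> lists I" using \<omega>'(1) assms(1) by auto
      with \<omega>' \<omega> i Cons(1) assms(3) show ?thesis
        by (intro bexI[of _ "i # \<omega>'"]) (simp_all add: wd_Cons W.m_assoc)
    next
      case False
      with Cons have "wd \<omega> \<cdot> t \<cdot> \<iota> wd \<omega> = s i" by simp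
      then have "wd \<omega> \<cdot> t = s i \<cdot> wd \<omega>"
        using i \<omega> assms(3) W.inv_solve_right[of "s i" "wd \<omega> \<cdot> t" "wd \<omega>"]
        by simp
      then have "wd \<omega> = wd (i # \<omega>) \<cdot> t"
        using i \<omega> assms(3) by (simp add: wd_Cons W.m_assoc)
      then show ?thesis
        using Cons by (intro bexI[of _ \<omega>]) auto
    qed
  qed simp
  moreover have "\<omega> \<in> lists I" using assms by auto
  ultimately show thesis
    using assms that inversion_wd by blast
qed


subsection \<open>Reduced words\<close>

text \<open>Minimality is required only among words over \<open>J\<close>, so one can argue inside a
  parabolic subgroup without comparing its length function with that of \<open>W\<close>.\<close>

definition reduced :: "'i set \<Rightarrow> 'i list \<Rightarrow> bool" where
  "reduced J \<omega> \<longleftrightarrow> \<omega> \<in> lists J \<and> (\<forall>\<omega>'\<in>lists J. wd \<omega>' = wd \<omega> \<longrightarrow> length \<omega> \<le> length \<omega>')"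

lemma exists_reduced:
  assumes "\<omega> \<in> lists J"
  obtains \<omega>' where "reduced J \<omega>'" "wd \<omega>' = wd \<omega>"
  using ex_has_least_nat[of "\<lambda>\<omega>'. \<omega>' \<in> lists J \<and> wd \<omega>' = wd \<omega>" \<omega> length] assms
  unfolding reduced_def by (metis (no_types, lifting))

text \<open>Otherwise \<open>wd \<omega>\<close> would invert \<open>s a\<close>, and strong
  exchange would give a word shorter than \<open>\<omega>\<close> for
  \<open>wd \<omega> \<cdot> s a\<close>.\<close>

lemma reduced_last_inversion:
  assumes "J \<subseteq> I" "reduced J (\<omega> @ [a])"
  shows "inversion (wd (\<omega> @ [a])) (s a)"
proof (rule ccontr)
  assume *: "\<not> ?thesis"
  have J: "\<omega> \<in> lists J" and a: "a \<in> I" and \<omega>: "\<omega> \<in> lists I"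
    using assms by (auto simp: reduced_def)
  have wd: "wd (\<omega> @ [a]) = wd \<omega> \<cdot> s a"
    using a \<omega> wd_append[of \<omega> "[a]"] by (simp add: wd_single)
  have "inversion (wd \<omega>) (s a)"
    using * \<omega> a inversion_mult_s[of a "wd \<omega>"] unfolding wd by simp
  then obtain \<omega>' where "\<omega>' \<in> lists J" "length \<omega>' < length \<omega>" "wd \<omega>' = wd \<omega> \<cdot> s a"
    by (rule strong_exchange[OF assms(1) J s_closed[OF a]])
  then show False
    using assms(2) wd unfolding reduced_def by force
qed

lemma reduced_ConsD:
  assumes "J \<subseteq> I" "reduced J (a # \<omega>)"
  shows "reduced J \<omega>"
proof -
  have *: "a \<in> J" "\<omega> \<in> lists J" using assms by (auto simp: reduced_def)
  have "length \<omega> \<le> length \<omega>'" if \<omega>': "\<omega>' \<in> lists J" "wd \<omega>' = wd \<omega>" for \<omega>'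
  proof -
    have "wd (a # \<omega>') = wd (a # \<omega>)"
      using * that assms(1) by (subst (1 2) wd_Cons) auto
    then show ?thesis
      using assms(2) that(1) *(1) unfolding reduced_def by (metis Cons_in_lists_iff Suc_le_mono length_Cons)
  qed
  with * show ?thesis by (simp add: reduced_def)
qed

lemma not_reduced_Cons_Cons:
  assumes "J \<subseteq> I"
  shows "\<not> reduced J (a # a # \<omega>)"
proof
  assume *: "reduced J (a # a # \<omega>)"
  then have "a \<in> I" "\<omega> \<in> lists I" using assms by (auto simp: reduced_def)
  then have "wd (a # a # \<omega>) = wd \<omega>"
    by (simp add: wd_Cons)
  with * show False unfolding reduced_def by force
qed

text \<open>Adjacent letters of a reduced word differ, so with only two letters at hand the word
  alternates.\<close>

lemma reduced_rank2:
  assumes "i \<in> I" "k \<in> I" "i \<noteq> k" "reduced {i, k} \<omega>"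
  shows "\<exists>f g. {f, g} = {i, k} \<and> \<omega> = altw (length \<omega>) f g"
  using assms(4)
proof (induction \<omega>)
  case (Cons a \<omega>)
  have J: "{i, k} \<subseteq> I" using assms by simp
  have a: "a \<in> {i, k}" using Cons.prems by (auto simp: reduced_def)
  from Cons reduced_ConsD[OF J] obtain f g where fg: "{f, g} = {i, k}" "\<omega> = altw (length \<omega>) f g"
    by blast
  show ?case
  proof (cases \<omega>)
    case Nil
    then show ?thesis using a by (intro exI[of _ a] exI[of _ "if a = i then k else i"]) auto
  next
    case (Cons b \<rho>)
    then have "b = f" using fg(2) by simp
    then have "a \<noteq> f" using Cons not_reduced_Cons_Cons[OF J] \<open>reduced {i, k} (a # \<omega>)\<close> by blast
    then have "a = g" using a fg(1) by auto
    then show ?thesis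
      using fg by (intro exI[of _ g] exI[of _ f]) (auto simp del: altw.simps simp: altw.simps(2))
  qed
qed (intro exI[of _ i] exI[of _ k], simp)

definition len :: "'i cox \<Rightarrow> nat" where
  "len w = (LEAST n. \<exists>\<omega>\<in>lists I. wd \<omega> = w \<and> length \<omega> = n)"

lemma len_le: "\<omega> \<in> lists I \<Longrightarrow> len (wd \<omega>) \<le> length \<omega>"
  unfolding len_def by (rule Least_le) blast

lemma len_reduced: "reduced I \<omega> \<Longrightarrow> len (wd \<omega>) = length \<omega>"
  unfolding len_def reduced_def by (rule Least_equality) auto


subsection \<open>Elements that map a simple root to a simple root\<close>

text \<open>If \<open>\<not> inversion v (s i)\<close>, the equation \<open>v s\<^sub>i = s\<^sub>j v\<close> says that \<open>v\<close> maps the simple root of \<open>i\<close> to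
  that of \<open>j\<close>. Such elements are products of those that come from finite dihedral
  parabolic subgroups.\<close>

lemma rank2_shape:
  assumes ik: "i \<in> I" "k \<in> I" "i \<noteq> k" and \<rho>: "\<rho> \<in> lists {i, k}" and b: "b \<in> {i, k}"
    and comm: "wd \<rho> \<cdot> s i = s b \<cdot> wd \<rho>"
    and inv: "\<not> inversion (wd \<rho>) (s i)" "inversion (wd \<rho>) (s k)"
  obtains f where "f \<in> I" "f \<noteq> b" "m b f \<noteq> 0" "wd \<rho> = wd (altw (m b f - 1) f b)"
    "i = (if even (m b f) then b else f)"
proof -
  let ?J = "{i, k}"
  have J: "?J \<subseteq> I" using ik by simp
  have lI: "\<omega> \<in> lists I" if "\<omega> \<in> lists ?J" for \<omega> using that J by auto
  obtain \<rho>' where \<rho>': "reduced ?J \<rho>'" "wd \<rho>' = wd \<rho>"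
    using exists_reduced[OF \<rho>] by blast
  obtain f g where fg: "{f, g} = ?J" "\<rho>' = altw (length \<rho>') f g"
    using reduced_rank2[OF ik \<rho>'(1)] by blast
  define l where "l = length \<rho>'"
  have red: "reduced ?J (altw l f g)" and wd: "wd \<rho> = wd (altw l f g)"
    using \<rho>' fg(2) by (simp_all add: l_def)
  have f: "f \<in> I" "g \<in> I" "f \<noteq> g" "f \<in> ?J" "g \<in> ?J"
    using fg(1) ik by (auto simp: doubleton_eq_iff)
  \<comment> \<open>A word for \<open>wd \<rho>\<close> of length at most \<open>l\<close> is
    reduced, and one ending in \<open>i\<close> would make \<open>wd \<rho>\<close> invert
    \<open>s i\<close>. The cases below are refuted by producing such a word.\<close>
  have last: "a \<noteq> i" if "\<omega> @ [a] \<in> lists ?J" "length (\<omega> @ [a]) \<le> l" "wd (\<omega> @ [a]) = wd \<rho>" for \<omega> a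
  proof
    assume "a = i"
    have "length (\<omega> @ [a]) \<le> length \<omega>'" if "\<omega>' \<in> lists ?J" "wd \<omega>' = wd (\<omega> @ [a])" for \<omega>'
    proof -
      have "length (altw l f g) \<le> length \<omega>'"
        using red that wd \<open>wd (\<omega> @ [a]) = wd \<rho>\<close> by (simp only: reduced_def)
      then show ?thesis using \<open>length (\<omega> @ [a]) \<le> l\<close> by simp
    qed
    with that(1) have "reduced ?J (\<omega> @ [a])"
      unfolding reduced_def by blast
    from reduced_last_inversion[OF J this] show False
      using that(3) inv(1) \<open>a = i\<close> by simp
  qed
  have "l \<noteq> 0"
    using inv(2) wd ik by (intro notI) simp
  then obtain n where n: "l = Suc n" by (cases l) auto
  have "(if even n then f else g) \<noteq> i"
    using last[of "altw n f g" "if even n then f else g"] wd f unfolding n altw_snoc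
    by (cases "even n") simp_all
  then have next_i: "i = (if even l then f else g)"
    using fg(1) n by (auto simp: doubleton_eq_iff split: if_splits)
  \<comment> \<open>For \<open>b = f\<close> the factor \<open>s b\<close> cancels the first letter,
    so that \<open>wd \<rho> \<cdot> s i\<close> has the word \<open>altw n g f\<close>; appending
    \<open>i\<close> to it gives a word for \<open>wd \<rho>\<close> of length \<open>l\<close> that
    ends in \<open>i\<close>.\<close>
  have "b \<noteq> f"
  proof
    assume "b = f"
    then have "wd \<rho> \<cdot> s i = wd (altw n g f)"
      using f comm unfolding wd n by (simp add: wd_Cons)
    then have "wd \<rho> = wd (altw n g f) \<cdot> s i"
      using ik lI[OF \<rho>] by (simp add: W.m_assoc flip: \<open>wd \<rho> \<cdot> s i = wd (altw n g f)\<close>)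
    also have "\<dots> = wd (altw n g f @ [i])"
      using f ik by (simp add: wd_append wd_single)
    finally show False
      using last[of "altw n g f" i] f ik n by simp
  qed
  then have b: "b = g" using b fg(1) by auto
  \<comment> \<open>Prefixing \<open>b\<close> and appending \<open>i\<close> both continue the
    alternation, so \<open>comm\<close> equates the two alternating words of length
    \<open>l + 1\<close>. This bounds \<open>m g f\<close> from above.\<close>
  have "wd (altw (Suc l) g f) = wd (altw (Suc l) f g)"
  proof -
    have "wd (altw (Suc l) g f) = s b \<cdot> wd \<rho>"
      using f b wd by (simp add: wd_Cons)
    also have "\<dots> = wd (altw l f g) \<cdot> s i"
      using comm wd by simp
    also have "\<dots> = wd (altw (Suc l) f g)"
      using f ik unfolding altw_snoc next_i[symmetric] by (simp add: wd_append wd_single)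
    finally show ?thesis .
  qed
  then have pow: "(s g \<cdot> s f) \<up> Suc l = \<one>\<^bsub>W\<^esub>"
    using altw_eq_iff f by blast
  then have m: "m g f \<noteq> 0" "m g f \<le> Suc l"
    using order_ge[of g f "Suc l"] f by auto
  have swap: "wd (altw (m g f) g f) = wd (altw (m g f) f g)"
    using altw_eq_iff braid_power f by blast
  \<comment> \<open>If \<open>m g f = l\<close>, the braid relation gives the other alternating
    word, which ends in \<open>i\<close>. If \<open>m g f < l\<close>, it replaces the prefix of
    length \<open>m g f + 1\<close> by a word of length \<open>m g f - 1\<close>, against
    reducedness.\<close>
  have "\<not> m g f \<le> l"
  proof
    assume le: "m g f \<le> l"
    show False
    proof (cases "m g f = l")
      case True
      have "altw l g f = altw n g f @ [i]"
        unfolding n altw_snoc using next_i f n by (auto split: if_splits)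
      then show False
        using last[of "altw n g f" i] swap wd f ik n True by simp
    next
      case False
      obtain p where p: "m g f = Suc p" using m by (cases "m g f") auto
      define r where "r = l - Suc (Suc p)"
      have l: "l = Suc (m g f) + r" using False le p by (simp add: r_def)
      define \<tau> where "\<tau> = (if even (Suc (m g f)) then altw r f g else altw r g f)"
      have \<tau>: "\<tau> \<in> lists ?J" using f by (auto simp: \<tau>_def)
      have "wd (altw (Suc (m g f)) f g) = s f \<cdot> wd (altw (m g f) f g)"
        using f swap by (simp add: wd_Cons)
      also have "\<dots> = wd (altw p g f)"
        using f unfolding p by (simp add: wd_Cons)
      finally have "wd (altw l f g) = wd (altw p g f @ \<tau>)"
        using f lI[OF \<tau>] unfolding l altw_add \<tau>_def[symmetric] by (simp add: wd_append del: altw.simps)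
      moreover have "altw p g f @ \<tau> \<in> lists ?J"
        using \<tau> f by simp
      moreover have "length (altw p g f @ \<tau>) < length (altw l f g)"
        using l p by (simp add: \<tau>_def)
      ultimately show False using red unfolding reduced_def by (metis not_le)
    qed
  qed
  with m have "m g f = Suc l" by simp
  then show thesis
    using that[of f] f b wd next_i m by auto
qed

text \<open>Induction on the length of \<open>v\<close>. With \<open>k\<close> the last letter of a
  reduced word, split \<open>v = v' u\<close>, where \<open>u\<close> lies in the parabolic subgroup
  of \<open>i\<close> and \<open>k\<close> and \<open>v'\<close> is shortest in its coset. Then
  \<open>u\<close> conjugates \<open>s i\<close> to a simple reflection \<open>s b\<close> and has
  the shape found in \<open>rank2_shape\<close>, while the shorter \<open>v'\<close> satisfies the
  hypotheses for \<open>b\<close> and \<open>j\<close>.\<close>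

lemma simple_conj_induct [consumes 5, case_names one mult dihedral]:
  assumes "v \<in> carrier W" "i \<in> I" "j \<in> I" "v \<cdot> s i = s j \<cdot> v" "\<not> inversion v (s i)"
    and one: "\<And>i. i \<in> I \<Longrightarrow> P \<one>\<^bsub>W\<^esub> i i"
    and mult: "\<And>v w i j k. v \<in> carrier W \<Longrightarrow> w \<in> carrier W \<Longrightarrow> i \<in> I \<Longrightarrow> j \<in> I \<Longrightarrow> k \<in> I \<Longrightarrow>
      P w i j \<Longrightarrow> P v j k \<Longrightarrow> P (v \<cdot> w) i k"
    and dihedral: "\<And>b f. b \<in> I \<Longrightarrow> f \<in> I \<Longrightarrow> f \<noteq> b \<Longrightarrow> m b f \<noteq> 0 \<Longrightarrow>
      P (wd (altw (m b f - 1) f b)) (if even (m b f) then b else f) b"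
  shows "P v i j"
  using assms(1-5)
proof (induction "len v" arbitrary: v i j rule: less_induct)
  case (less v i j)
  note v = less.prems(1) and ij = less.prems(2,3) and comm = less.prems(4) and inv = less.prems(5)
  obtain \<nu> where \<nu>: "reduced I \<nu>" "wd \<nu> = v"
    using wd_surj[OF v] exists_reduced by metis
  show ?case
  proof (cases \<nu> rule: rev_cases)
    case Nil
    then have "v = \<one>\<^bsub>W\<^esub>" using \<nu> by simp
    moreover from this comm ij have "s i = s j" by simp
    then have "i = j" using s_neq ij by blast
    ultimately show ?thesis using one ij by simp
  next
    case (snoc \<omega> k)
    have k: "k \<in> I" and \<omega>: "\<omega> \<in> lists I"
      using \<nu>(1) snoc by (auto simp: reduced_def)
    have inv_k: "inversion v (s k)"
      using reduced_last_inversion[of I \<omega> k] \<nu> snoc by simp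
    with inv have ik: "i \<noteq> k" by auto
    let ?J = "{i, k}"
    have J: "?J \<subseteq> I" using ij k by simp
    have lI: "\<omega> \<in> lists I" if "\<omega> \<in> lists ?J" for \<omega> using that J by auto
    \<comment> \<open>Minimising over words makes \<open>v' = v \<cdot> wd \<tau>\<close> a shortest
      element of the coset of \<open>v\<close>; the choice \<open>[k]\<close> will show that it is
      shorter than \<open>v\<close>.\<close>
    obtain \<tau> where \<tau>: "\<tau> \<in> lists ?J"
      "\<And>\<tau>'. \<tau>' \<in> lists ?J \<Longrightarrow> len (v \<cdot> wd \<tau>) \<le> len (v \<cdot> wd \<tau>')"
      using ex_has_least_nat[of "\<lambda>\<tau>. \<tau> \<in> lists ?J" "[]" "\<lambda>\<tau>. len (v \<cdot> wd \<tau>)"] by auto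
    define v' where "v' = v \<cdot> wd \<tau>"
    define \<rho> where "\<rho> = rev \<tau>"
    have \<rho>: "\<rho> \<in> lists ?J" using \<tau>(1) by (auto simp: \<rho>_def)
    have u: "wd \<rho> \<in> carrier W" and v': "v' \<in> carrier W"
      using lI[OF \<rho>] lI[OF \<tau>(1)] v by (simp_all add: v'_def)
    have vu: "v = v' \<cdot> wd \<rho>"
      using v lI[OF \<tau>(1)] by (simp add: v'_def \<rho>_def wd_rev W.m_assoc)
    have less_len: "len v' < len v"
    proof -
      have "wd \<omega> = v \<cdot> wd [k]"
        using \<nu>(2) snoc k \<omega> by (simp add: wd_append wd_single W.m_assoc flip: \<nu>(2))
      then have "len v' \<le> len (wd \<omega>)"
        using \<tau>(2)[of "[k]"] by (simp add: v'_def)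
      also have "\<dots> \<le> length \<omega>" using \<omega> by (rule len_le)
      also have "\<dots> < len v" using len_reduced[OF \<nu>(1)] \<nu>(2) snoc by simp
      finally show ?thesis .
    qed
    \<comment> \<open>By strong exchange an inversion in the parabolic subgroup would lead to a
      shorter element of the same coset.\<close>
    have inv_v': "\<not> inversion v' (wd \<sigma>)" if \<sigma>: "\<sigma> \<in> lists ?J" for \<sigma>
    proof
      assume "inversion v' (wd \<sigma>)"
      moreover obtain \<nu>' where \<nu>': "reduced I \<nu>'" "wd \<nu>' = v'"
        using wd_surj[OF v'] exists_reduced by metis
      ultimately obtain \<omega>' where \<omega>': "\<omega>' \<in> lists I" "length \<omega>' < length \<nu>'" "wd \<omega>' = v' \<cdot> wd \<sigma>"
        using strong_exchange[of I \<nu>' "wd \<sigma>"] lI[OF \<sigma>] by (auto simp: reduced_def)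
      have "v' \<cdot> wd \<sigma> = v \<cdot> wd (\<tau> @ \<sigma>)"
        using v lI[OF \<tau>(1)] lI[OF \<sigma>] by (simp add: v'_def wd_append W.m_assoc)
      then have "len v' \<le> len (wd \<omega>')"
        using \<tau>(2)[of "\<tau> @ \<sigma>"] \<tau>(1) \<sigma> \<omega>'(3) by (simp add: v'_def)
      also have "\<dots> < len v'"
        using len_le[OF \<omega>'(1)] \<omega>'(2) len_reduced[OF \<nu>'(1)] \<nu>'(2) by simp
      finally show False by simp
    qed
    have conj_J: "wd \<rho> \<cdot> s a \<cdot> \<iota> wd \<rho> = wd (\<rho> @ [a] @ rev \<rho>)" "\<rho> @ [a] @ rev \<rho> \<in> lists ?J" if "a \<in> ?J" for a
    proof -
      show "\<rho> @ [a] @ rev \<rho> \<in> lists ?J" using \<rho> that by auto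
      have a: "a \<in> I" using that J by auto
      have "rev \<rho> \<in> lists I" using lI[OF \<rho>] by auto
      then show "wd \<rho> \<cdot> s a \<cdot> \<iota> wd \<rho> = wd (\<rho> @ [a] @ rev \<rho>)"
        using a lI[OF \<rho>] by (simp add: wd_append wd_Cons wd_rev W.m_assoc)
    qed
    \<comment> \<open>As \<open>v'\<close> contributes no sign on the parabolic subgroup, the
      cocycle identity transfers the hypotheses about \<open>v\<close> to the factor
      \<open>wd \<rho>\<close>.\<close>
    have inv_u: "inversion (wd \<rho>) (s a) = inversion v (s a)" if "a \<in> ?J" for a
      using inv_v'[OF conj_J(2)[OF that]] inversion_mult[OF v' u, of "s a"] that J
      unfolding vu conj_J(1)[OF that] by auto
    define \<sigma> where "\<sigma> = \<rho> @ [i] @ rev \<rho>"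
    define t where "t = wd \<sigma>"
    have \<sigma>: "\<sigma> \<in> lists ?J" and t: "t = wd \<rho> \<cdot> s i \<cdot> \<iota> wd \<rho>"
      using conj_J[of i] by (simp_all add: \<sigma>_def t_def)
    have tW: "t \<in> carrier W" using lI[OF \<sigma>] by (simp add: t_def)
    have v't: "v' \<cdot> t = s j \<cdot> v'"
    proof -
      have "v' \<cdot> t = v \<cdot> s i \<cdot> \<iota> wd \<rho>"
        using u v' ij by (simp add: t vu W.m_assoc)
      also have "\<dots> = s j \<cdot> v'"
        unfolding comm using u v' ij by (simp add: vu W.m_assoc)
      finally show ?thesis .
    qed
    text \<open>Comparing the inversions of \<open>v' t\<close> and \<open>s\<^sub>j v'\<close> shows that \<open>t\<close> has itself as only inversion
      in the parabolic subgroup, which forces \<open>t\<close> to be simple.\<close>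
    have inv_t: "inversion t (s a) \<longleftrightarrow> t = s a" if a: "a \<in> ?J" for a
    proof -
      have aI: "a \<in> I" using a J by auto
      have "t \<cdot> s a \<cdot> \<iota> t = wd (\<sigma> @ [a] @ rev \<sigma>)"
      proof -
        have "rev \<sigma> \<in> lists I" using lI[OF \<sigma>] by auto
        then show ?thesis
          using aI lI[OF \<sigma>] by (simp add: t_def wd_append wd_Cons wd_rev W.m_assoc)
      qed
      moreover have "\<sigma> @ [a] @ rev \<sigma> \<in> lists ?J" using \<sigma> a by auto
      ultimately have "\<not> inversion v' (t \<cdot> s a \<cdot> \<iota> t)"
        using inv_v' by simp
      then have "inversion t (s a) \<longleftrightarrow> inversion (v' \<cdot> t) (s a)"
        using inversion_mult[OF v' tW, of "s a"] aI by simp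
      also have "\<dots> \<longleftrightarrow> v' \<cdot> s a \<cdot> \<iota> v' = s j"
        unfolding v't using inversion_s_mult[of j v' "s a"] inv_v'[of "[a]"] v' aI a ij by (simp add: wd_single)
      also have "\<dots> \<longleftrightarrow> v' \<cdot> s a = v' \<cdot> t"
        using v' aI ij v't W.inv_solve_right[of "s j" "v' \<cdot> s a" v'] by auto
      also have "\<dots> \<longleftrightarrow> t = s a"
        using v' tW aI by auto
      finally show ?thesis .
    qed
    obtain \<sigma>' where \<sigma>': "reduced ?J \<sigma>'" "wd \<sigma>' = t"
      using exists_reduced[OF \<sigma>] t_def by metis
    have "\<sigma>' \<noteq> []"
    proof
      assume "\<sigma>' = []"
      then have "wd \<rho> \<cdot> s i = wd \<rho>"
        using \<sigma>'(2) t u ij W.inv_solve_right[of "\<one>\<^bsub>W\<^esub>" "wd \<rho> \<cdot> s i" "wd \<rho>"] by simp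
      then have "s i = \<one>\<^bsub>W\<^esub>" using u ij by simp
      then show False using inversion_s[of i "s i"] ij by simp
    qed
    then obtain \<alpha> b where "\<sigma>' = \<alpha> @ [b]" by (meson rev_exhaust)
    moreover from this \<sigma>' have b: "b \<in> ?J" by (auto simp: reduced_def)
    ultimately have tb: "t = s b"
      using reduced_last_inversion[OF J, of \<alpha> b] \<sigma>' inv_t[OF b] by simp
    have bI: "b \<in> I" using b J by auto
    have comm_u: "wd \<rho> \<cdot> s i = s b \<cdot> wd \<rho>"
      using t u ij unfolding tb by (simp add: W.m_assoc)
    obtain f where f: "f \<in> I" "f \<noteq> b" "m b f \<noteq> 0" "wd \<rho> = wd (altw (m b f - 1) f b)"
        "i = (if even (m b f) then b else f)"
      using rank2_shape[OF ij(1) k ik \<rho> b comm_u] inv inv_k inv_u[of i] inv_u[of k] by auto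
    then have "P (wd \<rho>) i b" using dihedral[OF bI f(1-3)] by simp
    moreover have "P v' b j"
      using less.hyps[OF less_len v' bI ij(2)] v't tb inv_v'[of "[b]"] b by (simp add: wd_single)
    ultimately show ?thesis
      unfolding vu using mult[OF v' u ij(1) bI ij(2)] by simp
  qed
qed

text \<open>Both sides of the equation are alternating words of length \<open>m b f\<close>, equal
  by the braid relation. This is what relation (iii) requires of the operators in the
  representation.\<close>

lemma dihedral_no_inversion:
  assumes "b \<in> I" "f \<in> I" "f \<noteq> b" "m b f \<noteq> 0"
  defines "u \<equiv> wd (altw (m b f - 1) f b)" and "i \<equiv> if even (m b f) then b else f"
  shows "u \<cdot> s i = s b \<cdot> u" "\<not> inversion u (s i)"
proof -
  obtain n where n: "m b f = Suc n" using assms(4) by (cases "m b f") auto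
  have i: "i \<in> I" "i = (if even n then f else b)" using assms n by (auto simp: i_def)
  have "u \<cdot> s i = wd (altw (m b f) f b)"
    using assms(1,2) i(1) unfolding u_def n altw_snoc i(2)[symmetric]
    by (simp add: wd_append wd_single)
  also have "\<dots> = wd (altw (m b f) b f)"
    using altw_eq_iff[of b f "m b f"] braid_power assms by simp
  also have "\<dots> = s b \<cdot> u"
    using assms(1,2) by (simp add: u_def n wd_Cons)
  finally show "u \<cdot> s i = s b \<cdot> u" .
  \<comment> \<open>Generalised to all \<open>k < m b f\<close> and both orders of the letters: the
    letter that would continue the word is not inverted. A flip at the first letter of a word of
    length \<open>k + 1\<close> would equate the two alternating words of that length, which is
    impossible below the order \<open>m b f\<close>.\<close>
  have "\<not> inv_word (altw k p q) (s (if even k then p else q))"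
    if "k < m b f" "{p, q} = {b, f}" for k p q
    using that
  proof (induction k arbitrary: p q)
    case (Suc k)
    have pq: "p \<in> I" "q \<in> I" "p \<noteq> q" "m p q = m b f"
      using Suc.prems(2) assms(1-3) m_sym[of b f] by (auto simp: doubleton_eq_iff)
    define c where "c = (if even k then q else p)"
    have c: "c \<in> I" using pq by (simp add: c_def)
    have "wd (altw k q p) \<cdot> s c \<cdot> \<iota> wd (altw k q p) \<noteq> s p"
    proof
      assume "wd (altw k q p) \<cdot> s c \<cdot> \<iota> wd (altw k q p) = s p"
      then have "wd (altw k q p) \<cdot> s c = s p \<cdot> wd (altw k q p)"
        using pq c W.inv_solve_right[of "s p" "wd (altw k q p) \<cdot> s c" "wd (altw k q p)"]
        by simp
      also have "\<dots> = wd (altw (Suc k) p q)"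
        using pq by (simp add: wd_Cons)
      also have "wd (altw k q p) \<cdot> s c = wd (altw (Suc k) q p)"
        using pq c unfolding altw_snoc c_def[symmetric] by (simp add: wd_append wd_single)
      finally have "(s q \<cdot> s p) \<up> Suc k = \<one>\<^bsub>W\<^esub>"
        using altw_eq_iff pq by blast
      then have "m q p \<le> Suc k" using order_ge[of q p "Suc k"] pq by auto
      then show False using Suc.prems pq m_sym[of p q] by simp
    qed
    moreover have "\<not> inv_word (altw k q p) (s c)"
      unfolding c_def using Suc.prems by (intro Suc.IH) auto
    moreover have "(if even (Suc k) then p else q) = c" by (simp add: c_def)
    ultimately show ?case by (simp only: altw.simps inv_word.simps)
  qed simp
  from this[of n f b] show "\<not> inversion u (s i)"
    using inversion_wd[of "altw n f b" "s i"] assms(1,2) i n by (auto simp: u_def)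
qed

end


section \<open>The Hecke-Hopf algebra\<close>

lemma hecke_relators_closed: "hecke_relators I m \<subseteq> carrier (free_ring (hecke_gens I))"
proof -
  let ?C = "carrier (free_ring (hecke_gens I))"
  have C_of: "frag_of u \<in> ?C" if "u \<in> lists (hecke_gens I)" for u
    using that by simp
  have C_diff: "a - b \<in> ?C" if "a \<in> ?C" "b \<in> ?C" for a b
    using that keys_diff[of a b] by auto
  have C_add: "a + b \<in> ?C" if "a \<in> ?C" "b \<in> ?C" for a b
    using that keys_add[of a b] by auto
  have gens: "GenS i \<in> hecke_gens I" "GenD i \<in> hecke_gens I" if "i \<in> I" for i
    using that by (auto simp: hecke_gens_def)
  have altw: "map GenS (altw n i j) \<in> lists (hecke_gens I)" if "i \<in> I" "j \<in> I" for n i j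
    using altw_in_lists[OF that, of n] gens by auto
  show ?thesis
    unfolding hecke_relators_def alt_word_altw Un_subset_iff
    by (intro conjI; clarify; intro C_diff C_add C_of)
      (simp_all add: gens altw concat_replicate_lists)
qed

lemma idempotent_relators_closed: "idempotent_relators X \<subseteq> carrier (free_ring X)"
proof
  fix r assume "r \<in> idempotent_relators X"
  then obtain x where "r = frag_of [x, x] - frag_of [x]" "x \<in> X"
    by (auto simp: idempotent_relators_def)
  then show "r \<in> carrier (free_ring X)"
    using keys_diff[of "frag_of [x, x]" "frag_of [x]"] by auto
qed

lemma hecke_relatorsI:
  "i \<in> I \<Longrightarrow> frag_of [GenS i, GenS i] - frag_of [] \<in> hecke_relators I m"
  "i \<in> I \<Longrightarrow> frag_of [GenD i, GenD i] - frag_of [GenD i] \<in> hecke_relators I m"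
  "i \<in> I \<Longrightarrow> (frag_of [GenS i, GenD i] + frag_of [GenD i, GenS i]) - (frag_of [GenS i] - frag_of [])
    \<in> hecke_relators I m"
  "i \<in> I \<Longrightarrow> j \<in> I \<Longrightarrow>
    frag_of (concat (replicate (m i j) [GenS i, GenS j])) - frag_of [] \<in> hecke_relators I m"
  "i \<in> I \<Longrightarrow> j \<in> I \<Longrightarrow> i \<noteq> j \<Longrightarrow> m i j \<noteq> 0 \<Longrightarrow> frag_of (GenD i # alt_word (m i j - 1) j i)
    - frag_of (alt_word (m i j - 1) j i @ [GenD (if even (m i j) then i else j)]) \<in> hecke_relators I m"
  unfolding hecke_relators_def Un_iff mem_Collect_eq by blast+

context coxeter
begin

abbreviation "H \<equiv> H_hat I m"
abbreviation add_H (infixl "\<boxplus>" 65) where "a \<boxplus> b \<equiv> a \<oplus>\<^bsub>H\<^esub> b"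
abbreviation diff_H (infixl "\<boxminus>" 65) where "a \<boxminus> b \<equiv> a \<ominus>\<^bsub>H\<^esub> b"
abbreviation "Hs \<equiv> H_s I m"
abbreviation "Hd \<equiv> H_D I m"
abbreviation mult_H (infixl "\<star>" 70) where "a \<star> b \<equiv> a \<otimes>\<^bsub>H\<^esub> b"
abbreviation "T \<equiv> presented_ring Rfl (idempotent_relators Rfl)"

sublocale H: presentation "hecke_gens I" "hecke_relators I m"
  rewrites "presented_ring (hecke_gens I) (hecke_relators I m) = H"
  by (unfold_locales, rule hecke_relators_closed) (simp add: H_hat_def)

sublocale T: presentation "Rfl" "idempotent_relators Rfl"
  by unfold_locales (rule idempotent_relators_closed)

lemma gens [simp]: "i \<in> I \<Longrightarrow> GenS i \<in> hecke_gens I" "i \<in> I \<Longrightarrow> GenD i \<in> hecke_gens I"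
  by (auto simp: hecke_gens_def)

lemma map_GenS_lists [simp]: "\<omega> \<in> lists I \<Longrightarrow> map GenS \<omega> \<in> lists (hecke_gens I)"
  by auto

lemma H_s_proj: "Hs i = H.proj (frag_of [GenS i])"
  and H_D_proj: "Hd i = H.proj (frag_of [GenD i])"
  by (simp_all add: H_s_def H_D_def H.ring_gen_proj)

lemma H_s_closed [simp]: "i \<in> I \<Longrightarrow> Hs i \<in> carrier H"
  and H_D_closed [simp]: "i \<in> I \<Longrightarrow> Hd i \<in> carrier H"
  by (simp_all add: H_s_proj H_D_proj)

lemma H_s_H_s [simp]: "i \<in> I \<Longrightarrow> Hs i \<star> Hs i = \<one>\<^bsub>H\<^esub>"
  using H.relator_proj[OF hecke_relatorsI(1), of i] H.proj_append[of "[GenS i]" "[GenS i]"]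
  by (simp add: H_s_proj H.proj_Nil)

lemma H_D_H_D [simp]: "i \<in> I \<Longrightarrow> Hd i \<star> Hd i = Hd i"
  using H.relator_proj[OF hecke_relatorsI(2), of i] H.proj_append[of "[GenD i]" "[GenD i]"]
  by (simp add: H_D_proj)

lemma H_s_H_D:
  assumes i: "i \<in> I"
  shows "Hs i \<star> Hd i \<boxplus> Hd i \<star> Hs i = Hs i \<boxminus> \<one>\<^bsub>H\<^esub>"
proof -
  let ?a = "frag_of [GenS i, GenD i]" and ?b = "frag_of [GenD i, GenS i]"
  let ?c = "frag_of [GenS i]"
  have keys: "supp (?a + ?b) \<subseteq> lists (hecke_gens I)"
    "supp (?c - frag_of []) \<subseteq> lists (hecke_gens I)"
    using i by (intro order_trans[OF keys_add] order_trans[OF keys_diff]; simp)+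
  have "H.proj (?a + ?b) = H.proj (?c - frag_of [])"
    by (rule H.relator_proj[OF hecke_relatorsI(3)[OF i] keys])
  moreover have "H.proj (?a + ?b) = H.proj ?a \<boxplus> H.proj ?b"
    using H.proj.hom_add[of ?a ?b] i by simp
  moreover have "H.proj (?c - frag_of []) = H.proj ?c \<boxminus> \<one>\<^bsub>H\<^esub>"
    using H.proj_diff[of ?c "frag_of []"] i by (simp add: H.proj_Nil)
  ultimately show ?thesis
    using H.proj_append[of "[GenS i]" "[GenD i]"] H.proj_append[of "[GenD i]" "[GenS i]"] i
    by (simp add: H_s_proj H_D_proj)
qed

section \<open>Group elements inside the algebra\<close>

definition hword :: "'i list \<Rightarrow> 'i hecke" where
  "hword \<omega> = H.proj (frag_of (map GenS \<omega>))"

lemma hword_Nil [simp]: "hword [] = \<one>\<^bsub>H\<^esub>"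
  by (simp add: hword_def H.proj_Nil)

lemma hword_append:
  "\<omega> \<in> lists I \<Longrightarrow> \<omega>' \<in> lists I \<Longrightarrow> hword (\<omega> @ \<omega>') = hword \<omega> \<star> hword \<omega>'"
  unfolding hword_def map_append by (rule H.proj_append) simp_all

lemma hword_single: "hword [i] = Hs i"
  by (simp add: hword_def H_s_proj)

lemma hword_Cons: "i \<in> I \<Longrightarrow> \<omega> \<in> lists I \<Longrightarrow> hword (i # \<omega>) = Hs i \<star> hword \<omega>"
  using hword_append[of "[i]" \<omega>] by (simp add: hword_single)

lemma hword_closed [simp]: "\<omega> \<in> lists I \<Longrightarrow> hword \<omega> \<in> carrier H"
  by (simp add: hword_def)

lemma hword_relator:
  assumes "i \<in> I" "j \<in> I"
  shows "hword (concat (replicate (m i j) [i, j])) = \<one>\<^bsub>H\<^esub>"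
proof -
  let ?u = "concat (replicate (m i j) [GenS i, GenS j])"
  have "map GenS (concat (replicate n [i, j])) = concat (replicate n [GenS i, GenS j])" for n
    by (induction n) auto
  moreover have "H.proj (frag_of ?u) = H.proj (frag_of [])"
    by (rule H.relator_proj[OF hecke_relatorsI(4)[OF assms]])
      (use assms in \<open>simp_all add: concat_replicate_lists\<close>)
  ultimately show ?thesis by (simp add: hword_def H.proj_Nil)
qed

text \<open>The left multiplications by \<open>Hs i\<close> satisfy the Coxeter relations; applied
  to \<open>1\<close> they return the value of the word.\<close>

lemma hword_cong:
  assumes "\<omega> \<in> lists I" "\<omega>' \<in> lists I" "wd \<omega> = wd \<omega>'"
  shows "hword \<omega> = hword \<omega>'"
proof -
  have eq: "foldr (\<lambda>i a. Hs i \<star> a) \<omega> a = hword \<omega> \<star> a"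
    if "\<omega> \<in> lists I" "a \<in> carrier H" for \<omega> a
    using that(1)
    by induction (use that(2) in \<open>simp_all add: hword_Cons H.pres.m_assoc\<close>)
  have "foldr (\<lambda>i a. Hs i \<star> a) \<omega> \<one>\<^bsub>H\<^esub> = foldr (\<lambda>i a. Hs i \<star> a) \<omega>' \<one>\<^bsub>H\<^esub>"
  proof (rule foldr_wd_cong[where A = "carrier H", OF _ _ _ assms])
    fix i j a assume i: "i \<in> I" and a: "a \<in> carrier H"
    show "Hs i \<star> a \<in> carrier H" using i a by simp
    show "Hs i \<star> (Hs i \<star> a) = a"
      using i a by (simp flip: H.pres.m_assoc)
    assume j: "j \<in> I"
    show "(((\<star>) (Hs i) \<circ> (\<star>) (Hs j)) ^^ m i j) a = a"
      using eq[OF concat_replicate_lists[OF i j] a, of "m i j"] hword_relator[OF i j] a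
      by (simp add: foldr_concat_replicate)
  qed simp
  then show ?thesis using assms by (simp add: eq)
qed

definition hgrp :: "'i cox \<Rightarrow> 'i hecke" where
  "hgrp w = hword (SOME \<omega>. \<omega> \<in> lists I \<and> wd \<omega> = w)"

lemma hgrp_wd: "\<omega> \<in> lists I \<Longrightarrow> hgrp (wd \<omega>) = hword \<omega>"
  unfolding hgrp_def
  using someI[of "\<lambda>\<omega>'. \<omega>' \<in> lists I \<and> wd \<omega>' = wd \<omega>" \<omega>] hword_cong by blast

lemma hgrp_s [simp]: "i \<in> I \<Longrightarrow> hgrp (s i) = Hs i"
  using hgrp_wd[of "[i]"] by (simp add: wd_single hword_single)

lemma hgrp_one [simp]: "hgrp \<one>\<^bsub>W\<^esub> = \<one>\<^bsub>H\<^esub>"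
  using hgrp_wd[of "[]"] by simp

lemma hgrp_closed [simp]: "w \<in> carrier W \<Longrightarrow> hgrp w \<in> carrier H"
  by (metis wd_surj hgrp_wd hword_closed)

lemma hgrp_mult: "v \<in> carrier W \<Longrightarrow> w \<in> carrier W \<Longrightarrow> hgrp (v \<cdot> w) = hgrp v \<star> hgrp w"
  by (metis wd_surj hgrp_wd hword_append wd_append append_in_lists_conv)

lemma hgrp_inv [simp]:
  "w \<in> carrier W \<Longrightarrow> hgrp w \<star> hgrp (\<iota> w) = \<one>\<^bsub>H\<^esub>"
  "w \<in> carrier W \<Longrightarrow> hgrp (\<iota> w) \<star> hgrp w = \<one>\<^bsub>H\<^esub>"
  by (simp_all flip: hgrp_mult)

lemma hgrp_inv_left [simp]:
  "w \<in> carrier W \<Longrightarrow> a \<in> carrier H \<Longrightarrow> hgrp w \<star> (hgrp (\<iota> w) \<star> a) = a"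
  "w \<in> carrier W \<Longrightarrow> a \<in> carrier H \<Longrightarrow> hgrp (\<iota> w) \<star> (hgrp w \<star> a) = a"
  by (simp_all flip: H.pres.m_assoc)

text \<open>The dihedral case of \<open>hgrp_H_D\<close>: relation (iii) rewritten with the group
  element \<open>u\<close>.\<close>

lemma H_D_dihedral:
  assumes "b \<in> I" "f \<in> I" "f \<noteq> b" "m b f \<noteq> 0"
  defines "u \<equiv> wd (altw (m b f - 1) f b)"
  shows "hgrp u \<star> Hd (if even (m b f) then b else f) = Hd b \<star> hgrp u"
proof -
  let ?\<omega> = "altw (m b f - 1) f b" and ?i = "if even (m b f) then b else f"
  have \<omega>: "?\<omega> \<in> lists I" using assms by simp
  have "H.proj (frag_of (GenD b # map GenS ?\<omega>)) = H.proj (frag_of (map GenS ?\<omega> @ [GenD ?i]))"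
    by (rule H.relator_proj[OF hecke_relatorsI(5)[where i = b and j = f and m = m and I = I, unfolded alt_word_altw]])
      (use assms \<omega> in \<open>simp_all\<close>)
  then show ?thesis
    using assms \<omega> H.proj_append[of "[GenD b]" "map GenS ?\<omega>"] H.proj_append[of "map GenS ?\<omega>" "[GenD ?i]"]
    by (simp add: u_def hgrp_wd hword_def H_D_proj)
qed

lemma hgrp_H_D:
  assumes "v \<in> carrier W" "i \<in> I" "j \<in> I" "v \<cdot> s i = s j \<cdot> v" "\<not> inversion v (s i)"
  shows "hgrp v \<star> Hd i = Hd j \<star> hgrp v"
  using assms
proof (induction v i j rule: simple_conj_induct)
  case (mult v w i j k)
  have "hgrp (v \<cdot> w) \<star> Hd i = hgrp v \<star> (hgrp w \<star> Hd i)"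
    using mult by (simp add: hgrp_mult H.pres.m_assoc)
  also have "\<dots> = hgrp v \<star> Hd j \<star> hgrp w"
    unfolding mult(6) using mult(1-5) by (simp add: H.pres.m_assoc)
  also have "\<dots> = Hd k \<star> hgrp (v \<cdot> w)"
    unfolding mult(7) using mult(1-5) by (simp add: hgrp_mult H.pres.m_assoc)
  finally show ?case .
qed (use H_D_dihedral in simp_all)


subsection \<open>The family of idempotents indexed by the reflections\<close>

lemma reflection_closed: "t \<in> Rfl \<Longrightarrow> t \<in> carrier W"
  by (auto simp: reflections_def)

lemma simple_reflection [simp]: "i \<in> I \<Longrightarrow> s i \<in> Rfl"
  unfolding reflections_def by (intro CollectI exI[of _ "\<one>\<^bsub>W\<^esub>"] exI[of _ i]) simp

lemma reflection_conj:
  assumes "t \<in> Rfl" "w \<in> carrier W"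
  shows "w \<cdot> t \<cdot> \<iota> w \<in> Rfl"
proof -
  obtain v i where v: "t = v \<cdot> s i \<cdot> \<iota> v" "v \<in> carrier W" "i \<in> I"
    using assms by (auto simp: reflections_def)
  then show ?thesis
    unfolding reflections_def using assms(2)
    by (intro CollectI exI[of _ "w \<cdot> v"] exI[of _ i]) (simp add: W.inv_mult_group W.m_assoc)
qed

lemma reflection_conj_s:
  assumes "t \<in> Rfl" "i \<in> I"
  shows "s i \<cdot> t \<cdot> s i \<in> Rfl"
  using reflection_conj[OF assms(1), of "s i"] assms(2) by simp

text \<open>In terms of roots: \<open>wd \<omega>\<close> maps the simple root of \<open>i\<close>
  to the positive root of \<open>t\<close>.\<close>

definition positive_rep :: "'i cox \<Rightarrow> 'i list \<Rightarrow> 'i \<Rightarrow> bool" where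
  "positive_rep t \<omega> i \<longleftrightarrow> \<omega> \<in> lists I \<and> i \<in> I \<and> t = wd \<omega> \<cdot> s i \<cdot> \<iota> wd \<omega> \<and>
    \<not> inversion (wd \<omega>) (s i)"

text \<open>Both \<open>w\<close> and \<open>w \<cdot> s i\<close> conjugate \<open>s i\<close> to
  \<open>t\<close>, and exactly one of them does not invert \<open>s i\<close>.\<close>

lemma exists_positive_rep:
  assumes "t \<in> Rfl"
  shows "\<exists>\<omega> i. positive_rep t \<omega> i"
proof -
  obtain w i where w: "t = w \<cdot> s i \<cdot> \<iota> w" "w \<in> carrier W" "i \<in> I"
    using assms by (auto simp: reflections_def)
  obtain \<omega> where \<omega>: "\<omega> \<in> lists I" "w = wd \<omega>" using wd_surj[OF w(2)] by blast
  show ?thesis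
  proof (cases "inversion w (s i)")
    case False
    then show ?thesis using w \<omega> by (intro exI[of _ \<omega>] exI[of _ i]) (auto simp: positive_rep_def)
  next
    case True
    have "wd (\<omega> @ [i]) = w \<cdot> s i"
      using w \<omega> by (simp add: wd_append wd_single)
    moreover from this have "t = wd (\<omega> @ [i]) \<cdot> s i \<cdot> \<iota> wd (\<omega> @ [i])"
      using w by (simp add: W.inv_mult_group W.m_assoc)
    moreover have "\<not> inversion (w \<cdot> s i) (s i)"
      using True inversion_mult_s[OF w(3,2)] by simp
    ultimately show ?thesis
      using w \<omega> by (intro exI[of _ "\<omega> @ [i]"] exI[of _ i]) (auto simp: positive_rep_def)
  qed
qed

text \<open>Kept as a word because the action is defined on the free ring. The choice of
  representative is harmless in \<open>H\<close> by \<open>d_family_eq\<close> and for the operators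
  by \<open>act_d_word\<close>.\<close>

definition d_word :: "'i cox \<Rightarrow> 'i hecke_gen list" where
  "d_word t = (let (\<omega>, i) = (SOME (\<omega>, i). positive_rep t \<omega> i) in
    map GenS \<omega> @ [GenD i] @ map GenS (rev \<omega>))"

lemma d_word:
  assumes "t \<in> Rfl"
  obtains \<omega> i where "positive_rep t \<omega> i" "d_word t = map GenS \<omega> @ [GenD i] @ map GenS (rev \<omega>)"
  using someI_ex[of "\<lambda>(\<omega>, i). positive_rep t \<omega> i"] exists_positive_rep[OF assms]
  unfolding d_word_def by (fastforce simp: Let_def)

lemma rev_lists [simp]: "\<omega> \<in> lists A \<Longrightarrow> rev \<omega> \<in> lists A"
  by auto

lemma d_word_closed [simp]: "t \<in> Rfl \<Longrightarrow> d_word t \<in> lists (hecke_gens I)"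
  by (erule d_word) (simp add: positive_rep_def)

definition d_family :: "'i cox \<Rightarrow> 'i hecke" where
  "d_family = (\<lambda>t\<in>Rfl. H.proj (frag_of (d_word t)))"

lemma d_family_closed [simp]: "t \<in> Rfl \<Longrightarrow> d_family t \<in> carrier H"
  by (simp add: d_family_def)

text \<open>If \<open>v\<close>, \<open>j\<close> is the representative chosen for the same
  reflection, then \<open>v^-1 w\<close> maps the simple root of \<open>i\<close> to that of
  \<open>j\<close>, and \<open>hgrp_H_D\<close> moves \<open>Hd i\<close> past it.\<close>

lemma d_family_eq:
  assumes w: "w \<in> carrier W" and i: "i \<in> I" and pos: "\<not> inversion w (s i)"
  shows "d_family (w \<cdot> s i \<cdot> \<iota> w) = hgrp w \<star> Hd i \<star> hgrp (\<iota> w)"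
proof -
  let ?t = "w \<cdot> s i \<cdot> \<iota> w"
  have t: "?t \<in> Rfl"
    using reflection_conj[of "s i" w] w i by simp
  obtain \<omega> j where rep: "positive_rep ?t \<omega> j"
    and word: "d_word ?t = map GenS \<omega> @ [GenD j] @ map GenS (rev \<omega>)"
    using d_word[OF t] by blast
  let ?v = "wd \<omega>"
  have \<omega>: "\<omega> \<in> lists I" and j: "j \<in> I" and tv: "?t = ?v \<cdot> s j \<cdot> \<iota> ?v"
    and pos': "\<not> inversion ?v (s j)"
    using rep by (auto simp: positive_rep_def)
  have v: "?v \<in> carrier W" using \<omega> by (rule wd_closed)
  let ?x = "\<iota> ?v \<cdot> w"
  have "?x \<cdot> s i = \<iota> ?v \<cdot> ?t \<cdot> w"
    using v w i by (simp add: W.m_assoc)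
  also have "\<dots> = s j \<cdot> ?x"
    unfolding tv using v w j by (simp add: W.m_assoc)
  finally have comm: "?x \<cdot> s i = s j \<cdot> ?x" .
  \<comment> \<open>The identity inverts nothing and \<open>?v\<close> does not invert
    \<open>s j\<close>, so the cocycle identity shows that the inverse of \<open>?v\<close> does not
    invert \<open>?t\<close>.\<close>
  have "inversion (\<iota> ?v \<cdot> ?v) (s j) \<longleftrightarrow> inversion ?v (s j) \<noteq> inversion (\<iota> ?v) ?t"
    unfolding tv using v j by (intro inversion_mult) simp_all
  then have "\<not> inversion (\<iota> ?v) ?t"
    using v j pos' by simp
  then have "\<not> inversion ?x (s i)"
    using inversion_mult[of "\<iota> ?v" w "s i"] v w i pos by simp
  with comm have D: "hgrp ?x \<star> Hd i = Hd j \<star> hgrp ?x"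
    using v w i j by (intro hgrp_H_D) simp_all
  have "d_family ?t = hword \<omega> \<star> (Hd j \<star> hword (rev \<omega>))"
    unfolding d_family_def restrict_apply' [OF t] word hword_def H_D_proj
    using \<omega> j by (simp only: H.proj_append append_in_lists_conv map_GenS_lists rev_lists
        Cons_in_lists_iff gens lists.Nil simp_thms)
  also have "\<dots> = hgrp ?v \<star> (Hd j \<star> (hgrp ?x \<star> hgrp (\<iota> w)))"
    using \<omega> v w by (simp add: W.m_assoc flip: hgrp_mult hgrp_wd wd_rev)
  also have "\<dots> = hgrp ?v \<star> (hgrp ?x \<star> Hd i) \<star> hgrp (\<iota> w)"
    unfolding D using v w i j by (simp add: H.pres.m_assoc)
  also have "\<dots> = hgrp w \<star> Hd i \<star> hgrp (\<iota> w)"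
    using v w i by (simp add: hgrp_mult H.pres.m_assoc)
  finally show ?thesis .
qed

lemma d_family_s [simp]: "i \<in> I \<Longrightarrow> d_family (s i) = Hd i"
  using d_family_eq[of "\<one>\<^bsub>W\<^esub>" i] by simp

text \<open>The cocycle identity turns a positive representative of \<open>t\<close> into one of the
  conjugate. For \<open>w = s i\<close> this becomes the conjugation property that defines the
  family.\<close>

lemma d_family_conj:
  assumes w: "w \<in> carrier W" and t: "t \<in> Rfl" and pos: "\<not> inversion w t"
  shows "d_family (w \<cdot> t \<cdot> \<iota> w) = hgrp w \<star> d_family t \<star> hgrp (\<iota> w)"
proof -
  obtain \<omega> i where "positive_rep t \<omega> i" using exists_positive_rep[OF t] by blast
  then have v: "wd \<omega> \<in> carrier W" and i: "i \<in> I" and tv: "t = wd \<omega> \<cdot> s i \<cdot> \<iota> wd \<omega>"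
    and pos': "\<not> inversion (wd \<omega>) (s i)"
    by (auto simp: positive_rep_def)
  have "\<not> inversion (w \<cdot> wd \<omega>) (s i)"
    using inversion_mult[OF w v, of "s i"] i pos pos' tv by simp
  from d_family_eq[OF _ i this] d_family_eq[OF v i pos'] show ?thesis
    using v w i unfolding tv by (simp add: hgrp_mult W.inv_mult_group W.m_assoc H.pres.m_assoc)
qed

lemma d_family_conj_s:
  assumes "i \<in> I" "t \<in> Rfl" "t \<noteq> s i"
  shows "d_family (s i \<cdot> t \<cdot> s i) = Hs i \<star> d_family t \<star> Hs i"
  using d_family_conj[of "s i" t] assms reflection_closed[of t] by simp

lemma d_family_idem:
  assumes t: "t \<in> Rfl"
  shows "d_family t \<star> d_family t = d_family t"
proof -
  obtain \<omega> i where "positive_rep t \<omega> i" using exists_positive_rep[OF t] by blast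
  then have v: "wd \<omega> \<in> carrier W" and i: "i \<in> I" and tv: "t = wd \<omega> \<cdot> s i \<cdot> \<iota> wd \<omega>"
    and pos: "\<not> inversion (wd \<omega>) (s i)"
    by (auto simp: positive_rep_def)
  have "hgrp (wd \<omega>) \<star> Hd i \<star> hgrp (\<iota> wd \<omega>) \<star>
      (hgrp (wd \<omega>) \<star> Hd i \<star> hgrp (\<iota> wd \<omega>)) =
      hgrp (wd \<omega>) \<star> (Hd i \<star> Hd i) \<star> hgrp (\<iota> wd \<omega>)"
    using v i by (simp add: H.pres.m_assoc del: H_D_H_D)
  then show ?thesis
    using d_family_eq[OF v i pos] i unfolding tv by simp
qed

lemma is_D_family_d_family: "is_D_family I m d_family"
  unfolding is_D_family_def
proof (intro conjI ballI)
  show "d_family \<in> Rfl \<rightarrow>\<^sub>E carrier H"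
    by (rule PiE_I) (simp, simp only: d_family_def restrict_apply if_False)
qed (use d_family_conj_s in simp_all)

lemma is_D_family_unique:
  assumes D: "is_D_family I m D" and E: "is_D_family I m E"
  shows "D = E"
proof (rule extensionalityI)
  show "D \<in> extensional Rfl" "E \<in> extensional Rfl"
    using D E by (auto simp: is_D_family_def PiE_def)
  have *: "D (wd \<omega> \<cdot> s i \<cdot> \<iota> wd \<omega>) = E (wd \<omega> \<cdot> s i \<cdot> \<iota> wd \<omega>)"
    if "\<omega> \<in> lists I" "i \<in> I" for \<omega> i
    using that(1)
  proof induction
    case Nil
    then show ?case using D E that(2) by (simp add: is_D_family_def)
  next
    case (Cons k \<omega>)
    let ?t = "wd \<omega> \<cdot> s i \<cdot> \<iota> wd \<omega>"
    have t: "?t \<in> Rfl"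
      using Cons that by (intro reflection_conj) simp_all
    have eq: "wd (k # \<omega>) \<cdot> s i \<cdot> \<iota> wd (k # \<omega>) = s k \<cdot> ?t \<cdot> s k"
      using Cons that by (simp add: wd_Cons W.inv_mult_group W.m_assoc)
    show ?case
    proof (cases "?t = s k")
      \<comment> \<open>The conjugation property leaves out this case, but \<open>s k\<close> is
        fixed under conjugation by itself and its value is prescribed.\<close>
      case True
      then show ?thesis using D E Cons unfolding eq by (simp add: is_D_family_def)
    next
      case False
      then show ?thesis
        using D E Cons t unfolding eq is_D_family_def by simp
    qed
  qed
  fix t assume "t \<in> Rfl"
  then obtain w i where w: "t = w \<cdot> s i \<cdot> \<iota> w" "w \<in> carrier W" "i \<in> I"
    by (auto simp: reflections_def)
  obtain \<omega> where "\<omega> \<in> lists I" "w = wd \<omega>" using wd_surj[OF w(2)] by blast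
  then show "D t = E t" using * w by simp
qed

lemma D_refl_eq: "D_refl I m = d_family"
  unfolding D_refl_def
  by (rule the_equality, rule is_D_family_d_family, rule is_D_family_unique[OF _ is_D_family_d_family])

section \<open>The canonical map from the group ring\<close>

lemma ring_group_ring: "ring (monoid_ring W)"
  by (rule ring_monoid_ring) (rule W.monoid_axioms)

lemma group_ring_map:
  "group_ring_map I m \<in> ring_hom (monoid_ring W) H"
  "w \<in> carrier W \<Longrightarrow> group_ring_map I m (frag_of w) = hgrp w"
proof -
  have M: "monoid W" ..
  have "hgrp \<in> hom W H"
    by (rule homI) (simp_all add: hgrp_mult)
  then obtain h where h: "h \<in> ring_hom (monoid_ring W) H"
    "\<And>w. w \<in> carrier W \<Longrightarrow> h (frag_of w) = hgrp w"
    using monoid_ring_universal[OF M H.pres.ring_axioms, of hgrp] by (metis hgrp_one)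
  \<comment> \<open>The definite description asks for an extensional function, so the homomorphism
    is restricted to the carrier.\<close>
  define h' where "h' = restrict h (carrier (monoid_ring W))"
  have h': "h' \<in> ring_hom (monoid_ring W) H"
    unfolding h'_def by (rule ring.ring_hom_restrict[OF ring_group_ring h(1)]) simp
  have h'_of: "h' (frag_of w) = hgrp w" if "w \<in> carrier W" for w
    using that h(2) by (simp add: h'_def)
  have "group_ring_map I m = h'"
    unfolding group_ring_map_def
  proof (rule the_equality)
    show "h' \<in> ring_hom (monoid_ring W) H \<and> h' \<in> extensional (carrier (monoid_ring W)) \<and>
        (\<forall>i\<in>I. h' (frag_of (s i)) = Hs i)"
      using h' h'_of by (auto simp: h'_def)
    fix g assume g: "g \<in> ring_hom (monoid_ring W) H \<and> g \<in> extensional (carrier (monoid_ring W)) \<and>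
        (\<forall>i\<in>I. g (frag_of (s i)) = Hs i)"
    have g_wd: "g (frag_of (wd \<omega>)) = hword \<omega>" if "\<omega> \<in> lists I" for \<omega>
      using that
    proof induction
      case Nil
      then show ?case using g ring_hom_one[of g "monoid_ring W" H] by simp
    next
      case (Cons i \<omega>)
      have "frag_of (wd (i # \<omega>)) = frag_of (s i) \<otimes>\<^bsub>monoid_ring W\<^esub> frag_of (wd \<omega>)"
        using Cons by (simp add: wd_Cons)
      also have "g \<dots> = g (frag_of (s i)) \<star> g (frag_of (wd \<omega>))"
        using g Cons ring_hom_mult[of g "monoid_ring W" H "frag_of (s i)" "frag_of (wd \<omega>)"]
        by simp
      finally show ?case
        using Cons g by (simp add: hword_Cons)
    qed
    show "g = h'"
    proof (rule extensionalityI)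
      show "g \<in> extensional (carrier (monoid_ring W))" "h' \<in> extensional (carrier (monoid_ring W))"
        using g by (simp_all add: h'_def)
      fix x assume x: "x \<in> carrier (monoid_ring W)"
      show "g x = h' x"
      proof (rule ring_hom_monoid_ring_cong[OF M H.pres.ring_axioms _ h'])
        show "g (frag_of w) = h' (frag_of w)" if w: "w \<in> carrier W" for w
        proof -
          obtain \<omega> where "\<omega> \<in> lists I" "w = wd \<omega>" using wd_surj[OF w] by blast
          then show ?thesis using g_wd h'_of[OF w] hgrp_wd by simp
        qed
      qed (use g x in auto)
    qed
  qed
  then show "group_ring_map I m \<in> ring_hom (monoid_ring W) H"
    "w \<in> carrier W \<Longrightarrow> group_ring_map I m (frag_of w) = hgrp w"
    using h' h'_of by simp_all
qed


section \<open>A representation on functions on the Coxeter group\<close>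

abbreviation "F \<equiv> free_ring Rfl"

text \<open>The operators below satisfy the relations of \<open>\<^bold>H(W)\<close> only modulo functions with values in the
  ideal of the idempotent relators; evaluation at \<open>1\<close> turns the operator of \<open>D\<^sub>t\<close> into left
  multiplication by the letter \<open>t\<close>.\<close>

definition d_op :: "'i cox \<Rightarrow> ('i cox \<Rightarrow> 'i frag_cox) \<Rightarrow>
    'i cox \<Rightarrow> 'i frag_cox" where
  "d_op t f x =
    (if inversion (\<iota> x) t
     then f x - frag_of [\<iota> x \<cdot> t \<cdot> x] \<otimes>\<^bsub>F\<^esub> f x - f (t \<cdot> x)
     else frag_of [\<iota> x \<cdot> t \<cdot> x] \<otimes>\<^bsub>F\<^esub> f x)"

fun act_gen where
  "act_gen (GenS i) f = (\<lambda>x. f (s i \<cdot> x))"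
| "act_gen (GenD i) f = d_op (s i) f"

abbreviation "act_word u f \<equiv> foldr act_gen u f"

definition act where
  "act p f = (\<lambda>x. frag_extend (\<lambda>u. act_word u f x) p)"

lemma act_gen_diff: "act_gen a (\<lambda>x. f x - g x) = (\<lambda>x. act_gen a f x - act_gen a g x)"
  by (cases a) (auto simp: d_op_def mult_free_ring_distrib)

lemma act_gen_zero: "act_gen a (\<lambda>x. 0) = (\<lambda>x. 0)"
  by (cases a) (auto simp: d_op_def)

lemma act_word_diff: "act_word u (\<lambda>x. f x - g x) = (\<lambda>x. act_word u f x - act_word u g x)"
  by (induction u) (simp_all add: act_gen_diff)

lemma act_word_zero: "act_word u (\<lambda>x. 0) = (\<lambda>x. 0)"
  by (induction u) (simp_all add: act_gen_zero)

lemma act_of [simp]: "act (frag_of u) f = act_word u f"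
  by (simp add: act_def)

lemma act_zero [simp]: "act 0 f = (\<lambda>x. 0)"
  by (simp add: act_def)

lemma act_diff: "act (p - q) f = (\<lambda>x. act p f x - act q f x)"
  by (simp add: act_def frag_extend_diff)

lemma act_word_act: "act_word u (act p f) x = frag_extend (\<lambda>v. act_word (u @ v) f x) p"
proof -
  have "supp p \<subseteq> UNIV" by simp
  then show ?thesis
    by (induction p rule: frag_induct)
      (simp_all add: act_word_zero act_diff act_word_diff frag_extend_diff)
qed

lemma act_mult: "act (p \<otimes>\<^bsub>free_ring X\<^esub> q) f = act p (act q f)"
proof -
  have "supp p \<subseteq> UNIV" by simp
  then show ?thesis
  proof (induction p rule: frag_induct)
    case (one u)
    have "frag_of u \<otimes>\<^bsub>free_ring X\<^esub> q = frag_extend (frag_of \<circ> (@) u) q"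
      by (simp add: free_ring_def monoid_ring_def comp_def)
    moreover have "act (frag_extend (frag_of \<circ> (@) u) q) f x = act_word u (act q f) x" for x
      unfolding act_word_act unfolding act_def frag_extend_compose by (simp add: comp_def)
    ultimately show ?case by (simp add: fun_eq_iff)
  qed (simp_all add: mult_free_ring_distrib act_diff)
qed

text \<open>Formulated for any additive subgroup \<open>C\<close> stable under left multiplication
  by reflections: it is needed for the whole free ring and for the ideal of idempotent
  relators.\<close>

lemma act_word_closed:
  assumes C: "0 \<in> C" "\<And>a b. a \<in> C \<Longrightarrow> b \<in> C \<Longrightarrow> a - b \<in> C"
    "\<And>r a. r \<in> Rfl \<Longrightarrow> a \<in> C \<Longrightarrow> frag_of [r] \<otimes>\<^bsub>F\<^esub> a \<in> C"
    and f: "\<And>x. x \<in> carrier W \<Longrightarrow> f x \<in> C" and u: "u \<in> lists (hecke_gens I)"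
    and x: "x \<in> carrier W"
  shows "act_word u f x \<in> C"
  using u x
proof (induction u arbitrary: x)
  case (Cons a u)
  show ?case
  proof (cases a)
    case (GenS i)
    then show ?thesis using Cons by (auto simp: hecke_gens_def)
  next
    case (GenD i)
    then have i: "i \<in> I" using Cons by (auto simp: hecke_gens_def)
    then have "\<iota> x \<cdot> s i \<cdot> x \<in> Rfl"
      using reflection_conj[of "s i" "\<iota> x"] Cons.prems by simp
    then show ?thesis
      using Cons GenD i by (simp add: d_op_def C)
  qed
qed (use f in simp)

lemma act_closed:
  assumes C: "0 \<in> C" "\<And>a b. a \<in> C \<Longrightarrow> b \<in> C \<Longrightarrow> a - b \<in> C"
    "\<And>r a. r \<in> Rfl \<Longrightarrow> a \<in> C \<Longrightarrow> frag_of [r] \<otimes>\<^bsub>F\<^esub> a \<in> C"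
    and f: "\<And>x. x \<in> carrier W \<Longrightarrow> f x \<in> C" and p: "supp p \<subseteq> lists (hecke_gens I)"
    and x: "x \<in> carrier W"
  shows "act p f x \<in> C"
  using p
proof (induction p rule: frag_induct)
  case (one u)
  then show ?case
    using act_word_closed[of C f u x] assms by simp
qed (use C in \<open>simp_all add: act_diff\<close>)

lemma carrier_F_diff: "a \<in> carrier F \<Longrightarrow> b \<in> carrier F \<Longrightarrow> a - b \<in> carrier F"
  unfolding carrier_free_ring by (rule keys_diff_subset)

lemma frag_of_mult_closed:
  assumes "r \<in> Rfl"
  shows "a \<in> carrier F \<Longrightarrow> frag_of [r] \<otimes>\<^bsub>F\<^esub> a \<in> carrier F"
    and "a \<in> T.relideal \<Longrightarrow> frag_of [r] \<otimes>\<^bsub>F\<^esub> a \<in> T.relideal"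
proof -
  have r: "frag_of [r] \<in> carrier F" using assms by simp
  show "a \<in> carrier F \<Longrightarrow> frag_of [r] \<otimes>\<^bsub>F\<^esub> a \<in> carrier F"
    using T.free.m_closed[OF r] by blast
  show "a \<in> T.relideal \<Longrightarrow> frag_of [r] \<otimes>\<^bsub>F\<^esub> a \<in> T.relideal"
    using T.relideal.I_l_closed[OF _ r] by blast
qed

lemma act_word_map_GenS:
  assumes "\<omega> \<in> lists I" "x \<in> carrier W"
  shows "act_word (map GenS \<omega>) f x = f (\<iota> wd \<omega> \<cdot> x)"
  using assms
proof (induction \<omega> arbitrary: x)
  case (Cons i \<omega>)
  then show ?case
    by (simp add: wd_Cons W.inv_mult_group W.m_assoc)
qed simp

text \<open>The operator form of \<open>w D_t w^-1 = D_t'\<close> with \<open>t' = w t w^-1\<close>.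
  Passing from \<open>x\<close> to \<open>w^-1 x\<close> preserves the reflection
  \<open>x^-1 t' x\<close>, and since \<open>w\<close> does not invert \<open>t\<close>, the cocycle
  identity preserves the case distinction.\<close>

lemma d_op_conj:
  assumes x: "x \<in> carrier W" and w: "w \<in> carrier W" and t: "t \<in> carrier W" and pos: "\<not> inversion w t"
    and g: "\<And>y. y \<in> carrier W \<Longrightarrow> g y = f (\<iota> w \<cdot> y)"
  shows "d_op (w \<cdot> t \<cdot> \<iota> w) g x = d_op t f (\<iota> w \<cdot> x)"
proof -
  let ?t = "w \<cdot> t \<cdot> \<iota> w"
  have "inversion (\<iota> x \<cdot> w) t \<longleftrightarrow> inversion (\<iota> x) ?t"
    using inversion_mult[of "\<iota> x" w t] x w t pos by simp
  moreover have "\<iota> (\<iota> w \<cdot> x) = \<iota> x \<cdot> w"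
    using x w by (simp add: W.inv_mult_group)
  moreover have "\<iota> x \<cdot> ?t \<cdot> x = \<iota> x \<cdot> w \<cdot> t \<cdot> (\<iota> w \<cdot> x)"
    "g (?t \<cdot> x) = f (t \<cdot> (\<iota> w \<cdot> x))"
    using x w t g by (simp_all add: W.m_assoc)
  ultimately show ?thesis
    using g[OF x] by (simp add: d_op_def)
qed

lemma idempotent_relator_mult:
  assumes "r \<in> Rfl" "a \<in> carrier F"
  shows "frag_of [r] \<otimes>\<^bsub>F\<^esub> (frag_of [r] \<otimes>\<^bsub>F\<^esub> a) - frag_of [r] \<otimes>\<^bsub>F\<^esub> a \<in> T.relideal"
proof -
  have r: "frag_of [r] \<in> carrier F" using assms by simp
  have "frag_of [r, r] - frag_of [r] \<in> T.relideal"
    using assms(1) T.free.genideal_self[OF idempotent_relators_closed]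
    by (auto simp: idempotent_relators_def)
  then have "(frag_of [r, r] - frag_of [r]) \<otimes>\<^bsub>F\<^esub> a \<in> T.relideal"
    using T.relideal.I_r_closed assms(2) by blast
  moreover have "frag_of [r, r] \<otimes>\<^bsub>F\<^esub> a = frag_of [r] \<otimes>\<^bsub>F\<^esub> (frag_of [r] \<otimes>\<^bsub>F\<^esub> a)"
    using T.free.m_assoc[OF r r assms(2)] by simp
  ultimately show ?thesis by (simp add: mult_free_ring_distrib)
qed

lemma zero_relideal [simp]: "0 \<in> T.relideal"
  using T.relideal.zero_closed by simp

text \<open>Only the relator for \<open>D_i^2 = D_i\<close> makes use of the ideal; all the others
  act as zero exactly. Relation (iii) is an instance of \<open>d_op_conj\<close>.\<close>

lemma act_relator:
  assumes p: "p \<in> hecke_relators I m" and f: "\<And>y. y \<in> carrier W \<Longrightarrow> f y \<in> carrier F"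
    and x: "x \<in> carrier W"
  shows "act p f x \<in> T.relideal"
proof -
  have s_x: "inversion (\<iota> (s i \<cdot> x)) (s i) \<longleftrightarrow> \<not> inversion (\<iota> x) (s i)"
    "\<iota> (s i \<cdot> x) \<cdot> s i \<cdot> (s i \<cdot> x) = \<iota> x \<cdot> s i \<cdot> x" if "i \<in> I" for i
    using inversion_mult_s[of i "\<iota> x"] that x by (simp_all add: W.inv_mult_group W.m_assoc)
  have relator: "act_word (map GenS (concat (replicate (m i j) [i, j]))) f x = f x" if "i \<in> I" "j \<in> I" for i j
    using act_word_map_GenS[OF concat_replicate_lists[OF that] x] wd_relator[OF that] x by simp
  have map_relator: "map GenS (concat (replicate n [i, j])) = concat (replicate n [GenS i, GenS j])" for n i j
    by (induction n) auto
  from p consider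
      i where "i \<in> I" "p = frag_of [GenS i, GenS i] - frag_of []"
    | i where "i \<in> I" "p = frag_of [GenD i, GenD i] - frag_of [GenD i]"
    | i where "i \<in> I" "p = (frag_of [GenS i, GenD i] + frag_of [GenD i, GenS i]) - (frag_of [GenS i] - frag_of [])"
    | i j where "i \<in> I" "j \<in> I" "p = frag_of (concat (replicate (m i j) [GenS i, GenS j])) - frag_of []"
    | i j where "i \<in> I" "j \<in> I" "i \<noteq> j" "m i j \<noteq> 0"
      "p = frag_of (GenD i # alt_word (m i j - 1) j i) - frag_of (alt_word (m i j - 1) j i @ [GenD (if even (m i j) then i else j)])"
    unfolding hecke_relators_def Un_iff mem_Collect_eq by blast
  then show ?thesis
  proof cases
    case (1 i)
    then show ?thesis using x by (simp add: act_diff)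
  next
    case (2 i)
    let ?r = "\<iota> x \<cdot> s i \<cdot> x"
    let ?e = "\<lambda>a. frag_of [?r] \<otimes>\<^bsub>F\<^esub> a"
    have r: "?r \<in> Rfl"
      using reflection_conj[of "s i" "\<iota> x"] x 2 by simp
    have sx: "s i \<cdot> x \<in> carrier W" using x 2 by simp
    have *: "?e (?e (f x)) - ?e (f x) \<in> T.relideal"
      by (rule idempotent_relator_mult[OF r f[OF x]])
    show ?thesis
    proof (cases "inversion (\<iota> x) (s i)")
      case False
      then show ?thesis using 2 * by (simp add: act_diff d_op_def)
    next
      case True
      \<comment> \<open>At \<open>s i \<cdot> x\<close> the other case of \<open>d_op\<close>
        applies with the same reflection, and the terms in \<open>f (s i \<cdot> x)\<close>
        cancel.\<close>
      have "act p f x = ?e (?e (f x)) - ?e (f x)"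
        using 2 True x s_x[OF 2(1)] by (simp add: act_diff d_op_def mult_free_ring_distrib)
      then show ?thesis using * by simp
    qed
  next
    case (3 i)
    have "act p f x = 0"
      using 3 x s_x[OF 3(1)] by (simp add: act_def frag_extend_add frag_extend_diff d_op_def)
    then show ?thesis by simp
  next
    case (4 i j)
    then show ?thesis
      using relator[OF 4(1,2)] by (simp add: act_diff map_relator)
  next
    case (5 i j)
    let ?\<omega> = "altw (m i j - 1) j i" and ?k = "if even (m i j) then i else j"
    have \<omega>: "?\<omega> \<in> lists I" using 5 by simp
    have k: "?k \<in> I" using 5 by simp
    have comm: "wd ?\<omega> \<cdot> s ?k = s i \<cdot> wd ?\<omega>" and pos: "\<not> inversion (wd ?\<omega>) (s ?k)"
      using dihedral_no_inversion[of i j] 5 by blast+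
    have "wd ?\<omega> \<cdot> s ?k \<cdot> \<iota> wd ?\<omega> = s i"
      unfolding comm using 5 \<omega> by (simp add: W.m_assoc)
    then have "d_op (s i) (act_word (map GenS ?\<omega>) f) x = d_op (s ?k) f (\<iota> wd ?\<omega> \<cdot> x)"
      using d_op_conj[OF x wd_closed[OF \<omega>] s_closed[OF k] pos, of "act_word (map GenS ?\<omega>) f" f]
        act_word_map_GenS[OF \<omega>] by simp
    also have "\<dots> = act_word (map GenS ?\<omega> @ [GenD ?k]) f x"
      unfolding foldr_append by (subst act_word_map_GenS[OF \<omega> x]) simp
    finally have "act p f x = 0"
      unfolding 5(5) act_diff act_of alt_word_altw by simp
    then show ?thesis by simp
  qed
qed

text \<open>The elements that map all functions with values in \<open>F\<close> to functions with
  values in \<open>T.relideal\<close> form a two-sided ideal: on the left because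
  \<open>T.relideal\<close> is stable under the operators, on the right because functions with
  values in \<open>F\<close> are.\<close>

lemma act_relideal:
  assumes p: "p \<in> H.relideal" and f: "\<And>y. y \<in> carrier W \<Longrightarrow> f y \<in> carrier F" and x: "x \<in> carrier W"
  shows "act p f x \<in> T.relideal"
proof -
  let ?FH = "free_ring (hecke_gens I)"
  define K where "K = {p \<in> carrier ?FH. \<forall>f x. (\<forall>y\<in>carrier W. f y \<in> carrier F) \<longrightarrow>
    x \<in> carrier W \<longrightarrow> act p f x \<in> T.relideal}"
  have KI: "p \<in> K" if "p \<in> carrier ?FH"
    "\<And>f x. (\<And>y. y \<in> carrier W \<Longrightarrow> f y \<in> carrier F) \<Longrightarrow> x \<in> carrier W \<Longrightarrow> act p f x \<in> T.relideal" for p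
    using that by (simp add: K_def)
  have KD: "act p f x \<in> T.relideal" if "p \<in> K" "\<And>y. y \<in> carrier W \<Longrightarrow> f y \<in> carrier F" "x \<in> carrier W" for p f x
    using that by (simp add: K_def)
  have K_carrier: "p \<in> carrier ?FH" if "p \<in> K" for p
    using that by (simp add: K_def)
  have K_zero: "0 \<in> K" by (rule KI) simp_all
  have K_diff: "p - q \<in> K" if "p \<in> K" "q \<in> K" for p q
  proof (rule KI)
    show "p - q \<in> carrier ?FH"
      using K_carrier[OF that(1)] K_carrier[OF that(2)] by (simp add: keys_diff_subset)
    fix f x assume "\<And>y. y \<in> carrier W \<Longrightarrow> f y \<in> carrier F" "x \<in> carrier W"
    then show "act (p - q) f x \<in> T.relideal"
      using KD[OF that(1)] KD[OF that(2)] by (simp add: act_diff T.relideal_diff)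
  qed
  have "ideal K ?FH"
  proof (rule idealI[OF ring_free_ring])
    show "subgroup K (add_monoid ?FH)"
    proof (rule group.subgroupI[OF abelian_group.a_group[OF ring.is_abelian_group[OF ring_free_ring]]])
      show "K \<subseteq> carrier (add_monoid ?FH)" using K_carrier by auto
      show "K \<noteq> {}" using K_zero by auto
      fix p q assume pq: "p \<in> K" "q \<in> K"
      have "- p \<in> K" "- q \<in> K" using K_diff[OF K_zero] pq by simp_all
      then show "inv\<^bsub>add_monoid ?FH\<^esub> p \<in> K"
        using a_inv_free_ring[of p "hecke_gens I"] K_carrier[OF pq(1)]
        unfolding a_inv_def[symmetric] by (simp only: carrier_free_ring)
      show "p \<otimes>\<^bsub>add_monoid ?FH\<^esub> q \<in> K"
        using K_diff[OF pq(1) \<open>- q \<in> K\<close>] by simp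
    qed
    fix p q assume p: "p \<in> K" and q: "q \<in> carrier ?FH"
    have closed: "q \<otimes>\<^bsub>?FH\<^esub> p \<in> carrier ?FH" "p \<otimes>\<^bsub>?FH\<^esub> q \<in> carrier ?FH"
      using H.free.m_closed K_carrier[OF p] q by blast+
    show "q \<otimes>\<^bsub>?FH\<^esub> p \<in> K"
    proof (rule KI[OF closed(1)])
      fix f x assume f: "\<And>y. y \<in> carrier W \<Longrightarrow> f y \<in> carrier F" and x: "x \<in> carrier W"
      show "act (q \<otimes>\<^bsub>?FH\<^esub> p) f x \<in> T.relideal"
        unfolding act_mult
        by (rule act_closed[OF zero_relideal T.relideal_diff frag_of_mult_closed(2) KD[OF p f]
              q[unfolded carrier_free_ring] x])
    qed
    show "p \<otimes>\<^bsub>?FH\<^esub> q \<in> K"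
    proof (rule KI[OF closed(2)])
      fix f x assume f: "\<And>y. y \<in> carrier W \<Longrightarrow> f y \<in> carrier F" and x: "x \<in> carrier W"
      have "act q f y \<in> carrier F" if "y \<in> carrier W" for y
        by (rule act_closed[OF _ carrier_F_diff frag_of_mult_closed(1) f
              q[unfolded carrier_free_ring] that]) simp
      then show "act (p \<otimes>\<^bsub>?FH\<^esub> q) f x \<in> T.relideal"
        unfolding act_mult using KD[OF p] x by blast
    qed
  qed
  moreover have "hecke_relators I m \<subseteq> K"
  proof
    fix p assume "p \<in> hecke_relators I m"
    then show "p \<in> K"
      using subsetD[OF hecke_relators_closed] act_relator by (intro KI) blast+
  qed
  ultimately have "H.relideal \<subseteq> K"
    by (rule H.free.genideal_minimal)
  then show ?thesis using KD p f x by blast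
qed

text \<open>A second use of \<open>d_op_conj\<close>: the chosen representative disappears, and the
  word acts by the formula for \<open>t\<close> itself.\<close>

lemma act_d_word:
  assumes t: "t \<in> Rfl" and x: "x \<in> carrier W"
  shows "act_word (d_word t) f x = d_op t f x"
proof -
  obtain \<omega> i where rep: "positive_rep t \<omega> i"
    and word: "d_word t = map GenS \<omega> @ [GenD i] @ map GenS (rev \<omega>)"
    using d_word[OF t] by blast
  have \<omega>: "\<omega> \<in> lists I" and i: "i \<in> I" and tw: "t = wd \<omega> \<cdot> s i \<cdot> \<iota> wd \<omega>"
    and pos: "\<not> inversion (wd \<omega>) (s i)"
    using rep by (auto simp: positive_rep_def)
  let ?f = "act_word (map GenS (rev \<omega>)) f"
  have f: "?f (\<iota> wd \<omega> \<cdot> y) = f y" if "y \<in> carrier W" for y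
    using that \<omega> by (subst act_word_map_GenS) (simp_all add: wd_rev)
  have "act_word (d_word t) f x = d_op (s i) ?f (\<iota> wd \<omega> \<cdot> x)"
    unfolding word foldr_append by (subst act_word_map_GenS[OF \<omega> x]) simp
  also have "\<dots> = d_op t f x"
    unfolding tw using f by (intro d_op_conj[symmetric] x pos wd_closed \<omega> s_closed i) simp
  finally show ?thesis .
qed

lemma act_d_words_one:
  assumes "\<tau> \<in> lists Rfl" "\<And>y. y \<in> carrier W \<Longrightarrow> f y \<in> carrier F"
  shows "act_word (concat (map d_word \<tau>)) f \<one>\<^bsub>W\<^esub> = frag_of \<tau> \<otimes>\<^bsub>F\<^esub> f \<one>\<^bsub>W\<^esub>"
  using assms(1)
proof induction
  case Nil
  then show ?case using assms(2)[of "\<one>\<^bsub>W\<^esub>"] T.free.l_one[of "f \<one>\<^bsub>W\<^esub>"] by simp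
next
  case (Cons t \<tau>)
  have t: "t \<in> carrier W" using Cons reflection_closed by simp
  have cl: "frag_of [t] \<in> carrier F" "frag_of \<tau> \<in> carrier F" using Cons by simp_all
  have "act_word (concat (map d_word (t # \<tau>))) f \<one>\<^bsub>W\<^esub> =
      frag_of [t] \<otimes>\<^bsub>F\<^esub> act_word (concat (map d_word \<tau>)) f \<one>\<^bsub>W\<^esub>"
    using Cons t by (simp add: act_d_word d_op_def)
  also have "\<dots> = frag_of (t # \<tau>) \<otimes>\<^bsub>F\<^esub> f \<one>\<^bsub>W\<^esub>"
    unfolding Cons.IH using T.free.m_assoc[OF cl assms(2)[OF W.one_closed]] by simp
  finally show ?case .
qed


subsection \<open>Linear independence of the products of the idempotents with the group elements\<close>

definition rep :: "'i cox \<Rightarrow> 'i list" where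
  "rep w = (SOME \<omega>. \<omega> \<in> lists I \<and> wd \<omega> = w)"

lemma rep:
  assumes "w \<in> carrier W"
  shows "rep w \<in> lists I" "wd (rep w) = w"
proof -
  obtain \<omega> where "\<omega> \<in> lists I" "w = wd \<omega>"
    by (rule wd_surj[OF assms])
  then have "rep w \<in> lists I \<and> wd (rep w) = w"
    using someI[of "\<lambda>\<omega>. \<omega> \<in> lists I \<and> wd \<omega> = w" \<omega>] unfolding rep_def by blast
  then show "rep w \<in> lists I" "wd (rep w) = w" by blast+
qed

definition dw_word :: "'i cox list \<times> 'i cox \<Rightarrow> 'i hecke_gen list" where
  "dw_word = (\<lambda>(\<tau>, w). concat (map d_word \<tau>) @ map GenS (rep w))"

definition slice :: "'i cox \<Rightarrow> ('i cox list \<times> 'i cox \<Rightarrow>\<^sub>0 int)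
    \<Rightarrow> 'i frag_cox" where
  "slice w = frag_extend (\<lambda>(\<tau>, v). if v = w then frag_of \<tau> else 0)"

lemma concat_d_words_lists: "\<tau> \<in> lists Rfl \<Longrightarrow> concat (map d_word \<tau>) \<in> lists (hecke_gens I)"
  by (induction \<tau> rule: lists.induct) simp_all

lemma dw_word_lists:
  "\<tau> \<in> lists Rfl \<Longrightarrow> w \<in> carrier W \<Longrightarrow> dw_word (\<tau>, w) \<in> lists (hecke_gens I)"
  using concat_d_words_lists[of \<tau>] rep(1) by (simp add: dw_word_def)

lemma keys_dw_words:
  assumes "supp P \<subseteq> lists Rfl \<times> carrier W"
  shows "supp (frag_extend (frag_of \<circ> dw_word) P) \<subseteq> lists (hecke_gens I)"
proof (rule order_trans[OF keys_frag_extend], rule UN_least)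
  fix a assume "a \<in> supp P"
  with assms have "fst a \<in> lists Rfl" "snd a \<in> carrier W" by auto
  then show "supp ((frag_of \<circ> dw_word) a) \<subseteq> lists (hecke_gens I)"
    using dw_word_lists[of "fst a" "snd a"] by simp
qed

text \<open>The conclusion is membership in the ideal and not vanishing, since coefficients are
  computed in the free ring on the reflections; it says that the coefficient of \<open>w\<close> is
  zero in \<open>T\<close>.\<close>

lemma slice_relideal:
  assumes P: "supp P \<subseteq> lists Rfl \<times> carrier W"
    and zero: "H.proj (frag_extend (frag_of \<circ> dw_word) P) = \<zero>\<^bsub>H\<^esub>" and w: "w \<in> carrier W"
  shows "slice w P \<in> T.relideal"
proof -
  define f where "f = (\<lambda>x. if x = \<iota> w then frag_of [] else 0 :: 'i frag_cox)"
  have f: "f y \<in> carrier F" for y by (simp add: f_def)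
  have "act (frag_extend (frag_of \<circ> dw_word) P) f \<one>\<^bsub>W\<^esub> = slice w P"
    using P
  proof (induction P rule: frag_induct)
    case zero
    then show ?case by (simp add: slice_def)
  next
    case (diff P Q)
    then show ?case by (simp add: slice_def frag_extend_diff act_diff)
  next
    case (one a)
    obtain \<tau> v where a: "a = (\<tau>, v)" "\<tau> \<in> lists Rfl" "v \<in> carrier W"
      using one by auto
    let ?g = "act_word (map GenS (rep v)) f"
    have g: "?g y = f (\<iota> v \<cdot> y)" if "y \<in> carrier W" for y
      using act_word_map_GenS[OF rep(1)[OF a(3)] that] rep(2)[OF a(3)] by simp
    have "act_word (dw_word a) f \<one>\<^bsub>W\<^esub> = frag_of \<tau> \<otimes>\<^bsub>F\<^esub> ?g \<one>\<^bsub>W\<^esub>"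
      unfolding a(1) dw_word_def prod.case foldr_append using f g
      by (intro act_d_words_one a(2)) simp
    moreover have "?g \<one>\<^bsub>W\<^esub> = (if v = w then frag_of [] else 0)"
      using g[OF W.one_closed] a(3) w by (auto simp: f_def)
    ultimately show ?case
      by (simp add: a(1) slice_def)
  qed
  moreover have "frag_extend (frag_of \<circ> dw_word) P \<in> H.relideal"
    using H.proj_eq_zero_iff[OF keys_dw_words[OF P]] zero by simp
  ultimately show ?thesis
    using act_relideal[of "frag_extend (frag_of \<circ> dw_word) P" f "\<one>\<^bsub>W\<^esub>"] f by simp
qed


section \<open>The two factorizations\<close>

abbreviation "Dset \<equiv> generate_ring H (d_family ` Rfl)"

lemma d_family_image: "d_family ` Rfl \<subseteq> carrier H"
  by auto

lemma Dset_subring: "subring Dset H"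
  by (rule H.pres.generate_ring_is_subring[OF d_family_image])

lemma D_hat_simps:
  "carrier (D_hat I m) = Dset"
  "\<zero>\<^bsub>D_hat I m\<^esub> = \<zero>\<^bsub>H\<^esub>" "\<one>\<^bsub>D_hat I m\<^esub> = \<one>\<^bsub>H\<^esub>"
  "a \<oplus>\<^bsub>D_hat I m\<^esub> b = a \<boxplus> b" "a \<otimes>\<^bsub>D_hat I m\<^esub> b = a \<star> b"
  by (simp_all add: D_hat_def D_refl_eq)

lemma ring_D_hat: "ring (D_hat I m)"
  unfolding D_hat_def D_refl_eq by (rule H.pres.generate_ring_is_ring[OF d_family_image])

section \<open>The presentation of the subalgebra generated by the idempotents\<close>

definition phi :: "('i frag_cox) set \<Rightarrow> 'i hecke" where
  "phi = (SOME \<phi>. \<phi> \<in> ring_hom T H \<and>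
    (\<forall>t\<in>Rfl. \<phi> (ring_gen Rfl (idempotent_relators Rfl) t) = d_family t))"

lemma phi_exists: "\<exists>\<phi>. \<phi> \<in> ring_hom T H \<and>
    (\<forall>t\<in>Rfl. \<phi> (ring_gen Rfl (idempotent_relators Rfl) t) = d_family t)"
proof -
  obtain h where h: "h \<in> ring_hom F H" "\<And>t. t \<in> Rfl \<Longrightarrow> h (frag_of [t]) = d_family t"
    using free_ring_universal[OF H.pres.ring_axioms d_family_image] by blast
  have "h r = \<zero>\<^bsub>H\<^esub>" if r: "r \<in> idempotent_relators Rfl" for r
  proof -
    obtain t where t: "r = frag_of [t, t] - frag_of [t]" "t \<in> Rfl"
      using r by (auto simp: idempotent_relators_def)
    have "h (frag_of [t] \<otimes>\<^bsub>F\<^esub> frag_of [t]) = d_family t"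
      using ring_hom_mult[OF h(1), of "frag_of [t]" "frag_of [t]"] t(2) h(2) d_family_idem by simp
    then show ?thesis
      using ring_hom_free_ring_diff[OF H.pres.ring_axioms h(1), of "frag_of [t, t]" "frag_of [t]"] t h(2)
      by simp
  qed
  from T.presented_ring_universal[OF H.pres.ring_axioms h(1) this]
  obtain \<phi> where \<phi>: "\<phi> \<in> ring_hom T H"
    "\<And>p. supp p \<subseteq> lists Rfl \<Longrightarrow> \<phi> (T.proj p) = h p" by blast
  show ?thesis
    by (rule exI[of _ \<phi>]) (use \<phi> h(2) in \<open>simp add: T.ring_gen_proj\<close>)
qed

lemma phi_hom: "phi \<in> ring_hom T H"
  and phi_gen: "t \<in> Rfl \<Longrightarrow>
    phi (ring_gen Rfl (idempotent_relators Rfl) t) = d_family t"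
  using someI_ex[OF phi_exists] unfolding phi_def by blast+

lemma phi_ring_hom_ring: "ring_hom_ring T H phi"
  by (rule ring_hom_ringI2[OF T.pres.ring_axioms H.pres.ring_axioms phi_hom])

lemmas phi_closed = ring_hom_closed[OF phi_hom]
lemmas phi_mult = ring_hom_mult[OF phi_hom]
lemmas phi_add = ring_hom_add[OF phi_hom]
lemmas phi_one = ring_hom_one[OF phi_hom]
lemmas phi_zero = ring_hom_zero[OF phi_hom T.pres.ring_axioms H.pres.ring_axioms]

lemmas phi_diff = ring_hom_minus[OF T.pres.ring_axioms H.pres.ring_axioms phi_hom]

lemma phi_word:
  assumes "\<tau> \<in> lists Rfl"
  shows "phi (T.proj (frag_of \<tau>)) = H.proj (frag_of (concat (map d_word \<tau>)))"
  using assms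
proof induction
  case Nil
  then show ?case by (simp add: T.proj_Nil H.proj_Nil phi_one)
next
  case (Cons t \<tau>)
  have "phi (T.proj (frag_of (t # \<tau>))) = d_family t \<star> phi (T.proj (frag_of \<tau>))"
    unfolding T.proj_Cons[OF Cons(1,2)]
    using Cons(1,2) by (subst phi_mult) (simp_all add: phi_gen)
  also have "\<dots> = H.proj (frag_of (d_word t @ concat (map d_word \<tau>)))"
    unfolding Cons.IH using Cons(1,2) concat_d_words_lists[OF Cons(2)]
    by (subst H.proj_append) (simp_all add: d_family_def)
  finally show ?case by simp
qed

lemma phi_image: "phi ` carrier T = Dset"
proof
  have gen: "phi a \<in> Dset" if "a \<in> carrier T" for a
    using that
  proof (induction a rule: T.proj_induct)
    case zero
    then show ?case using subringE(2)[OF Dset_subring] by (simp add: phi_zero)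
  next
    case (word \<tau>)
    then show ?case
    proof induction
      case Nil
      then show ?case using subringE(3)[OF Dset_subring] by (simp add: T.proj_Nil phi_one)
    next
      case (Cons t \<tau>)
      have "phi (T.proj (frag_of (t # \<tau>))) = d_family t \<star> phi (T.proj (frag_of \<tau>))"
        unfolding T.proj_Cons[OF Cons(1,2)]
        using Cons(1,2) by (subst phi_mult) (simp_all add: phi_gen)
      then show ?case
        using Cons by (simp add: generate_ring.eng_mult generate_ring.incl)
    qed
  next
    case (diff a b)
    then show ?case
      by (simp add: phi_diff H.pres.minus_eq generate_ring.eng_add generate_ring.a_inv)
  qed
  then show "phi ` carrier T \<subseteq> Dset" by blast
  have "subring (carrier T) T"
    by (rule T.pres.subringI) auto
  then have "subring (phi ` carrier T) H"
    by (rule ring_hom_ring.img_is_subring[OF phi_ring_hom_ring])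
  moreover have "d_family ` Rfl \<subseteq> phi ` carrier T"
    using phi_gen T.ring_gen_closed by (metis image_eqI image_subsetI)
  ultimately show "Dset \<subseteq> phi ` carrier T"
    by (rule H.pres.generate_ring_min_subring1[OF d_family_image])
qed

lemma phi_in_Dset: "a \<in> carrier T \<Longrightarrow> phi a \<in> Dset"
  using phi_image by blast

lemma Dset_phi:
  assumes "d \<in> Dset"
  obtains a where "a \<in> carrier T" "d = phi a"
  using assms phi_image by blast

lemma Dset_closed: "d \<in> Dset \<Longrightarrow> d \<in> carrier H"
  using subringE(1)[OF Dset_subring] by blast

lemma proj_dw_word:
  assumes "\<tau> \<in> lists Rfl" "w \<in> carrier W"
  shows "H.proj (frag_of (dw_word (\<tau>, w))) = phi (T.proj (frag_of \<tau>)) \<star> hgrp w"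
  unfolding dw_word_def prod.case phi_word[OF assms(1)]
  using H.proj_append[OF concat_d_words_lists[OF assms(1)] map_GenS_lists[OF rep(1)[OF assms(2)]]]
    hgrp_wd[OF rep(1)[OF assms(2)]] rep(2)[OF assms(2)] by (simp add: hword_def)

abbreviation "dw_index \<equiv> lists Rfl \<times> carrier W"

definition dw_proj :: "('i cox list \<times> 'i cox \<Rightarrow>\<^sub>0 int)
    \<Rightarrow> 'i hecke" where
  "dw_proj P = H.proj (frag_extend (frag_of \<circ> dw_word) P)"

lemma dw_proj_of [simp]: "dw_proj (frag_of a) = H.proj (frag_of (dw_word a))"
  by (simp add: dw_proj_def)

lemma dw_proj_closed: "supp P \<subseteq> dw_index \<Longrightarrow> dw_proj P \<in> carrier H"
  unfolding dw_proj_def using keys_dw_words by simp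

lemma dw_proj_diff:
  assumes "supp P \<subseteq> dw_index" "supp P' \<subseteq> dw_index"
  shows "dw_proj (P - P') = dw_proj P \<boxminus> dw_proj P'"
  unfolding dw_proj_def frag_extend_diff by (rule H.proj_diff[OF keys_dw_words[OF assms(1)] keys_dw_words[OF assms(2)]])

lemma dw_proj_zero: "dw_proj 0 = \<zero>\<^bsub>H\<^esub>"
  using H.proj.hom_zero by (simp add: dw_proj_def)

text \<open>A section of \<open>slice w\<close>: it places all words over the single group element
  \<open>w\<close>.\<close>

definition insert_w :: "'i cox \<Rightarrow> ('i frag_cox)
    \<Rightarrow> 'i cox list \<times> 'i cox \<Rightarrow>\<^sub>0 int" where
  "insert_w w = frag_extend (\<lambda>\<tau>. frag_of (\<tau>, w))"

text \<open>A lift \<open>p\<close> of \<open>a\<close>, placed over the group element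
  \<open>1\<close>, is mapped by \<open>dw_proj\<close> to \<open>phi a\<close> and has
  \<open>p\<close> as its slice at \<open>1\<close>; hence \<open>p\<close> lies in the
  ideal.\<close>

lemma phi_inj:
  assumes a: "a \<in> carrier T" and zero: "phi a = \<zero>\<^bsub>H\<^esub>"
  shows "a = \<zero>\<^bsub>T\<^esub>"
proof -
  obtain p where p: "supp p \<subseteq> lists Rfl" "a = T.proj p"
    using T.proj_surj[OF a] by blast
  let ?\<iota> = "insert_w \<one>\<^bsub>W\<^esub>"
  have *: "supp (?\<iota> p) \<subseteq> dw_index \<and> dw_proj (?\<iota> p) = phi (T.proj p) \<and> slice \<one>\<^bsub>W\<^esub> (?\<iota> p) = p"
    using p(1)
  proof (induction p rule: frag_induct)
    case zero
    then show ?case using dw_proj_zero phi_zero T.proj.hom_zero by (simp add: insert_w_def slice_def)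
  next
    case (diff p q)
    then have "T.proj p \<in> carrier T" "T.proj q \<in> carrier T" by simp_all
    moreover have "?\<iota> (p - q) = ?\<iota> p - ?\<iota> q" by (simp add: insert_w_def frag_extend_diff)
    moreover have "slice \<one>\<^bsub>W\<^esub> (?\<iota> p - ?\<iota> q) = slice \<one>\<^bsub>W\<^esub> (?\<iota> p) - slice \<one>\<^bsub>W\<^esub> (?\<iota> q)"
      by (simp add: slice_def frag_extend_diff)
    ultimately show ?case
      using diff by (simp add: dw_proj_diff phi_diff T.proj_diff keys_diff_subset)
  next
    case (one \<tau>)
    have "H.proj (frag_of (dw_word (\<tau>, \<one>\<^bsub>W\<^esub>))) = phi (T.proj (frag_of \<tau>))"
      using one proj_dw_word[OF one W.one_closed] phi_closed[of "T.proj (frag_of \<tau>)"] by simp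
    then show ?case using one by (simp add: insert_w_def slice_def)
  qed
  then have "p \<in> T.relideal"
    using slice_relideal[of "?\<iota> p" "\<one>\<^bsub>W\<^esub>", folded dw_proj_def] * zero p(2) by simp
  then show ?thesis
    using T.proj_eq_zero_iff p by simp
qed

lemma D_hat_presentation: "phi \<in> ring_iso T (D_hat I m)"
proof (rule ring_iso_memI)
  show "bij_betw phi (carrier T) (carrier (D_hat I m))"
    unfolding bij_betw_def D_hat_simps(1)
  proof
    show "inj_on phi (carrier T)"
    proof (rule inj_onI)
      fix a b assume ab: "a \<in> carrier T" "b \<in> carrier T" "phi a = phi b"
      then have "phi (a \<ominus>\<^bsub>T\<^esub> b) = \<zero>\<^bsub>H\<^esub>"
        using phi_closed[OF ab(2)] by (simp add: phi_diff)
      then have "a \<ominus>\<^bsub>T\<^esub> b = \<zero>\<^bsub>T\<^esub>"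
        using phi_inj ab(1,2) T.pres.minus_closed by blast
      then show "a = b" using ab by simp
    qed
  qed (rule phi_image)
qed (simp_all add: D_hat_simps phi_in_Dset phi_mult phi_add phi_one)


text \<open>The span of the products \<open>d w\<close> is stable under left multiplication by \<open>D\<^sub>i\<close> and, since
  \<open>s\<^sub>i d\<close> is again of the form \<open>d\<^sub>1 s\<^sub>i + d\<^sub>2\<close>, also by \<open>s\<^sub>i\<close>.\<close>

lemma H_s_H_D_left:
  assumes i: "i \<in> I" and y: "y \<in> carrier H"
  shows "Hs i \<star> (Hd i \<star> y) =
    Hs i \<star> y \<boxminus> y \<boxminus> Hd i \<star> (Hs i \<star> y)"
proof -
  let ?S = "Hs i" and ?D = "Hd i"
  have "(?S \<star> ?D \<boxplus> ?D \<star> ?S) \<star> y = (?S \<boxminus> \<one>\<^bsub>H\<^esub>) \<star> y"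
    using H_s_H_D[OF i] by simp
  then have eq: "?S \<star> (?D \<star> y) \<boxplus> ?D \<star> (?S \<star> y) = ?S \<star> y \<boxminus> y"
    using i y by (simp add: H.pres.l_distr H.pres.m_assoc H.pres.minus_eq H.pres.l_minus)
  have "?S \<star> (?D \<star> y) = (?S \<star> (?D \<star> y) \<boxplus> ?D \<star> (?S \<star> y)) \<boxminus> ?D \<star> (?S \<star> y)"
    using i y by (simp add: H.pres.minus_eq H.pres.a_assoc H.pres.r_neg)
  then show ?thesis unfolding eq .
qed

lemma H_s_d_family:
  assumes i: "i \<in> I" and t: "t \<in> Rfl" "t \<noteq> s i"
  shows "Hs i \<star> d_family t = d_family (s i \<cdot> t \<cdot> s i) \<star> Hs i"
  using i t by (simp add: d_family_conj_s H.pres.m_assoc)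

lemma Dset_diff: "a \<in> Dset \<Longrightarrow> b \<in> Dset \<Longrightarrow> a \<boxminus> b \<in> Dset"
  by (simp add: H.pres.minus_eq generate_ring.eng_add generate_ring.a_inv)

lemma d_family_Dset: "t \<in> Rfl \<Longrightarrow> d_family t \<in> Dset"
  by (rule generate_ring.incl) simp

text \<open>Quantifying over \<open>T\<close> allows induction on words in the reflections. Past
  \<open>D_t\<close> with \<open>t \<noteq> s i\<close> the generator only conjugates
  \<open>t\<close>; past \<open>D_i\<close> it leaves terms with and without \<open>s i\<close>, so
  the two shapes on the right-hand side persist.\<close>

lemma H_s_phi:
  assumes i: "i \<in> I" and a: "a \<in> carrier T"
  shows "\<exists>d\<in>Dset. \<exists>d'\<in>Dset. Hs i \<star> phi a = d \<star> Hs i \<boxplus> d'"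
  using a
proof (induction a rule: T.proj_induct)
  case zero
  have "\<zero>\<^bsub>H\<^esub> \<in> Dset" by (rule subringE(2)[OF Dset_subring])
  then show ?case
    using i by (intro bexI[of _ "\<zero>\<^bsub>H\<^esub>"]) (simp_all add: phi_zero)
next
  case (word \<tau>)
  then show ?case
  proof induction
    case Nil
    have "\<zero>\<^bsub>H\<^esub> \<in> Dset" "\<one>\<^bsub>H\<^esub> \<in> Dset" by (rule subringE(2,3)[OF Dset_subring])+
    then show ?case
      using i by (intro bexI[of _ "\<one>\<^bsub>H\<^esub>"] bexI[of _ "\<zero>\<^bsub>H\<^esub>"]) (simp_all add: T.proj_Nil phi_one)
  next
    case (Cons t \<tau>)
    let ?S = "Hs i" and ?D = "Hd i" and ?y = "phi (T.proj (frag_of \<tau>))"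
    have t: "t \<in> Rfl" using Cons by simp
    have "T.proj (frag_of \<tau>) \<in> carrier T" using Cons(2) by simp
    then have y: "?y \<in> Dset" by (rule phi_in_Dset)
    obtain d d' where d: "d \<in> Dset" "d' \<in> Dset" "?S \<star> ?y = d \<star> ?S \<boxplus> d'"
      using Cons.IH by blast
    have ty: "phi (T.proj (frag_of (t # \<tau>))) = d_family t \<star> ?y"
      unfolding T.proj_Cons[OF Cons(1,2)]
      using Cons(1,2) by (subst phi_mult) (simp_all add: phi_gen)
    note closed = d(1,2)[THEN Dset_closed] y[THEN Dset_closed]
    show ?case
    proof (cases "t = s i")
      case True
      have D: "?D \<in> Dset" using d_family_Dset[OF t] True i by simp
      have "?S \<star> phi (T.proj (frag_of (t # \<tau>))) =
          (d \<star> ?S \<boxplus> d') \<boxminus> ?y \<boxminus> ?D \<star> (d \<star> ?S \<boxplus> d')"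
        using H_s_H_D_left[OF i closed(3)] True i unfolding ty d(3) by simp
      also have "\<dots> = (d \<boxminus> ?D \<star> d) \<star> ?S \<boxplus> (d' \<boxminus> ?y \<boxminus> ?D \<star> d')"
        using closed i by (simp add: H.pres.minus_eq H.pres.l_distr H.pres.r_distr H.pres.l_minus
            H.pres.minus_add H.pres.m_assoc H.pres.a_ac)
      finally show ?thesis
        using Dset_diff[OF d(1) generate_ring.eng_mult[OF D d(1)]]
          Dset_diff[OF Dset_diff[OF d(2) y] generate_ring.eng_mult[OF D d(2)]] by blast
    next
      case False
      let ?t = "s i \<cdot> t \<cdot> s i"
      have t': "?t \<in> Rfl" by (rule reflection_conj_s[OF t i])
      have "?S \<star> phi (T.proj (frag_of (t # \<tau>))) = ?S \<star> d_family t \<star> ?y"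
        unfolding ty using i t closed by (simp add: H.pres.m_assoc)
      also have "\<dots> = d_family ?t \<star> (?S \<star> ?y)"
        unfolding H_s_d_family[OF i t False] using i t' closed by (simp add: H.pres.m_assoc)
      also have "\<dots> = (d_family ?t \<star> d) \<star> ?S \<boxplus> d_family ?t \<star> d'"
        unfolding d(3) using i t' closed by (simp add: H.pres.m_assoc H.pres.r_distr)
      finally show ?thesis
        using generate_ring.eng_mult[OF d_family_Dset[OF t'] d(1)]
          generate_ring.eng_mult[OF d_family_Dset[OF t'] d(2)] by blast
    qed
  qed
next
  case (diff a b)
  obtain d d' where d: "d \<in> Dset" "d' \<in> Dset" "Hs i \<star> phi a = d \<star> Hs i \<boxplus> d'"
    using diff by blast
  obtain e e' where e: "e \<in> Dset" "e' \<in> Dset" "Hs i \<star> phi b = e \<star> Hs i \<boxplus> e'"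
    using diff by blast
  note closed = d(1,2)[THEN Dset_closed] e(1,2)[THEN Dset_closed]
  have "Hs i \<star> phi (a \<ominus>\<^bsub>T\<^esub> b) = Hs i \<star> phi a \<boxminus> Hs i \<star> phi b"
    using diff i phi_closed by (simp add: phi_diff H.pres.minus_eq H.pres.r_distr H.pres.r_minus)
  also have "\<dots> = (d \<boxminus> e) \<star> Hs i \<boxplus> (d' \<boxminus> e')"
    unfolding d(3) e(3) using closed i
    by (simp add: H.pres.minus_eq H.pres.l_distr H.pres.l_minus H.pres.minus_add H.pres.a_ac)
  finally show ?case
    using Dset_diff[OF d(1) e(1)] Dset_diff[OF d(2) e(2)] by blast
qed

section \<open>Spanning by products of idempotents with group elements\<close>

definition dw_span :: "'i hecke set" where
  "dw_span = {dw_proj P | P. supp P \<subseteq> dw_index}"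

lemma dw_span_zero: "\<zero>\<^bsub>H\<^esub> \<in> dw_span"
  unfolding dw_span_def using dw_proj_zero by (intro CollectI exI[of _ 0]) simp

lemma dw_span_closed: "x \<in> dw_span \<Longrightarrow> x \<in> carrier H"
  unfolding dw_span_def using dw_proj_closed by blast

lemma dw_span_diff:
  assumes "x \<in> dw_span" "y \<in> dw_span"
  shows "x \<boxminus> y \<in> dw_span"
proof -
  obtain P Q where "supp P \<subseteq> dw_index" "x = dw_proj P"
    "supp Q \<subseteq> dw_index" "y = dw_proj Q"
    using assms unfolding dw_span_def by blast
  then show ?thesis
    unfolding dw_span_def using dw_proj_diff by (intro CollectI exI[of _ "P - Q"]) (simp add: keys_diff_subset)
qed

lemma dw_span_add:
  assumes "x \<in> dw_span" "y \<in> dw_span"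
  shows "x \<boxplus> y \<in> dw_span"
proof -
  have "x \<boxminus> (\<zero>\<^bsub>H\<^esub> \<boxminus> y) \<in> dw_span"
    by (intro dw_span_diff dw_span_zero assms)
  then show ?thesis
    using assms[THEN dw_span_closed] by (simp add: H.pres.minus_eq)
qed

lemma dw_span_prod:
  assumes d: "d \<in> Dset" and w: "w \<in> carrier W"
  shows "d \<star> hgrp w \<in> dw_span"
proof -
  obtain a where a: "a \<in> carrier T" "d = phi a" using Dset_phi[OF d] by blast
  have "phi a \<star> hgrp w \<in> dw_span"
    using a(1)
  proof (induction a rule: T.proj_induct)
    case zero
    then show ?case using w dw_span_zero by (simp add: phi_zero)
  next
    case (word \<tau>)
    have "phi (T.proj (frag_of \<tau>)) \<star> hgrp w = dw_proj (frag_of (\<tau>, w))"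
      using proj_dw_word[OF word w] by simp
    then show ?case
      unfolding dw_span_def using word w by (intro CollectI exI[of _ "frag_of (\<tau>, w)"]) simp
  next
    case (diff a b)
    have "phi (a \<ominus>\<^bsub>T\<^esub> b) \<star> hgrp w = phi a \<star> hgrp w \<boxminus> phi b \<star> hgrp w"
      using diff w phi_closed by (simp add: phi_diff H.pres.minus_eq H.pres.l_distr H.pres.l_minus)
    then show ?case using dw_span_diff diff by simp
  qed
  then show ?thesis using a by simp
qed

lemma dw_span_left:
  assumes x: "x \<in> dw_span" and g: "g \<in> carrier H"
    and step: "\<And>d w. d \<in> Dset \<Longrightarrow> w \<in> carrier W \<Longrightarrow> g \<star> (d \<star> hgrp w) \<in> dw_span"
  shows "g \<star> x \<in> dw_span"
proof -
  obtain P where P: "supp P \<subseteq> dw_index" "x = dw_proj P"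
    using x unfolding dw_span_def by blast
  have "g \<star> dw_proj P \<in> dw_span"
    using P(1)
  proof (induction P rule: frag_induct)
    case zero
    then show ?case using dw_span_zero g by (simp only: dw_proj_zero H.pres.r_null)
  next
    case (diff P Q)
    have "dw_proj P \<in> carrier H" "dw_proj Q \<in> carrier H"
      using dw_proj_closed diff(1,2) by simp_all
    then have "g \<star> dw_proj (P - Q) = g \<star> dw_proj P \<boxminus> g \<star> dw_proj Q"
      unfolding dw_proj_diff[OF diff(1,2)] using g by (simp add: H.pres.minus_eq H.pres.r_distr H.pres.r_minus)
    then show ?case using dw_span_diff diff by simp
  next
    case (one a)
    then obtain \<tau> w where a: "a = (\<tau>, w)" "\<tau> \<in> lists Rfl" "w \<in> carrier W" by auto
    have "T.proj (frag_of \<tau>) \<in> carrier T" using a by simp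
    then show ?case
      using step[OF phi_in_Dset a(3)] proj_dw_word[OF a(2,3)] a(1) by simp
  qed
  then show ?thesis using P by simp
qed

lemma carrier_H_dw_span:
  assumes "x \<in> carrier H"
  shows "x \<in> dw_span"
  using assms
proof (induction x rule: H.proj_induct)
  case (word u)
  then show ?case
  proof induction
    case Nil
    have "\<one>\<^bsub>H\<^esub> \<star> hgrp \<one>\<^bsub>W\<^esub> \<in> dw_span"
      by (rule dw_span_prod[OF subringE(3)[OF Dset_subring] W.one_closed])
    then show ?case by (simp add: H.proj_Nil)
  next
    case (Cons g u)
    let ?x = "H.proj (frag_of u)"
    from Cons(1) consider i where "i \<in> I" "g = GenS i" | i where "i \<in> I" "g = GenD i"
      by (auto simp: hecke_gens_def)
    then show ?case
    proof cases
      case (1 i)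
      have "Hs i \<star> ?x \<in> dw_span"
      proof (rule dw_span_left[OF Cons.IH H_s_closed[OF 1(1)]])
        fix d w assume d: "d \<in> Dset" and w: "w \<in> carrier W"
        obtain a where a: "a \<in> carrier T" "d = phi a" using Dset_phi[OF d] by blast
        obtain e e' where e: "e \<in> Dset" "e' \<in> Dset" "Hs i \<star> d = e \<star> Hs i \<boxplus> e'"
          using H_s_phi[OF 1(1) a(1)] a(2) by blast
        have "Hs i \<star> (d \<star> hgrp w) = (Hs i \<star> d) \<star> hgrp w"
          using 1 w Dset_closed[OF d] by (simp add: H.pres.m_assoc)
        also have "\<dots> = e \<star> hgrp (s i \<cdot> w) \<boxplus> e' \<star> hgrp w"
          unfolding e(3) using 1 w e(1,2)[THEN Dset_closed]
          by (simp add: hgrp_mult H.pres.m_assoc H.pres.l_distr)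
        also have "\<dots> \<in> dw_span"
          using 1 w e by (intro dw_span_add dw_span_prod) simp_all
        finally show "Hs i \<star> (d \<star> hgrp w) \<in> dw_span" .
      qed
      then show ?thesis
        using H.proj_Cons[OF Cons(1,2)] 1 by (simp add: H_s_def)
    next
      case (2 i)
      have "Hd i \<star> ?x \<in> dw_span"
      proof (rule dw_span_left[OF Cons.IH H_D_closed[OF 2(1)]])
        fix d w assume d: "d \<in> Dset" and w: "w \<in> carrier W"
        have "Hd i \<in> Dset"
          using d_family_Dset[of "s i"] 2 by simp
        then have "(Hd i \<star> d) \<star> hgrp w \<in> dw_span"
          by (intro dw_span_prod generate_ring.eng_mult d w)
        then show "Hd i \<star> (d \<star> hgrp w) \<in> dw_span"
          using 2 w Dset_closed[OF d] by (simp add: H.pres.m_assoc)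
      qed
      then show ?thesis
        using H.proj_Cons[OF Cons(1,2)] 2 by (simp add: H_D_def)
    qed
  qed
qed (simp_all add: dw_span_zero dw_span_diff)

section \<open>The isomorphism from the tensor product\<close>

lemma sum_insert_slice:
  assumes "finite K" "supp P \<subseteq> UNIV \<times> K"
  shows "(\<Sum>w\<in>K. insert_w w (slice w P)) = P"
  using assms(2)
proof (induction P rule: frag_induct)
  case (one a)
  obtain \<tau> v where a: "a = (\<tau>, v)" "v \<in> K" using one by auto
  have "(\<Sum>w\<in>K. insert_w w (slice w (frag_of a))) = (\<Sum>w\<in>K. if v = w then frag_of (\<tau>, w) else 0)"
    by (rule sum.cong) (simp_all add: a slice_def insert_w_def)
  then show ?case using assms(1) a by simp
qed (simp_all add: slice_def insert_w_def frag_extend_diff sum_subtractf)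

lemma keys_slice:
  assumes "supp P \<subseteq> dw_index"
  shows "supp (slice w P) \<subseteq> lists Rfl"
  using assms
proof (induction P rule: frag_induct)
  case (one a)
  then show ?case
    by (cases "snd a = w") (auto simp: slice_def case_prod_unfold)
qed (simp_all add: slice_def frag_extend_diff keys_diff_subset)

lemma keys_insert_w:
  assumes "supp p \<subseteq> lists Rfl" "w \<in> carrier W"
  shows "supp (insert_w w p) \<subseteq> dw_index"
  using assms(1)
  by (induction p rule: frag_induct)
    (use assms(2) in \<open>simp_all add: insert_w_def frag_extend_diff keys_diff_subset\<close>)

text \<open>Injectivity needs no explicit inverse: the free abelian group on pairs of a word and a
  group element maps onto the tensor product by \<open>\<kappa>\<close>, \<open>\<mu>\<close> after
  \<open>\<kappa>\<close> is \<open>dw_proj\<close>, and \<open>\<kappa>\<close> kills whatever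
  \<open>dw_proj\<close> kills. Surjectivity is the spanning result.\<close>

lemma hecke_tensor_factorization:
  defines "A \<equiv> add_monoid (D_hat I m)" and "B \<equiv> add_monoid (monoid_ring W)" and "C \<equiv> add_monoid H"
  shows "\<exists>\<mu>\<in>iso (tensor_group A B) C. \<forall>d\<in>carrier (D_hat I m). \<forall>x\<in>carrier (monoid_ring W).
    \<mu> (pure_tensor A B d x) = d \<star> group_ring_map I m x"
proof -
  have A_simps: "carrier A = Dset" "\<And>a b. a \<otimes>\<^bsub>A\<^esub> b = a \<boxplus> b" "\<one>\<^bsub>A\<^esub> = \<zero>\<^bsub>H\<^esub>"
    by (simp_all add: A_def D_hat_simps)
  have B_simps: "\<And>x. x \<in> carrier B \<longleftrightarrow> supp x \<subseteq> carrier W"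
    "\<And>a b. a \<otimes>\<^bsub>B\<^esub> b = a + b" "\<one>\<^bsub>B\<^esub> = 0"
    by (simp_all add: B_def)
  have C_simps: "carrier C = carrier H" "\<And>a b. a \<otimes>\<^bsub>C\<^esub> b = a \<boxplus> b" "\<one>\<^bsub>C\<^esub> = \<zero>\<^bsub>H\<^esub>"
    by (simp_all add: C_def)
  have AG: "comm_group A" and BG: "comm_group B" and CG: "comm_group C"
    unfolding A_def B_def C_def
    by (rule abelian_group.a_comm_group[OF ring.is_abelian_group],
        rule ring_D_hat ring_monoid_ring[OF W.is_monoid] H.pres.ring_axioms)+
  have C_group: "group C" by (rule comm_group.axioms(2)[OF CG])
  have tp: "tensor_pair A B" by (rule tensor_pair.intro[OF AG BG])
  let ?Q = "tensor_group A B"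
  let ?pure = "pure_tensor A B"
  let ?g = "group_ring_map I m"
  note Q_group = tensor_pair.Q_group[OF tp]
  note pure_closed = tensor_pair.pure_tensor_closed[OF tp, unfolded A_simps B_simps]
  have inv_C: "inv\<^bsub>C\<^esub> x = \<ominus>\<^bsub>H\<^esub> x" for x
    unfolding C_def a_inv_def ..
  have g_closed: "?g x \<in> carrier H" if "supp x \<subseteq> carrier W" for x
    using ring_hom_closed[OF group_ring_map(1)] that by simp
  have g_add: "?g (x + y) = ?g x \<boxplus> ?g y"
    if "supp x \<subseteq> carrier W" "supp y \<subseteq> carrier W" for x y
    using ring_hom_add[OF group_ring_map(1), of x y] that by simp
  obtain \<mu> where \<mu>: "\<mu> \<in> hom ?Q C"
    and \<mu>_pure: "\<And>d x. d \<in> Dset \<Longrightarrow> supp x \<subseteq> carrier W \<Longrightarrow> \<mu> (?pure d x) = d \<star> ?g x"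
  proof (rule tensor_pair.tensor_universal[OF tp CG, of "\<lambda>d x. d \<star> ?g x"])
    fix \<mu> assume "\<mu> \<in> hom ?Q C"
      "\<And>a b. a \<in> carrier A \<Longrightarrow> b \<in> carrier B \<Longrightarrow> \<mu> (?pure a b) = a \<star> ?g b"
    then show thesis using that[of \<mu>] unfolding A_simps B_simps by blast
  qed (unfold A_simps B_simps C_simps, simp_all add: Dset_closed g_closed g_add H.pres.l_distr H.pres.r_distr)
  have "(\<lambda>(\<tau>, w). ?pure (phi (T.proj (frag_of \<tau>))) (frag_of w)) ` dw_index \<subseteq> carrier ?Q"
  proof (rule image_subsetI)
    fix a assume "a \<in> dw_index"
    then obtain \<tau> w where a: "a = (\<tau>, w)" "\<tau> \<in> lists Rfl" "w \<in> carrier W" by auto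
    have "T.proj (frag_of \<tau>) \<in> carrier T" using a by simp
    then show "(\<lambda>(\<tau>, w). ?pure (phi (T.proj (frag_of \<tau>))) (frag_of w)) a \<in> carrier ?Q"
      using a pure_closed[OF phi_in_Dset] by simp
  qed
  then obtain \<kappa> where \<kappa>: "\<kappa> \<in> hom (free_Abelian_group dw_index) ?Q"
    and \<kappa>_of: "\<And>\<tau> w. \<tau> \<in> lists Rfl \<Longrightarrow> w \<in> carrier W \<Longrightarrow>
      \<kappa> (frag_of (\<tau>, w)) = ?pure (phi (T.proj (frag_of \<tau>))) (frag_of w)"
    by (rule comm_group.free_Abelian_group_universal[OF tensor_pair.Q_comm_group[OF tp]]) auto
  note \<kappa>_zero = hom_free_Abelian_group_zero[OF Q_group \<kappa>]
  note \<kappa>_diff = hom_free_Abelian_group_diff[OF Q_group \<kappa>]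
  have \<kappa>_closed: "\<kappa> P \<in> carrier ?Q" if "supp P \<subseteq> dw_index" for P
    using hom_in_carrier[OF \<kappa>] that by simp
  have gh: "group_hom ?Q C \<mu>"
    using \<mu> Q_group C_group by (simp add: group_hom_def group_hom_axioms_def)
  have \<mu>_one: "\<mu> \<one>\<^bsub>?Q\<^esub> = \<zero>\<^bsub>H\<^esub>"
    using group_hom.hom_one[OF gh] by (simp add: C_simps)
  have \<mu>_diff: "\<mu> (x \<otimes>\<^bsub>?Q\<^esub> inv\<^bsub>?Q\<^esub> y) = \<mu> x \<boxminus> \<mu> y" if "x \<in> carrier ?Q" "y \<in> carrier ?Q" for x y
    using group_hom.hom_mult[OF gh that(1) group.inv_closed[OF Q_group that(2)]] group_hom.hom_inv[OF gh that(2)]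
    by (simp only: C_simps inv_C H.pres.minus_eq)
  have \<mu>\<kappa>: "\<mu> (\<kappa> P) = dw_proj P" if "supp P \<subseteq> dw_index" for P
    using that
  proof (induction P rule: frag_induct)
    case zero
    then show ?case by (simp only: \<kappa>_zero \<mu>_one dw_proj_zero)
  next
    case (diff P P')
    then show ?case by (simp only: \<kappa>_diff \<mu>_diff \<kappa>_closed dw_proj_diff)
  next
    case (one a)
    then obtain \<tau> w where a: "a = (\<tau>, w)" "\<tau> \<in> lists Rfl" "w \<in> carrier W" by auto
    have "phi (T.proj (frag_of \<tau>)) \<in> Dset" using a by (intro phi_in_Dset) simp
    then show ?case
      using a \<kappa>_of[OF a(2,3)] \<mu>_pure group_ring_map(2)[OF a(3)] proj_dw_word[OF a(2,3)] by simp
  qed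
  have pure_zero_left: "?pure \<zero>\<^bsub>H\<^esub> x = \<one>\<^bsub>?Q\<^esub>" if "supp x \<subseteq> carrier W" for x
    using tensor_pair.pure_tensor_one_left[OF tp, of x] that by (simp add: A_simps B_simps)
  have pure_diff_left: "?pure (phi (a \<ominus>\<^bsub>T\<^esub> b)) x = ?pure (phi a) x \<otimes>\<^bsub>?Q\<^esub> inv\<^bsub>?Q\<^esub> ?pure (phi b) x"
    if "a \<in> carrier T" "b \<in> carrier T" "supp x \<subseteq> carrier W" for a b x
  proof (rule tensor_pair.pure_tensor_diff_left[OF tp])
    have "a = (a \<ominus>\<^bsub>T\<^esub> b) \<oplus>\<^bsub>T\<^esub> b"
      using that by (simp add: T.pres.minus_eq T.pres.a_assoc T.pres.l_neg)
    then show "phi a = phi (a \<ominus>\<^bsub>T\<^esub> b) \<otimes>\<^bsub>A\<^esub> phi b"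
      unfolding A_simps using phi_add[of "a \<ominus>\<^bsub>T\<^esub> b" b] that by simp
  qed (use that in \<open>simp_all add: A_simps B_simps phi_in_Dset\<close>)
  \<comment> \<open>Inductions over the group ring and over \<open>T\<close> reduce every pure
    tensor to one of a product of idempotents with a group element, which is a value of
    \<open>\<kappa>\<close>.\<close>
  have range_\<kappa>: "\<exists>P. supp P \<subseteq> dw_index \<and> \<kappa> P = q" if "q \<in> carrier ?Q" for q
  proof -
    define M where "M = \<kappa> ` carrier (free_Abelian_group dw_index)"
    have M: "subgroup M ?Q"
      unfolding M_def using \<kappa> Q_group
      by (intro group_hom.img_is_subgroup) (simp add: group_hom_def group_hom_axioms_def)
    note M_one = subgroup.one_closed[OF M]
    have M_diff: "x \<otimes>\<^bsub>?Q\<^esub> inv\<^bsub>?Q\<^esub> y \<in> M" if "x \<in> M" "y \<in> M" for x y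
      by (rule subgroup.m_closed[OF M that(1) subgroup.m_inv_closed[OF M that(2)]])
    have "?pure (phi a) x \<in> M" if a: "a \<in> carrier T" and x: "supp x \<subseteq> carrier W" for a x
      using x
    proof (induction x rule: frag_induct)
      case zero
      then show ?case
        using tensor_pair.pure_tensor_one_right[OF tp, of "phi a"] phi_in_Dset[OF a] M_one
        by (simp add: A_simps B_simps)
    next
      case (diff x y)
      have "?pure (phi a) (x - y) = ?pure (phi a) x \<otimes>\<^bsub>?Q\<^esub> inv\<^bsub>?Q\<^esub> ?pure (phi a) y"
        using diff(1,2) phi_in_Dset[OF a]
        by (intro tensor_pair.pure_tensor_diff_right[OF tp]) (simp_all add: A_simps B_simps keys_diff_subset)
      then show ?case using M_diff diff by simp
    next
      case (one w)
      show ?case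
        using a
      proof (induction a rule: T.proj_induct)
        case zero
        then show ?case using pure_zero_left one M_one by (simp add: phi_zero)
      next
        case (word \<tau>)
        then show ?case
          unfolding M_def using one \<kappa>_of by (intro image_eqI[of _ _ "frag_of (\<tau>, w)"]) simp_all
      next
        case (diff a b)
        then show ?case using pure_diff_left one M_diff by simp
      qed
    qed
    then have pure_M: "?pure d x \<in> M" if "d \<in> Dset" "supp x \<subseteq> carrier W" for d x
      using that Dset_phi by metis
    have "q \<in> M"
    proof (rule tensor_pair.tensor_induct[OF tp that])
      show "?pure d x \<in> M" if "d \<in> carrier A" "x \<in> carrier B" for d x
        using pure_M that unfolding A_simps B_simps by blast
    qed (rule M_one, rule M_diff)
    then show ?thesis
      unfolding M_def by (elim imageE) (simp only: carrier_free_Abelian_group_iff, blast)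
  qed
  have \<kappa>_insert: "\<kappa> (insert_w w p) = ?pure (phi (T.proj p)) (frag_of w)"
    if "supp p \<subseteq> lists Rfl" and w: "w \<in> carrier W" for p w
    using that(1)
  proof (induction p rule: frag_induct)
    case zero
    then show ?case
      using \<kappa>_zero pure_zero_left w T.proj.hom_zero phi_zero by (simp add: insert_w_def)
  next
    case (diff p q)
    have "\<kappa> (insert_w w (p - q)) = \<kappa> (insert_w w p) \<otimes>\<^bsub>?Q\<^esub> inv\<^bsub>?Q\<^esub> \<kappa> (insert_w w q)"
      using \<kappa>_diff keys_insert_w diff(1,2) w by (simp add: insert_w_def frag_extend_diff)
    moreover have "T.proj p \<in> carrier T" "T.proj q \<in> carrier T"
      using diff by simp_all
    ultimately show ?case
      using diff pure_diff_left w by (simp add: T.proj_diff)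
  next
    case (one \<tau>)
    then show ?case using \<kappa>_of w by (simp add: insert_w_def)
  qed
  \<comment> \<open>\<open>P\<close> is the finite sum of its slices put back in place. By
    independence each slice vanishes in \<open>T\<close>, so \<open>\<kappa>\<close> maps its part
    to a pure tensor with left factor zero.\<close>
  have \<kappa>_eq_one: "\<kappa> P = \<one>\<^bsub>?Q\<^esub>" if P: "supp P \<subseteq> dw_index" and zero: "dw_proj P = \<zero>\<^bsub>H\<^esub>" for P
  proof -
    define K where "K = snd ` supp P"
    have K: "finite K" "K \<subseteq> carrier W" "supp P \<subseteq> UNIV \<times> K"
      using P by (force simp: K_def)+
    have ins: "\<kappa> (insert_w w (slice w P)) = \<one>\<^bsub>?Q\<^esub>" "supp (insert_w w (slice w P)) \<subseteq> dw_index"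
      if "w \<in> carrier W" for w
    proof -
      have "T.proj (slice w P) = \<zero>\<^bsub>T\<^esub>"
        using T.proj_eq_zero_iff[OF keys_slice[OF P]] slice_relideal[OF P zero[unfolded dw_proj_def] that] by simp
      then show "\<kappa> (insert_w w (slice w P)) = \<one>\<^bsub>?Q\<^esub>"
        using \<kappa>_insert[OF keys_slice[OF P] that] pure_zero_left that by (simp add: phi_zero)
      show "supp (insert_w w (slice w P)) \<subseteq> dw_index"
        by (rule keys_insert_w[OF keys_slice[OF P] that])
    qed
    have "\<kappa> (\<Sum>w\<in>K'. insert_w w (slice w P)) = \<one>\<^bsub>?Q\<^esub> \<and>
        supp (\<Sum>w\<in>K'. insert_w w (slice w P)) \<subseteq> dw_index" if "K' \<subseteq> carrier W" "finite K'" for K'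
      using that(2,1)
    proof (induction K' rule: finite_induct)
      case empty
      then show ?case using \<kappa>_zero by simp
    next
      case (insert w K')
      let ?x = "insert_w w (slice w P)" and ?y = "\<Sum>w\<in>K'. insert_w w (slice w P)"
      have x: "\<kappa> ?x = \<one>\<^bsub>?Q\<^esub>" "supp ?x \<subseteq> dw_index" using ins insert by simp_all
      have y: "\<kappa> ?y = \<one>\<^bsub>?Q\<^esub>" "supp ?y \<subseteq> dw_index" using insert by simp_all
      have "\<kappa> (?x + ?y) = \<one>\<^bsub>?Q\<^esub> \<otimes>\<^bsub>?Q\<^esub> \<one>\<^bsub>?Q\<^esub>"
        using hom_mult[OF \<kappa>, of ?x ?y] x y by simp
      moreover have "supp (?x + ?y) \<subseteq> dw_index"
        using x(2) y(2) keys_add[of ?x ?y] by blast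
      ultimately show ?case
        using insert(1,2) group.is_monoid[OF Q_group, THEN monoid.l_one] group.is_monoid[OF Q_group, THEN monoid.one_closed]
        by simp
    qed
    from this[OF K(2,1)] show ?thesis
      unfolding sum_insert_slice[OF K(1,3)] by blast
  qed
  have "\<mu> \<in> iso ?Q C"
  proof (rule isoI[OF \<mu>], unfold bij_betw_def, rule conjI)
    show "inj_on \<mu> (carrier ?Q)"
    proof (rule inj_onI)
      fix x y assume xy: "x \<in> carrier ?Q" "y \<in> carrier ?Q" "\<mu> x = \<mu> y"
      let ?z = "x \<otimes>\<^bsub>?Q\<^esub> inv\<^bsub>?Q\<^esub> y"
      have z: "?z \<in> carrier ?Q"
        by (rule monoid.m_closed[OF group.is_monoid[OF Q_group] xy(1) group.inv_closed[OF Q_group xy(2)]])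
      obtain P where P: "supp P \<subseteq> dw_index" "\<kappa> P = ?z"
        using range_\<kappa>[OF z] by blast
      have "\<mu> y \<in> carrier H" using hom_in_carrier[OF \<mu> xy(2)] by (simp add: C_simps)
      then have "dw_proj P = \<zero>\<^bsub>H\<^esub>"
        using \<mu>\<kappa>[OF P(1)] \<mu>_diff[OF xy(1,2)] xy(3) P(2) H.pres.r_right_minus_eq[of "\<mu> y" "\<mu> y"]
        by simp
      then have "?z = \<one>\<^bsub>?Q\<^esub>" using \<kappa>_eq_one[OF P(1)] P(2) by simp
      then show "x = y" using group.mult_inv_eq_one_iff[OF Q_group xy(1,2)] by simp
    qed
    show "\<mu> ` carrier ?Q = carrier C"
    proof
      show "\<mu> ` carrier ?Q \<subseteq> carrier C" using hom_in_carrier[OF \<mu>] by blast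
      show "carrier C \<subseteq> \<mu> ` carrier ?Q"
      proof
        fix x assume "x \<in> carrier C"
        then have "x \<in> dw_span" using carrier_H_dw_span by (simp add: C_simps)
        then obtain P where "supp P \<subseteq> dw_index" "x = dw_proj P"
          unfolding dw_span_def by blast
        then show "x \<in> \<mu> ` carrier ?Q" using \<mu>\<kappa> \<kappa>_closed by (metis image_eqI)
      qed
    qed
  qed
  then show ?thesis
    using \<mu>_pure unfolding D_hat_simps(1) by (intro bexI[of _ \<mu>] ballI) simp_all
qed

end

theorem theorem1p22:
  fixes I :: "'i set" and m :: "'i \<Rightarrow> 'i \<Rightarrow> nat"
  assumes "coxeter_matrix I m"
  shows
    "(\<exists>\<phi> \<in> ring_iso
        (presented_ring (reflections I m) (idempotent_relators (reflections I m))) (D_hat I m).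
        \<forall>s \<in> reflections I m.
          \<phi> (ring_gen (reflections I m) (idempotent_relators (reflections I m)) s) = D_refl I m s)
     \<and>
     (\<exists>\<mu> \<in> iso
        (tensor_group (add_monoid (D_hat I m)) (add_monoid (monoid_ring (coxeter_group I m))))
        (add_monoid (H_hat I m)).
        \<forall>d \<in> carrier (D_hat I m). \<forall>x \<in> carrier (monoid_ring (coxeter_group I m)).
          \<mu> (pure_tensor (add_monoid (D_hat I m)) (add_monoid (monoid_ring (coxeter_group I m))) d x)
            = d \<otimes>\<^bsub>H_hat I m\<^esub> group_ring_map I m x)"
proof
  have cox: "coxeter I m" by (rule coxeter.intro[OF assms])
  show "\<exists>\<phi> \<in> ring_iso
        (presented_ring (reflections I m) (idempotent_relators (reflections I m))) (D_hat I m).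
        \<forall>s \<in> reflections I m.
          \<phi> (ring_gen (reflections I m) (idempotent_relators (reflections I m)) s) = D_refl I m s"
    unfolding coxeter.D_refl_eq[OF cox]
    using coxeter.D_hat_presentation[OF cox] coxeter.phi_gen[OF cox] by blast
qed (rule coxeter.hecke_tensor_factorization[OF coxeter.intro[OF assms]])

end
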